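(* Let $K$ be an infinite field that is finitely generated over its prime field, and let $e\geq 1$ be an integer. Then for almost all $\boldsymbol{\sigma}\in\mathrm{Gal}(K)^e$ the field $K_s(\boldsymbol{\sigma})$ is a Galois extension of no proper subfield.
   Context: $K_s$ is the separable closure of $K$ and $\mathrm{Gal}(K)=\mathrm{Gal}(K_s/K)$ with the Krull topology. "For almost all" means for all outside a set of measure zero with respect to the normalized Haar measure on the compact group $\mathrm{Gal}(K)^e$. For $\boldsymbol{\sigma}=(\sigma_1,\ldots,\sigma_e)\in\mathrm{Gal}(K)^e$, $K_s(\boldsymbol{\sigma})=\{x\in K_s\mid\sigma_i(x)=x\text{ for all }i\}$. The proper subfields are arbitrary (not assumed to contain $K$), and Galois extensions may be infinite. *)

theory Defs
  imports
    "HOL-Algebra.Algebraic_Closure_Type"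
    "HOL-Algebra.Generated_Fields"
    "HOL-Algebra.Bij"
    "HOL-Algebra.Product_Groups"
    "HOL-Probability.Probability_Measure"
begin

text \<open>
  Subfields are subsets of a field type, regarded as a HOL-Algebra ring via
  \<^const>\<open>ring_of_type_algebra\<close>.  Polynomials over a subfield \<open>F\<close> of an algebraically closed
  field \<open>\<Omega>\<close> are polynomials over \<open>\<Omega>\<close> all of whose coefficients lie in \<open>F\<close>.
\<close>

abbreviation subfield_of_type :: "'a::field set \<Rightarrow> bool" where
  "subfield_of_type F \<equiv> subfield F (ring_of_type_algebra :: 'a ring)"

definition fin_gen_over_prime_field :: "'a::field itself \<Rightarrow> bool" where
  "fin_gen_over_prime_field _ \<longleftrightarrow>
     (\<exists>S. finite S \<and> generate_field (ring_of_type_algebra :: 'a ring) S = UNIV)"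


section \<open>Separable, normal and Galois extensions\<close>

definition polys_over :: "'a::field set \<Rightarrow> 'a poly set" where
  "polys_over F = {p. \<forall>i. Polynomial.coeff p i \<in> F}"

definition is_min_poly :: "'a::field set \<Rightarrow> 'a \<Rightarrow> 'a poly \<Rightarrow> bool" where
  "is_min_poly F x p \<longleftrightarrow>
     p \<in> polys_over F \<and> Polynomial.lead_coeff p = 1 \<and> poly p x = 0 \<and>
     (\<forall>q \<in> polys_over F. q \<noteq> 0 \<longrightarrow> poly q x = 0 \<longrightarrow> Polynomial.degree p \<le> Polynomial.degree q)"

text \<open>
  The element \<open>x\<close> is algebraic over \<open>F\<close> and its minimal polynomial has no multiple root.  As
  \<^const>\<open>rsquarefree\<close> only looks at roots in the type itself, that type has to be algebraically
  closed here.
\<close>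
definition separable_over :: "'a::alg_closed_field set \<Rightarrow> 'a \<Rightarrow> bool" where
  "separable_over F x \<longleftrightarrow> (\<exists>p. is_min_poly F x p \<and> rsquarefree p)"

definition separable_extension :: "'a::alg_closed_field set \<Rightarrow> 'a set \<Rightarrow> bool" where
  "separable_extension F L \<longleftrightarrow> (\<forall>x\<in>L. separable_over F x)"

definition normal_extension :: "'a::alg_closed_field set \<Rightarrow> 'a set \<Rightarrow> bool" where
  "normal_extension F L \<longleftrightarrow>
     (\<forall>x\<in>L. \<exists>p. is_min_poly F x p \<and> (\<forall>y. poly p y = 0 \<longrightarrow> y \<in> L))"

text \<open>Possibly infinite Galois extensions.\<close>
definition galois_extension :: "'a::alg_closed_field set \<Rightarrow> 'a set \<Rightarrow> bool" where
  "galois_extension F L \<longleftrightarrow>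
     subfield_of_type F \<and> subfield_of_type L \<and> F \<subseteq> L \<and>
     separable_extension F L \<and> normal_extension F L"

definition sep_closure :: "'a::alg_closed_field set \<Rightarrow> 'a set" where
  "sep_closure F = {x. separable_over F x}"


section \<open>Galois groups and the Krull topology\<close>

text \<open>
  The group of automorphisms of \<open>N\<close> over \<open>F\<close>.  As in \<^const>\<open>BijGroup\<close>, its elements are maps
  that are undefined outside of \<open>N\<close>, so that each automorphism is represented exactly once.
\<close>
definition gal_group :: "'a::field set \<Rightarrow> 'a set \<Rightarrow> ('a \<Rightarrow> 'a) monoid" where
  "gal_group F N = (BijGroup N)
     \<lparr> carrier := {s \<in> Bij N.
         s \<in> ring_hom ((ring_of_type_algebra :: 'a ring) \<lparr> carrier := N \<rparr>)
                      ((ring_of_type_algebra :: 'a ring) \<lparr> carrier := N \<rparr>) \<and>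
         (\<forall>x\<in>F. s x = x)} \<rparr>"

definition finite_galois_subextension ::
    "'a::alg_closed_field set \<Rightarrow> 'a set \<Rightarrow> 'a set \<Rightarrow> bool" where
  "finite_galois_subextension F N L \<longleftrightarrow>
     L \<subseteq> N \<and> galois_extension F L \<and>
     ring.finite_dimension (ring_of_type_algebra :: 'a ring) F L"

text \<open>The basic open sets are the left cosets of \<open>Gal(N/L)\<close> with \<open>L/F\<close> finite Galois.\<close>
definition krull_topology :: "'a::alg_closed_field set \<Rightarrow> 'a set \<Rightarrow> ('a \<Rightarrow> 'a) topology" where
  "krull_topology F N = topology_generated_by
     {s <#\<^bsub>gal_group F N\<^esub> carrier (gal_group L N) | s L.
        s \<in> carrier (gal_group F N) \<and> finite_galois_subextension F N L}"


section \<open>Normalized Haar measure on a compact group\<close>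

text \<open>
  A regular, left invariant Borel probability measure.  Right invariance is automatic for
  compact groups, and these conditions determine \<open>M\<close> uniquely.
\<close>
definition normalized_haar_measure ::
    "('g, 'm) monoid_scheme \<Rightarrow> 'g topology \<Rightarrow> 'g measure \<Rightarrow> bool" where
  "normalized_haar_measure G T M \<longleftrightarrow>
     prob_space M \<and>
     space M = topspace T \<and>
     sets M = sigma_sets (topspace T) {U. openin T U} \<and>
     (\<forall>a \<in> carrier G. \<forall>A \<in> sets M. a <#\<^bsub>G\<^esub> A \<in> sets M \<and> emeasure M (a <#\<^bsub>G\<^esub> A) = emeasure M A) \<and>
     (\<forall>A \<in> sets M. \<forall>\<epsilon>>0. \<exists>U C. openin T U \<and> closedin T C \<and> C \<subseteq> A \<and> A \<subseteq> U \<and>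
        emeasure M (U - C) < \<epsilon>)"


section \<open>The absolute Galois group of a field and its powers\<close>

text \<open>
  The field \<open>K\<close> is a type \<open>'a\<close>, identified with its image in its algebraic closure
  \<^typ>\<open>'a alg_closure\<close>.
\<close>
definition base_field :: "'a::field alg_closure set" where
  "base_field = range to_ac"

definition sep_closure_field :: "'a::field alg_closure set" where
  "sep_closure_field = sep_closure base_field"

definition abs_gal_power ::
    "nat \<Rightarrow> (nat \<Rightarrow> 'a::field alg_closure \<Rightarrow> 'a alg_closure) monoid" where
  "abs_gal_power e = product_group {..<e} (\<lambda>_. gal_group base_field sep_closure_field)"

definition abs_gal_power_topology ::
    "nat \<Rightarrow> (nat \<Rightarrow> 'a::field alg_closure \<Rightarrow> 'a alg_closure) topology" where
  "abs_gal_power_topology e =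
     product_topology (\<lambda>_. krull_topology base_field sep_closure_field) {..<e}"

definition fixed_field ::
    "nat \<Rightarrow> (nat \<Rightarrow> 'a::field alg_closure \<Rightarrow> 'a alg_closure) \<Rightarrow> 'a alg_closure set" where
  "fixed_field e \<sigma> = {x \<in> sep_closure_field. \<forall>i<e. \<sigma> i x = x}"

end

(*
  Let M be the fixed field of sigma and suppose that M is a Galois extension of a proper subfield E.
  Take x in M outside E and another root x' of its minimal polynomial over E.  If c is in E and
  y^2 + y = c x has a root y in M, then a conjugate of y over E is a root y' of y'^2 + y' = c x',
  and it lies in M by normality.  So it suffices that, for almost all sigma fixing x and x', some c
  in E has y in M and y' not in M.  There are only countably many pairs (x, x').  The elements c are
  taken from the integers in characteristic 0, and from F_p[t] with t in E transcendental in
  characteristic p; E contains these rings without having to contain K.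

  For the null set one adjoins pairs (y, y') one after the other.  As long as y, y' and
  y + y' + 2 y y' lie outside a finitely generated field F containing the previous ones, left
  translation by automorphisms over F flips y and y' independently, and the invariance of the Haar
  measure shows that the set of sigma failing for all c so far shrinks by the factor 1 - 4^(-e).

  Hence the arithmetic core: for a finitely generated field F and distinct nonzero a, b in F there
  is c such that none of c a, c b and c a + c b + 4 c^2 a b has the form w^2 + w with w in F.  Up to
  a power of the characteristic exponent, F lies in a simple separable extension of the fraction
  field of a polynomial ring over D = Z or F_p[t].  Specializing the variables and reducing modulo
  primes of D at which the defining polynomial has a simple root, one is left with conditions on c
  modulo three primes.
*)
theory Submission
  imports Defs
begin

hide_const (open) Polynomials.degree Polynomials.lead_coeff

section \<open>Subrings, subfields and polynomials over them\<close>

text \<open>The expression \<open>y^2 + y\<close> serves all characteristics at once: it is the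
  Artin-Schreier map if 2 = 0, and otherwise 4 (y^2 + y) + 1 = (2 y + 1)^2, so that solving y^2 + y
  = A means extracting a square root of 1 + 4 A. The two roots are y and -1 - y. The number 4^e
  counts the ways of flipping or keeping y and y' in each of the e coordinates. The obstacle is that
  the family of possible fields E need not be countable, so no null set can be attached to E itself.
  Only x, x' and one element t of E enter, and these form triples in a countable field. That K is
  infinite guarantees a transcendental t in E when the characteristic is p. For the same reason c is
  sought in the ring generated by t, which lies in every candidate E. Z and F_p[t] are treated
  together as Euclidean rings with finite residue fields. Inseparability is removed by q-th powers
  with q a power of the characteristic exponent: w^2 + w = c x implies (w^q)^2 + w^q = c^q x^q, and
  c^q still runs through all residues modulo a prime, because the Frobenius map of a finite field is
  bijective.\<close>

definition subrng :: "'b::comm_ring_1 set \<Rightarrow> bool" where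
  "subrng R \<longleftrightarrow> 0 \<in> R \<and> 1 \<in> R \<and> (\<forall>x\<in>R. \<forall>y\<in>R. x + y \<in> R \<and> x * y \<in> R) \<and> (\<forall>x\<in>R. - x \<in> R)"

text \<open>Since \<open>inverse 0 = 0\<close>, closure under inverses needs no exception for 0. The
  type class operations keep computations free of ring records.\<close>

definition subfld :: "'b::field set \<Rightarrow> bool" where
  "subfld F \<longleftrightarrow> subrng F \<and> (\<forall>x\<in>F. inverse x \<in> F)"

lemma subrng_0: "subrng R \<Longrightarrow> 0 \<in> R" and subrng_1: "subrng R \<Longrightarrow> 1 \<in> R"
  and subrng_add: "subrng R \<Longrightarrow> x \<in> R \<Longrightarrow> y \<in> R \<Longrightarrow> x + y \<in> R"
  and subrng_mult: "subrng R \<Longrightarrow> x \<in> R \<Longrightarrow> y \<in> R \<Longrightarrow> x * y \<in> R"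
  and subrng_uminus: "subrng R \<Longrightarrow> x \<in> R \<Longrightarrow> - x \<in> R"
  by (auto simp: subrng_def)

lemma subrng_diff: "subrng R \<Longrightarrow> x \<in> R \<Longrightarrow> y \<in> R \<Longrightarrow> x - y \<in> R"
  using subrng_add[of R x "- y"] subrng_uminus[of R y] by simp

lemma subrng_power: "subrng R \<Longrightarrow> x \<in> R \<Longrightarrow> x ^ n \<in> R"
  by (induction n) (auto intro: subrng_1 subrng_mult)

lemma subrng_sum: "subrng R \<Longrightarrow> (\<And>i. i \<in> A \<Longrightarrow> f i \<in> R) \<Longrightarrow> sum f A \<in> R"
  by (induction A rule: infinite_finite_induct) (auto intro: subrng_0 subrng_add)

lemma subrng_of_nat: "subrng R \<Longrightarrow> of_nat n \<in> R"
  by (induction n) (auto intro: subrng_0 subrng_1 subrng_add)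

lemma subrng_numeral: "subrng R \<Longrightarrow> numeral n \<in> R"
  using subrng_of_nat[of R "numeral n"] by simp

lemma subrng_of_int: "subrng R \<Longrightarrow> of_int n \<in> R"
  by (cases n rule: int_cases2) (auto intro: subrng_of_nat subrng_uminus)

lemmas subrng_intros = subrng_0 subrng_1 subrng_add subrng_mult subrng_uminus subrng_diff
  subrng_power subrng_sum subrng_of_nat subrng_numeral subrng_of_int

lemma subfld_subrng: "subfld F \<Longrightarrow> subrng F"
  and subfld_inverse: "subfld F \<Longrightarrow> x \<in> F \<Longrightarrow> inverse x \<in> F"
  by (auto simp: subfld_def)

lemma subfld_divide: "subfld F \<Longrightarrow> x \<in> F \<Longrightarrow> y \<in> F \<Longrightarrow> x / y \<in> F"
  by (simp add: divide_inverse subfld_inverse subfld_subrng subrng_mult)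

lemmas subfld_intros = subrng_intros[OF subfld_subrng] subfld_inverse subfld_divide

section \<open>Translation from HOL-Algebra subfields\<close>

lemma ring_of_type_algebra_simps:
  "carrier (ring_of_type_algebra :: 'b::field ring) = UNIV"
  "x \<otimes>\<^bsub>(ring_of_type_algebra :: 'b::field ring)\<^esub> y = x * y"
  "x \<oplus>\<^bsub>(ring_of_type_algebra :: 'b::field ring)\<^esub> y = x + y"
  "\<zero>\<^bsub>(ring_of_type_algebra :: 'b::field ring)\<^esub> = 0"
  "\<one>\<^bsub>(ring_of_type_algebra :: 'b::field ring)\<^esub> = 1"
  by (simp_all add: ring_of_type_algebra_def)

lemma ring_of_type_algebra_a_inv: "\<ominus>\<^bsub>(ring_of_type_algebra :: 'b::field ring)\<^esub> x = - x"
proof -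
  interpret field "ring_of_type_algebra :: 'b ring" by (rule field_from_type_algebra)
  show ?thesis using minus_equality[of "- x" x] by (simp add: ring_of_type_algebra_simps)
qed

lemma ring_of_type_algebra_m_inv:
  assumes "x \<noteq> 0" shows "inv\<^bsub>(ring_of_type_algebra :: 'b::field ring)\<^esub> x = inverse x"
proof -
  interpret field "ring_of_type_algebra :: 'b ring" by (rule field_from_type_algebra)
  show ?thesis using comm_inv_char[of x "inverse x"] assms by (simp add: ring_of_type_algebra_simps)
qed

lemma subfield_of_type_iff: "subfield_of_type F \<longleftrightarrow> subfld (F :: 'b::field set)"
proof -
  interpret field "ring_of_type_algebra :: 'b ring" by (rule field_from_type_algebra)
  show ?thesis
  proof
    assume F: "subfield_of_type F"
    have "inverse x \<in> F" if "x \<in> F" for x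
    proof (cases "x = 0")
      case False
      then show ?thesis using subfield_m_inv(1)[OF F, of x] that
        by (simp add: ring_of_type_algebra_simps ring_of_type_algebra_m_inv)
    qed (use that in simp)
    then show "subfld F" using subringE[OF subfieldE(1)[OF F]]
      by (auto simp: subfld_def subrng_def ring_of_type_algebra_simps ring_of_type_algebra_a_inv)
  next
    assume F: "subfld F"
    show "subfield_of_type F"
    proof (rule subfieldI')
      show "subring F ring_of_type_algebra"
        by (rule subringI) (use F in \<open>auto simp: ring_of_type_algebra_simps ring_of_type_algebra_a_inv
              intro: subfld_intros\<close>)
    qed (use F in \<open>auto simp: ring_of_type_algebra_simps ring_of_type_algebra_m_inv intro: subfld_intros\<close>)
  qed
qed

section \<open>Polynomials with coefficients in a subring\<close>

lemma polys_overD: "p \<in> polys_over R \<Longrightarrow> coeff p i \<in> R"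
  by (simp add: polys_over_def)

lemma polys_over_mono: "R \<subseteq> S \<Longrightarrow> polys_over R \<subseteq> polys_over S"
  by (auto simp: polys_over_def)

lemma polys_over_pCons_iff: "subrng R \<Longrightarrow> pCons a p \<in> polys_over R \<longleftrightarrow> a \<in> R \<and> p \<in> polys_over R"
  by (auto simp: polys_over_def coeff_pCons split: nat.splits)

lemma polys_over_0: "subrng R \<Longrightarrow> 0 \<in> polys_over R"
  by (simp add: polys_over_def subrng_0)

lemma polys_over_const: "subrng R \<Longrightarrow> a \<in> R \<Longrightarrow> [:a:] \<in> polys_over R"
  by (simp add: polys_over_pCons_iff polys_over_0)

lemma polys_over_1: "subrng R \<Longrightarrow> 1 \<in> polys_over R"
  using polys_over_const[of R 1] by (simp add: subrng_1 one_pCons)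

lemma polys_over_add: "subrng R \<Longrightarrow> p \<in> polys_over R \<Longrightarrow> q \<in> polys_over R \<Longrightarrow> p + q \<in> polys_over R"
  and polys_over_uminus: "subrng R \<Longrightarrow> p \<in> polys_over R \<Longrightarrow> - p \<in> polys_over R"
  and polys_over_diff: "subrng R \<Longrightarrow> p \<in> polys_over R \<Longrightarrow> q \<in> polys_over R \<Longrightarrow> p - q \<in> polys_over R"
  and polys_over_smult: "subrng R \<Longrightarrow> a \<in> R \<Longrightarrow> p \<in> polys_over R \<Longrightarrow> smult a p \<in> polys_over R"
  and polys_over_monom: "subrng R \<Longrightarrow> a \<in> R \<Longrightarrow> monom a n \<in> polys_over R"
  and polys_over_pderiv: "subrng R \<Longrightarrow> p \<in> polys_over R \<Longrightarrow> pderiv p \<in> polys_over R"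
  by (auto simp: polys_over_def coeff_pderiv simp del: of_nat_Suc intro: subrng_intros)

lemma polys_over_mult: "subrng R \<Longrightarrow> p \<in> polys_over R \<Longrightarrow> q \<in> polys_over R \<Longrightarrow> p * q \<in> polys_over R"
  by (auto simp: polys_over_def coeff_mult intro!: subrng_sum subrng_mult)

lemma polys_over_power: "subrng R \<Longrightarrow> p \<in> polys_over R \<Longrightarrow> p ^ n \<in> polys_over R"
  by (induction n) (auto intro: polys_over_1 polys_over_mult)

lemma polys_over_prod:
  "subrng R \<Longrightarrow> (\<And>i. i \<in> A \<Longrightarrow> f i \<in> polys_over R) \<Longrightarrow> prod f A \<in> polys_over R"
  by (induction A rule: infinite_finite_induct) (auto intro: polys_over_1 polys_over_mult)

lemmas polys_over_intros = polys_over_0 polys_over_1 polys_over_const polys_over_add polys_over_uminus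
  polys_over_diff polys_over_smult polys_over_monom polys_over_pderiv polys_over_mult
  polys_over_power polys_over_prod

lemmas polys_over_subfld_intros = polys_over_intros[OF subfld_subrng]

lemma polys_over_pcompose:
  assumes "subrng R" "p \<in> polys_over R" "q \<in> polys_over R" shows "pcompose p q \<in> polys_over R"
  using assms(2)
proof (induction p)
  case (pCons a p)
  then show ?case using assms by (auto simp: pcompose_pCons polys_over_pCons_iff intro!: polys_over_intros)
qed (use assms in \<open>auto intro: polys_over_intros\<close>)

lemma poly_in_subrng:
  assumes "subrng R" "p \<in> polys_over R" "x \<in> R" shows "poly p x \<in> R"
  using assms(2)
proof (induction p)
  case (pCons a p)
  then show ?case using assms by (auto simp: polys_over_pCons_iff intro!: subrng_intros)
qed (use assms in \<open>auto intro: subrng_intros\<close>)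

text \<open>A monic divisor never requires inverting a coefficient, so quotient and remainder stay
  over \<open>R\<close> even if \<open>R\<close> is no field. This is what later allows division by
  an integral minimal polynomial over \<open>D\<close> and over polynomial rings.\<close>

lemma polys_over_division:
  fixes g h :: "'b::field poly"
  assumes R: "subrng R" and g: "g \<in> polys_over R" "lead_coeff g = 1" and h: "h \<in> polys_over R"
  shows "\<exists>k\<in>polys_over R. \<exists>r\<in>polys_over R. h = g * k + r \<and> (r = 0 \<or> degree r < degree g)"
  using h
proof (induction "degree h" arbitrary: h rule: less_induct)
  case less
  show ?case
  proof (cases "h = 0 \<or> degree h < degree g")
    case True
    then show ?thesis using less.prems R by (intro bexI[of _ 0] bexI[of _ h]) (auto intro: polys_over_intros)
  next
    case False
    then have dg: "degree g \<le> degree h" and h0: "h \<noteq> 0" by auto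
    define m where "m = monom (lead_coeff h) (degree h - degree g)"
    define h' where "h' = h - g * m"
    have m: "m \<in> polys_over R" unfolding m_def using less.prems R by (auto intro: polys_over_intros polys_overD)
    have h': "h' \<in> polys_over R" unfolding h'_def using m less.prems R g by (auto intro: polys_over_intros)
    have g0: "g \<noteq> 0" using g by auto
    have m0: "m \<noteq> 0" using h0 by (simp add: m_def)
    have dm: "degree m = degree h - degree g" using h0 by (simp add: m_def degree_monom_eq)
    have dgm: "degree (g * m) = degree h" using g0 m0 dm dg by (simp add: degree_mult_eq)
    have lc: "lead_coeff (g * m) = lead_coeff h"
      using g h0 by (simp add: lead_coeff_mult m_def degree_monom_eq)
    have "h' = 0 \<or> degree h' < degree h"
    proof (cases "degree h = 0")
      case True
      then have "degree h' = 0" using dgm unfolding h'_def by (metis degree_diff_le le_zero_eq)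
      moreover have "coeff h' 0 = 0" using lc dgm True by (simp add: h'_def)
      ultimately show ?thesis by (metis leading_coeff_0_iff)
    next
      case False
      have "degree h' \<le> degree h" unfolding h'_def by (rule degree_diff_le) (use dgm in auto)
      moreover have "coeff h' (degree h) = 0" using lc dgm by (simp add: h'_def)
      ultimately show ?thesis using False by (metis eq_zero_or_degree_less)
    qed
    then obtain k r where kr: "k \<in> polys_over R" "r \<in> polys_over R" "h' = g * k + r" "r = 0 \<or> degree r < degree g"
    proof
      assume "h' = 0" then show ?thesis using that[of 0 0] R by (auto intro: polys_over_intros)
    next
      assume "degree h' < degree h" then show ?thesis using less.hyps[OF _ h'] that by blast
    qed
    have "h = g * (k + m) + r" using kr(3) by (simp add: h'_def algebra_simps)
    then show ?thesis using kr m R by (intro bexI[of _ "k + m"] bexI[of _ r]) (auto intro: polys_over_intros)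
  qed
qed

text \<open>The hypothesis \<open>g dvd h\<close> is divisibility over the whole field type. The
  remainder computed over \<open>R\<close> is divisible by \<open>g\<close> as well, hence zero, and
  this brings the cofactor down to \<open>R\<close>.\<close>

lemma polys_over_dvdE:
  fixes g h :: "'b::field poly"
  assumes R: "subrng R" and g: "g \<in> polys_over R" "lead_coeff g = 1" and h: "h \<in> polys_over R" and "g dvd h"
  obtains k where "k \<in> polys_over R" "h = g * k"
proof -
  obtain k r where kr: "k \<in> polys_over R" "r \<in> polys_over R" "h = g * k + r" "r = 0 \<or> degree r < degree g"
    using polys_over_division[OF R g h] by blast
  have "g dvd r" using \<open>g dvd h\<close> kr(3) by (simp add: dvd_add_right_iff)
  then have "r = 0" using kr(4) by (auto dest: dvd_imp_degree_le)
  then show ?thesis using kr that by simp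
qed

section \<open>Algebraic elements and minimal polynomials\<close>

definition alg_over :: "'b::field set \<Rightarrow> 'b \<Rightarrow> bool" where
  "alg_over R x \<longleftrightarrow> (\<exists>p\<in>polys_over R. p \<noteq> 0 \<and> poly p x = 0)"

lemma alg_over_mono: "alg_over R x \<Longrightarrow> R \<subseteq> S \<Longrightarrow> alg_over S x"
  unfolding alg_over_def using polys_over_mono by blast

lemma alg_over_self:
  assumes "subrng R" "x \<in> R" shows "alg_over R x"
  unfolding alg_over_def using assms
  by (intro bexI[of _ "[:-x, 1:]"]) (auto simp: polys_over_pCons_iff intro: polys_over_intros subrng_intros)

lemma min_poly_exists:
  assumes F: "subfld F" and "alg_over F x"
  shows "\<exists>f. is_min_poly F x f"
proof -
  define P where "P = (\<lambda>p. p \<in> polys_over F \<and> p \<noteq> 0 \<and> poly p x = 0)"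
  have "\<exists>p. P p" using assms by (auto simp: alg_over_def P_def)
  then obtain p where p: "P p" "\<And>q. P q \<Longrightarrow> degree p \<le> degree q"
    using ex_has_least_nat[of P _ degree] by metis
  let ?f = "smult (inverse (lead_coeff p)) p"
  have "is_min_poly F x ?f" unfolding is_min_poly_def
    using p F by (auto simp: P_def intro!: polys_over_subfld_intros subfld_intros polys_overD)
  then show ?thesis ..
qed

lemma min_poly_dvd:
  assumes F: "subfld F" and f: "is_min_poly F x f" and p: "p \<in> polys_over F" "poly p x = 0"
  shows "f dvd p"
proof -
  obtain k r where kr: "k \<in> polys_over F" "r \<in> polys_over F" "p = f * k + r" "r = 0 \<or> degree r < degree f"
    using polys_over_division[OF subfld_subrng[OF F], of f p] f p by (auto simp: is_min_poly_def)
  have "poly r x = 0" using kr p f by (simp add: is_min_poly_def)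
  then have "r = 0" using kr f by (auto simp: is_min_poly_def dest: leD)
  then show ?thesis using kr by simp
qed

lemma is_min_polyD:
  assumes "is_min_poly F x f"
  shows "f \<in> polys_over F" "lead_coeff f = 1" "poly f x = 0" "f \<noteq> 0" "degree f > 0"
proof -
  show *: "f \<in> polys_over F" "lead_coeff f = 1" "poly f x = 0" using assms by (auto simp: is_min_poly_def)
  then show "f \<noteq> 0" by auto
  show "degree f > 0"
  proof (rule ccontr)
    assume "\<not> degree f > 0"
    then obtain a where "f = [:a:]" using degree_eq_zeroE by auto
    then show False using * by auto
  qed
qed

lemma monic_dvd_same_degree_eq:
  fixes p q :: "'b::idom poly"
  assumes "p dvd q" "lead_coeff p = 1" "lead_coeff q = 1" "degree q \<le> degree p"
  shows "p = q"
proof -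
  obtain k where k: "q = p * k" using assms by auto
  have "k \<noteq> 0" "p \<noteq> 0" using k assms by auto
  then have "degree k = 0" using k assms by (simp add: degree_mult_eq)
  then obtain a where "k = [:a:]" using degree_eq_zeroE by auto
  moreover have "lead_coeff k = 1" using k assms lead_coeff_mult[of p k] by simp
  ultimately have "k = 1" using \<open>k = [:a:]\<close> by (simp add: one_pCons)
  then show ?thesis using k by simp
qed

lemma min_poly_unique:
  assumes "subfld F" "is_min_poly F x f" "is_min_poly F x g" shows "f = g"
proof -
  note fD = is_min_polyD[OF assms(2)] and gD = is_min_polyD[OF assms(3)]
  have "f dvd g" by (rule min_poly_dvd[OF assms(1,2) gD(1,3)])
  moreover have "degree g \<le> degree f" using assms(3) fD by (auto simp: is_min_poly_def)
  ultimately show ?thesis using fD gD by (intro monic_dvd_same_degree_eq)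
qed

text \<open>Irreducibility in disguise: if the minimal polynomial \<open>g\<close> of
  \<open>y\<close> were a proper factor of \<open>f\<close>, then \<open>x\<close> would be a root
  of \<open>g\<close> or of the cofactor, both of smaller degree than \<open>f\<close>.\<close>

lemma min_poly_other_root:
  assumes F: "subfld F" and f: "is_min_poly F x f" and y: "poly f y = 0"
  shows "is_min_poly F y f"
proof -
  note fD = is_min_polyD[OF f]
  have "alg_over F y" using fD y by (auto simp: alg_over_def)
  then obtain g where g: "is_min_poly F y g" using min_poly_exists[OF F] by blast
  note gD = is_min_polyD[OF g]
  obtain k where k: "k \<in> polys_over F" "f = g * k"
    using polys_over_dvdE[OF subfld_subrng[OF F] gD(1,2) fD(1) min_poly_dvd[OF F g fD(1) y]] by blast
  have "k \<noteq> 0" using k fD by auto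
  have deg: "degree f = degree g + degree k" using k \<open>k \<noteq> 0\<close> gD by (simp add: degree_mult_eq)
  have "poly g x = 0 \<or> poly k x = 0" using k fD by simp
  then have "degree f \<le> degree g"
  proof
    assume "poly g x = 0" then show ?thesis using f gD by (auto simp: is_min_poly_def)
  next
    assume "poly k x = 0"
    then have "degree f \<le> degree k" using f k \<open>k \<noteq> 0\<close> by (auto simp: is_min_poly_def)
    then show ?thesis using deg gD by simp
  qed
  then have "g = f" using monic_dvd_same_degree_eq[of g f] k gD fD by simp
  then show ?thesis using g by simp
qed

lemma degree_1_root_in:
  assumes F: "subfld F" and p: "p \<in> polys_over F" "degree p = 1" "poly p x = 0" shows "x \<in> F"
proof -
  obtain a q where aq: "p = pCons a q" by (cases p)
  then have "degree q = 0" "q \<noteq> 0" using p(2) by (auto split: if_splits)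
  then obtain b where ab: "p = [:a, b:]" "b \<noteq> 0" using aq degree_eq_zeroE by (metis pCons_0_0)
  then have "a \<in> F" "b \<in> F" using p F by (auto simp: polys_over_pCons_iff subfld_subrng)
  moreover have "x = - a / b" using ab p by (simp add: field_simps add_eq_0_iff)
  ultimately show ?thesis using F by (auto intro!: subfld_intros)
qed

lemma min_poly_of_mem:
  assumes F: "subfld F" and "x \<in> F" shows "is_min_poly F x [:- x, 1:]"
  unfolding is_min_poly_def using assms
proof (safe, goal_cases)
  case (4 q)
  have "degree q > 0"
  proof (rule ccontr)
    assume "\<not> degree q > 0"
    then obtain a where "q = [:a:]" using degree_eq_zeroE by auto
    then show False using 4 by auto
  qed
  then show ?case by simp
qed (auto simp: polys_over_pCons_iff subfld_subrng intro!: polys_over_intros subfld_intros)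

text \<open>The derivative criterion, root by root: a factor (X - a)^2 is detected by the derivative
  in every characteristic, although higher multiplicities are not.\<close>

lemma rsquarefree_iff:
  "rsquarefree p \<longleftrightarrow> p \<noteq> 0 \<and> (\<forall>a. \<not> (poly p a = 0 \<and> poly (pderiv p) a = 0))"
  for p :: "'b::field poly"
proof (cases "p = 0")
  case False
  have "order a p \<ge> 2 \<longleftrightarrow> poly p a = 0 \<and> poly (pderiv p) a = 0" for a
  proof
    assume "order a p \<ge> 2"
    then have "[:-a,1:]^2 dvd p" using order_divides by blast
    then obtain k where k: "p = [:-a,1:]^2 * k" by (rule dvdE)
    define l where "l = [:-a,1:]"
    have "p = l * l * k" using k by (simp only: power2_eq_square l_def)
    moreover have "poly l a = 0" by (simp add: l_def)
    ultimately show "poly p a = 0 \<and> poly (pderiv p) a = 0" by (simp add: pderiv_mult)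
  next
    assume a: "poly p a = 0 \<and> poly (pderiv p) a = 0"
    define l where "l = [:-a,1:]"
    have l: "poly l a = 0" "poly (pderiv l) a = 1" by (simp_all add: l_def pderiv_pCons)
    obtain k where k: "p = l * k" using a poly_eq_0_iff_dvd[of p a] unfolding l_def by (auto simp: dvd_def)
    have "poly k a = 0" using a l by (simp add: k pderiv_mult)
    then obtain m where m: "k = l * m" using poly_eq_0_iff_dvd[of k a] unfolding l_def by (auto simp: dvd_def)
    have "l ^ 2 dvd p" using k m by (simp add: power2_eq_square flip: mult.assoc)
    then show "order a p \<ge> 2" using False unfolding l_def by (simp add: order_divides)
  qed
  moreover have "order a p = 0 \<or> order a p = 1 \<longleftrightarrow> \<not> 2 \<le> order a p" for a by linarith
  ultimately show ?thesis using False by (simp add: rsquarefree_def)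
qed (simp add: rsquarefree_def)

lemma rsquarefree_dvd:
  assumes "rsquarefree q" "p dvd q" shows "rsquarefree (p :: 'b::field poly)"
  using assms unfolding rsquarefree_iff by (auto simp: pderiv_mult elim!: dvdE)

lemma rsquarefree_card_roots:
  assumes "rsquarefree (p :: 'b::alg_closed_field poly)" shows "card {x. poly p x = 0} = degree p"
proof -
  have p0: "p \<noteq> 0" using assms by (simp add: rsquarefree_def)
  obtain A where A: "size A = degree p" "p = smult (lead_coeff p) (\<Prod>x\<in>#A. [:-x, 1:])"
    using alg_closed_imp_factorization[OF p0] by blast
  have "proots p = A"
  proof -
    have "(\<Prod>x\<in>#B. [:-x, 1:]) \<noteq> 0" for B :: "'b multiset" by auto
    then have "proots (\<Prod>x\<in>#B. [:-x, 1:]) = B" for B :: "'b multiset"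
      by (induction B) (auto simp: proots_mult simp del: mult_pCons_left)
    then show ?thesis using A(2) p0 by (metis leading_coeff_0_iff proots_smult)
  qed
  moreover have "count (proots p) x \<le> 1" for x
    using assms by (auto simp: rsquarefree_def) (metis order.refl zero_le)
  then have "count A x = (if x \<in># A then 1 else 0)" for x
    using \<open>proots p = A\<close> by (metis One_nat_def count_eq_zero_iff le_0_eq le_SucE)
  then have "size A = card (set_mset A)" by (simp add: size_multiset_overloaded_eq)
  moreover have "set_mset A = {x. poly p x = 0}" using \<open>proots p = A\<close> p0 set_count_proots[of p] by auto
  ultimately show ?thesis using A(1) by simp
qed

section \<open>Homomorphisms, simple extensions and generated fields\<close>

text \<open>Only the values on \<open>R\<close> are constrained, and domain and target share one
  type. The same notion thus covers retractions onto \<open>D\<close>, embeddings of subfields and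
  automorphisms.\<close>

definition rhom :: "'b::field set \<Rightarrow> ('b \<Rightarrow> 'b) \<Rightarrow> bool" where
  "rhom R \<phi> \<longleftrightarrow> \<phi> 1 = 1 \<and> (\<forall>x\<in>R. \<forall>y\<in>R. \<phi> (x + y) = \<phi> x + \<phi> y \<and> \<phi> (x * y) = \<phi> x * \<phi> y)"

lemma rhom_1: "rhom R \<phi> \<Longrightarrow> \<phi> 1 = 1"
  and rhom_add: "rhom R \<phi> \<Longrightarrow> x \<in> R \<Longrightarrow> y \<in> R \<Longrightarrow> \<phi> (x + y) = \<phi> x + \<phi> y"
  and rhom_mult: "rhom R \<phi> \<Longrightarrow> x \<in> R \<Longrightarrow> y \<in> R \<Longrightarrow> \<phi> (x * y) = \<phi> x * \<phi> y"
  by (auto simp: rhom_def)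

lemma rhom_subset: "rhom R \<phi> \<Longrightarrow> S \<subseteq> R \<Longrightarrow> rhom S \<phi>"
  unfolding rhom_def by blast

lemma rhom_0: assumes "subrng R" "rhom R \<phi>" shows "\<phi> 0 = 0"
  using rhom_add[OF assms(2), of 0 0] subrng_0[OF assms(1)] by (simp only: add_0_left add_cancel_right_right)

lemma rhom_uminus:
  assumes "subrng R" "rhom R \<phi>" "x \<in> R" shows "\<phi> (- x) = - \<phi> x"
  using rhom_add[OF assms(2), of x "- x"] rhom_0[OF assms(1,2)] assms
  by (simp add: subrng_uminus minus_unique)

lemma rhom_diff:
  assumes "subrng R" "rhom R \<phi>" "x \<in> R" "y \<in> R" shows "\<phi> (x - y) = \<phi> x - \<phi> y"
  using rhom_add[OF assms(2), of x "- y"] rhom_uminus[OF assms(1,2,4)] assms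
  by (simp add: subrng_uminus)

lemma rhom_power:
  assumes "subrng R" "rhom R \<phi>" "x \<in> R" shows "\<phi> (x ^ n) = \<phi> x ^ n"
  by (induction n) (use assms in \<open>auto simp: rhom_1 rhom_mult subrng_power\<close>)

lemma rhom_sum:
  assumes "subrng R" "rhom R \<phi>" "\<And>i. i \<in> A \<Longrightarrow> f i \<in> R"
  shows "\<phi> (sum f A) = (\<Sum>i\<in>A. \<phi> (f i))"
  using assms(3)
  by (induction A rule: infinite_finite_induct)
     (use assms(1,2) in \<open>auto simp: rhom_0 rhom_add subrng_sum\<close>)

lemma rhom_inverse:
  assumes "subfld F" "rhom F \<phi>" "x \<in> F" shows "\<phi> (inverse x) = inverse (\<phi> x)"
proof (cases "x = 0")
  case True
  then show ?thesis using rhom_0[OF subfld_subrng[OF assms(1)] assms(2)] by simp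
next
  case False
  have "\<phi> x * \<phi> (inverse x) = 1"
    using rhom_mult[OF assms(2,3) subfld_inverse[OF assms(1,3)]] False rhom_1[OF assms(2)] by simp
  then show ?thesis by (metis inverse_unique)
qed

lemma rhom_eq_0:
  assumes "subfld F" "rhom F \<phi>" "x \<in> F" "\<phi> x = 0" shows "x = 0"
proof (rule ccontr)
  assume "x \<noteq> 0"
  then have "\<phi> x * \<phi> (inverse x) = 1"
    using rhom_mult[OF assms(2,3) subfld_inverse[OF assms(1,3)]] rhom_1[OF assms(2)] by simp
  then show False using assms(4) by simp
qed

context
  fixes R :: "'b::field set" and \<phi> :: "'b \<Rightarrow> 'b"
  assumes R: "subrng R" and \<phi>: "rhom R \<phi>"
begin

lemma coeff_map_rhom: "coeff (map_poly \<phi> p) i = \<phi> (coeff p i)"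
  by (simp add: coeff_map_poly rhom_0[OF R \<phi>])

lemma map_rhom_pCons: "map_poly \<phi> (pCons a p) = pCons (\<phi> a) (map_poly \<phi> p)"
  by (rule poly_eqI) (auto simp: coeff_map_rhom coeff_pCons split: nat.splits)

lemma map_rhom_add:
  "p \<in> polys_over R \<Longrightarrow> q \<in> polys_over R \<Longrightarrow> map_poly \<phi> (p + q) = map_poly \<phi> p + map_poly \<phi> q"
  by (rule poly_eqI) (simp add: coeff_map_rhom rhom_add[OF \<phi>] polys_overD)

lemma map_rhom_diff:
  "p \<in> polys_over R \<Longrightarrow> q \<in> polys_over R \<Longrightarrow> map_poly \<phi> (p - q) = map_poly \<phi> p - map_poly \<phi> q"
  by (rule poly_eqI) (simp add: coeff_map_rhom rhom_diff[OF R \<phi>] polys_overD)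

lemma map_rhom_smult:
  "a \<in> R \<Longrightarrow> p \<in> polys_over R \<Longrightarrow> map_poly \<phi> (smult a p) = smult (\<phi> a) (map_poly \<phi> p)"
  by (rule poly_eqI) (simp add: coeff_map_rhom rhom_mult[OF \<phi>] polys_overD)

lemma map_rhom_mult:
  assumes "p \<in> polys_over R" "q \<in> polys_over R"
  shows "map_poly \<phi> (p * q) = map_poly \<phi> p * map_poly \<phi> q"
proof (rule poly_eqI)
  fix n
  have "\<phi> (\<Sum>i\<le>n. coeff p i * coeff q (n - i)) = (\<Sum>i\<le>n. \<phi> (coeff p i * coeff q (n - i)))"
    by (rule rhom_sum[OF R \<phi>]) (use assms R in \<open>auto intro: subrng_mult polys_overD\<close>)
  then show "coeff (map_poly \<phi> (p * q)) n = coeff (map_poly \<phi> p * map_poly \<phi> q) n"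
    using assms by (simp add: coeff_map_rhom coeff_mult rhom_mult[OF \<phi>] polys_overD)
qed

lemma map_rhom_0: "map_poly \<phi> 0 = 0"
  by (rule poly_eqI) (simp add: coeff_map_rhom rhom_0[OF R \<phi>])

lemma poly_map_rhom:
  assumes "p \<in> polys_over R" "x \<in> R" shows "poly (map_poly \<phi> p) (\<phi> x) = \<phi> (poly p x)"
  using assms(1)
proof (induction p)
  case (pCons a p)
  then have "a \<in> R" "p \<in> polys_over R" by (auto simp: polys_over_pCons_iff R)
  then show ?case using pCons.IH assms(2) R
    by (simp add: map_rhom_pCons rhom_add[OF \<phi>] rhom_mult[OF \<phi>] subrng_mult poly_in_subrng)
qed (simp add: rhom_0[OF R \<phi>])

lemma pderiv_map_rhom:
  assumes "p \<in> polys_over R" shows "pderiv (map_poly \<phi> p) = map_poly \<phi> (pderiv p)"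
proof (rule poly_eqI)
  fix n
  have "\<phi> (of_nat k) = of_nat k" for k
    by (induction k) (use R in \<open>auto simp: rhom_0[OF R \<phi>] rhom_1[OF \<phi>] rhom_add[OF \<phi>] subrng_1 subrng_of_nat\<close>)
  then show "coeff (pderiv (map_poly \<phi> p)) n = coeff (map_poly \<phi> (pderiv p)) n"
    using assms R by (simp add: coeff_map_rhom coeff_pderiv rhom_mult[OF \<phi>] subrng_of_nat polys_overD del: of_nat_Suc)
qed

lemma map_poly_rhom_in: "(\<And>x. x \<in> R \<Longrightarrow> \<phi> x \<in> S) \<Longrightarrow> p \<in> polys_over R \<Longrightarrow> map_poly \<phi> p \<in> polys_over S"
  by (auto simp: polys_over_def coeff_map_rhom)

end

lemma map_poly_id_on:
  assumes "p \<in> polys_over R" "\<And>x. x \<in> R \<Longrightarrow> \<phi> x = x" "0 \<in> R" shows "map_poly \<phi> p = p"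
  by (rule poly_eqI) (use assms in \<open>simp add: coeff_map_poly polys_overD\<close>)

section \<open>Simple extensions\<close>

definition sext :: "'b::field set \<Rightarrow> 'b \<Rightarrow> 'b set" where
  "sext R t = {poly h t | h. h \<in> polys_over R}"

lemma sext_subrng: assumes "subrng R" shows "subrng (sext R t)"
  unfolding subrng_def
proof safe
  have "poly 0 t \<in> sext R t" "poly 1 t \<in> sext R t"
    unfolding sext_def using polys_over_0[OF assms] polys_over_1[OF assms] by blast+
  then show "0 \<in> sext R t" "1 \<in> sext R t" by simp_all
next
  fix x y assume "x \<in> sext R t" "y \<in> sext R t"
  then obtain h k where "x = poly h t" "y = poly k t" "h \<in> polys_over R" "k \<in> polys_over R" by (auto simp: sext_def)
  then show "x + y \<in> sext R t" "x * y \<in> sext R t"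
    using polys_over_add[OF assms, of h k] polys_over_mult[OF assms, of h k]
    by (auto simp: sext_def simp flip: poly_add poly_mult)
next
  fix x assume "x \<in> sext R t"
  then obtain h where "x = poly h t" "h \<in> polys_over R" by (auto simp: sext_def)
  then show "- x \<in> sext R t"
    using polys_over_uminus[OF assms, of h] by (auto simp: sext_def simp flip: poly_minus)
qed

lemma sext_incl: assumes "subrng R" shows "R \<subseteq> sext R t"
proof
  fix a assume "a \<in> R"
  then show "a \<in> sext R t" using polys_over_const[OF assms, of a] unfolding sext_def
    by (auto intro!: exI[of _ "[:a:]"])
qed

lemma sext_mem: assumes "subrng R" shows "t \<in> sext R t"
  using assms polys_over_pCons_iff[OF assms, of 0 1] polys_over_1[OF assms] subrng_0[OF assms]
  unfolding sext_def by (auto intro!: exI[of _ "[:0,1:]"] simp: one_pCons)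

lemma sext_least: "subrng S \<Longrightarrow> R \<subseteq> S \<Longrightarrow> t \<in> S \<Longrightarrow> sext R t \<subseteq> S"
  unfolding sext_def using polys_over_mono[of R S] by (auto intro: poly_in_subrng)

text \<open>Euclid's algorithm with the minimal polynomial \<open>f\<close> of \<open>t\<close>:
  dividing \<open>f\<close> by \<open>h\<close> leaves a remainder \<open>r\<close> of smaller
  degree, and f(t) = 0 expresses the inverse of h(t) through that of r(t).\<close>

lemma sext_subfld:
  assumes F: "subfld F" and "alg_over F t" shows "subfld (sext F t)"
proof -
  note R = subfld_subrng[OF F]
  obtain f where f: "is_min_poly F t f" using min_poly_exists[OF assms] by blast
  note fD = is_min_polyD[OF f]
  note S = sext_subrng[OF R, of t]
  have inv: "inverse (poly h t) \<in> sext F t" if "h \<in> polys_over F" "h \<noteq> 0" "degree h < degree f" for h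
    using that
  proof (induction "degree h" arbitrary: h rule: less_induct)
    case less
    have ht: "poly h t \<noteq> 0" using less.prems f by (auto simp: is_min_poly_def)
    show ?case
    proof (cases "degree h = 0")
      case True
      then obtain a where "h = [:a:]" using degree_eq_zeroE by auto
      then show ?thesis using less.prems sext_incl[OF R, of t] subfld_inverse[OF F, of a]
        by (auto simp: polys_over_pCons_iff R)
    next
      case False
      define c where "c = inverse (lead_coeff h)"
      have c: "c \<in> F" "c \<noteq> 0" using less.prems F by (auto simp: c_def intro!: subfld_inverse polys_overD)
      have h': "smult c h \<in> polys_over F" "lead_coeff (smult c h) = 1"
        using c less.prems R by (auto simp: c_def intro: polys_over_intros)
      obtain k r where kr: "k \<in> polys_over F" "r \<in> polys_over F" "f = smult c h * k + r"
        "r = 0 \<or> degree r < degree (smult c h)"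
        using polys_over_division[OF R h' fD(1)] by blast
      have eq: "c * poly h t * poly k t + poly r t = 0" using fD(3) kr(3) by (simp add: mult.assoc)
      have dr: "r = 0 \<or> degree r < degree h" using kr(4) c by simp
      have k0: "k \<noteq> 0" using kr(3,4) dr less.prems fD by auto
      \<comment> \<open>A zero remainder would make \<open>t\<close> a root of the cofactor
        \<open>k\<close>, whose degree is below that of \<open>f\<close> because \<open>h\<close> is
        not constant.\<close>
      have r0: "r \<noteq> 0"
      proof
        assume r: "r = 0"
        have "poly k t = 0" using eq r c ht by simp
        then have "degree f \<le> degree k" using f kr k0 by (auto simp: is_min_poly_def)
        moreover have "degree f = degree h + degree k" using kr(3) r c k0 less.prems by (simp add: degree_mult_eq)
        ultimately show False using False by simp
      qed
      have rt: "poly r t \<noteq> 0" using r0 dr less.prems kr f by (fastforce simp: is_min_poly_def)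
      have "inverse (poly r t) \<in> sext F t" by (rule less.hyps) (use r0 dr kr less.prems in auto)
      moreover have "inverse (poly h t) = - (c * poly k t) * inverse (poly r t)"
      proof -
        have "poly r t = - (c * poly k t) * poly h t" using eq by (simp add: algebra_simps add_eq_0_iff)
        then show ?thesis using rt ht by (simp add: field_simps)
      qed
      moreover have "poly k t \<in> sext F t" using kr by (auto simp: sext_def)
      ultimately show ?thesis using S sext_incl[OF R, of t] c by (auto intro!: subrng_intros)
    qed
  qed
  have "inverse x \<in> sext F t" if "x \<in> sext F t" for x
  proof -
    from that obtain h where h: "h \<in> polys_over F" "x = poly h t" by (auto simp: sext_def)
    obtain k r where kr: "k \<in> polys_over F" "r \<in> polys_over F" "h = f * k + r" "r = 0 \<or> degree r < degree f"
      using polys_over_division[OF R fD(1,2) h(1)] by blast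
    have x: "x = poly r t" using h kr fD by simp
    show ?thesis
    proof (cases "r = 0")
      case True then show ?thesis using x that by simp
    next
      case False then show ?thesis using x inv[of r] kr by auto
    qed
  qed
  then show ?thesis using S by (simp add: subfld_def)
qed

lemma rhom_extend:
  assumes R: "subrng R" and \<phi>: "rhom R \<phi>"
    and ker: "\<And>h. h \<in> polys_over R \<Longrightarrow> poly h t = 0 \<Longrightarrow> poly (map_poly \<phi> h) t' = 0"
  shows "\<exists>\<psi>. rhom (sext R t) \<psi> \<and> (\<forall>h\<in>polys_over R. \<psi> (poly h t) = poly (map_poly \<phi> h) t') \<and>
           (\<forall>x\<in>R. \<psi> x = \<phi> x) \<and> \<psi> t = t'"
proof -
  \<comment> \<open>\<open>SOME\<close> picks a polynomial representing \<open>z\<close>. By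
    \<open>ker\<close>, applied to the difference of two representatives, the value does not depend
    on the choice.\<close>
  define \<psi> where "\<psi> z = poly (map_poly \<phi> (SOME h. h \<in> polys_over R \<and> poly h t = z)) t'" for z
  have \<psi>: "\<psi> (poly h t) = poly (map_poly \<phi> h) t'" if "h \<in> polys_over R" for h
  proof -
    define k where "k = (SOME k. k \<in> polys_over R \<and> poly k t = poly h t)"
    have k: "k \<in> polys_over R \<and> poly k t = poly h t"
      unfolding k_def by (rule someI[of _ h]) (use that in simp)
    have "poly (map_poly \<phi> (k - h)) t' = 0" by (rule ker) (use k that R in \<open>auto intro: polys_over_intros\<close>)
    then show ?thesis using k that by (simp add: \<psi>_def map_rhom_diff[OF R \<phi>] flip: k_def)
  qed
  have *: "\<psi> x = \<phi> x" if "x \<in> R" for x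
    using \<psi>[OF polys_over_const[OF R that]] by (simp add: map_rhom_pCons[OF R \<phi>] map_rhom_0[OF R \<phi>])
  have "\<psi> t = t'"
    using \<psi>[of "[:0,1:]"] R
    by (simp add: polys_over_pCons_iff subrng_intros polys_over_intros map_rhom_pCons[OF R \<phi>] map_rhom_0[OF R \<phi>]
        rhom_0[OF R \<phi>] rhom_1[OF \<phi>])
  moreover have "rhom (sext R t) \<psi>"
    unfolding rhom_def
  proof safe
    show "\<psi> 1 = 1" using *[of 1] R \<phi> by (simp add: subrng_1 rhom_1)
    fix x y assume "x \<in> sext R t" "y \<in> sext R t"
    then obtain h k where hk: "x = poly h t" "y = poly k t" "h \<in> polys_over R" "k \<in> polys_over R" by (auto simp: sext_def)
    then show "\<psi> (x + y) = \<psi> x + \<psi> y" "\<psi> (x * y) = \<psi> x * \<psi> y"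
      using \<psi>[of "h + k"] \<psi>[of "h * k"] \<psi>[of h] \<psi>[of k] R
      by (simp_all add: polys_over_intros map_rhom_add[OF R \<phi>] map_rhom_mult[OF R \<phi>])
  qed
  ultimately show ?thesis using \<psi> * by blast
qed

section \<open>Generated fields\<close>

definition fgen :: "'b::field set \<Rightarrow> 'b set" where
  "fgen S = \<Inter>{F. subfld F \<and> S \<subseteq> F}"

lemma subfld_UNIV: "subfld UNIV" by (simp add: subfld_def subrng_def)

lemma fgen_subfld: "subfld (fgen S)"
  unfolding fgen_def subfld_def[of "\<Inter>_"] subrng_def by (auto intro: subfld_intros)

lemma fgen_incl: "S \<subseteq> fgen S" by (auto simp: fgen_def)

lemma fgen_least: "subfld F \<Longrightarrow> S \<subseteq> F \<Longrightarrow> fgen S \<subseteq> F" by (auto simp: fgen_def)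

lemma fgen_mono: "S \<subseteq> T \<Longrightarrow> fgen S \<subseteq> fgen T"
  by (meson fgen_incl fgen_least fgen_subfld order_trans)

lemma fgen_insert_alg:
  assumes "alg_over (fgen S) s" shows "fgen (insert s S) = sext (fgen S) s"
proof
  note R = subfld_subrng[OF fgen_subfld[of S]]
  show "fgen (insert s S) \<subseteq> sext (fgen S) s"
    by (rule fgen_least[OF sext_subfld[OF fgen_subfld assms]])
       (use sext_incl[OF R] sext_mem[OF R] fgen_incl[of S] in auto)
  show "sext (fgen S) s \<subseteq> fgen (insert s S)"
    by (rule sext_least[OF subfld_subrng[OF fgen_subfld]])
       (use fgen_mono[of S "insert s S"] fgen_incl[of "insert s S"] in auto)
qed

text \<open>Prepares inductions that adjoin one element at a time: a given element needs only
  finitely many generators from \<open>B\<close>, whereas \<open>A\<close>, typically the base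
  field, is kept whole.\<close>

lemma fgen_finitary:
  assumes "z \<in> fgen (A \<union> B)" shows "\<exists>T. finite T \<and> T \<subseteq> B \<and> z \<in> fgen (A \<union> T)"
proof -
  define N where "N = {z. \<exists>T. finite T \<and> T \<subseteq> B \<and> z \<in> fgen (A \<union> T)}"
  have comb: "\<exists>T. finite T \<and> T \<subseteq> B \<and> x \<in> fgen (A \<union> T) \<and> y \<in> fgen (A \<union> T)" if "x \<in> N" "y \<in> N" for x y
  proof -
    from that obtain S T where *: "finite S" "S \<subseteq> B" "x \<in> fgen (A \<union> S)" "finite T" "T \<subseteq> B" "y \<in> fgen (A \<union> T)"
      by (auto simp: N_def)
    then show ?thesis using fgen_mono[of "A \<union> S" "A \<union> (S \<union> T)"] fgen_mono[of "A \<union> T" "A \<union> (S \<union> T)"]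
      by (intro exI[of _ "S \<union> T"]) auto
  qed
  have "subfld N" unfolding subfld_def subrng_def
  proof safe
    show "0 \<in> N" "1 \<in> N" unfolding N_def mem_Collect_eq
      by (rule exI[of _ "{}"], simp add: subfld_intros(1,2)[OF fgen_subfld])+
    fix x y assume "x \<in> N" "y \<in> N"
    from comb[OF this] obtain T where T: "finite T" "T \<subseteq> B" "x \<in> fgen (A \<union> T)" "y \<in> fgen (A \<union> T)"
      by auto
    show "x + y \<in> N" "x * y \<in> N"
      unfolding N_def mem_Collect_eq
      by (rule exI[of _ T], use T subfld_intros(3,4)[OF fgen_subfld, of x "A \<union> T" y] in simp)+
  next
    fix x assume "x \<in> N"
    then obtain T where T: "finite T" "T \<subseteq> B" "x \<in> fgen (A \<union> T)" by (auto simp: N_def)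
    show "- x \<in> N" "inverse x \<in> N"
      unfolding N_def mem_Collect_eq
      by (rule exI[of _ T], use T subfld_intros(5)[OF fgen_subfld, of x "A \<union> T"]
          subfld_inverse[OF fgen_subfld, of x "A \<union> T"] in simp)+
  qed
  moreover have "A \<union> B \<subseteq> N"
  proof
    fix x assume "x \<in> A \<union> B"
    then show "x \<in> N"
    proof
      assume "x \<in> A" then show ?thesis unfolding N_def using fgen_incl[of "A \<union> {}"] by (auto intro!: exI[of _ "{}"])
    next
      assume "x \<in> B" then show ?thesis unfolding N_def using fgen_incl[of "A \<union> {x}"] by (auto intro!: exI[of _ "{x}"])
    qed
  qed
  ultimately show ?thesis using assms fgen_least[of N "A \<union> B"] by (auto simp: N_def)
qed

section \<open>Automorphisms of an algebraically closed field\<close>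

text \<open>Automorphisms of the whole algebraically closed type. They are restricted to the
  separable closure only when the Galois group enters.\<close>

definition auts :: "'b::field set \<Rightarrow> ('b \<Rightarrow> 'b) set" where
  "auts K = {\<rho>. bij \<rho> \<and> rhom UNIV \<rho> \<and> (\<forall>x\<in>K. \<rho> x = x)}"

lemma auts_mono: "K \<subseteq> F \<Longrightarrow> auts F \<subseteq> auts K" by (auto simp: auts_def)

lemma auts_id: "(\<lambda>x. x) \<in> auts K" by (auto simp: auts_def rhom_def bij_id[unfolded id_def])

lemma auts_comp: "\<rho> \<in> auts K \<Longrightarrow> \<tau> \<in> auts K \<Longrightarrow> (\<lambda>x. \<rho> (\<tau> x)) \<in> auts K"
  using bij_comp[of \<tau> \<rho>] by (auto simp: auts_def rhom_def o_def)

lemma auts_inv: assumes "\<rho> \<in> auts K" shows "inv_into UNIV \<rho> \<in> auts K"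
proof -
  have b: "bij \<rho>" and h: "rhom UNIV \<rho>" and f: "\<forall>x\<in>K. \<rho> x = x" using assms by (auto simp: auts_def)
  have s: "\<rho> (inv_into UNIV \<rho> x) = x" for x using b by (simp add: bij_is_surj surj_f_inv_f)
  have i: "inv_into UNIV \<rho> (\<rho> x) = x" for x using b by (simp add: bij_is_inj inv_f_f)
  have "rhom UNIV (inv_into UNIV \<rho>)" unfolding rhom_def
  proof safe
    show "inv_into UNIV \<rho> 1 = 1" using i[of 1] h by (simp add: rhom_1)
    fix x y
    show "inv_into UNIV \<rho> (x + y) = inv_into UNIV \<rho> x + inv_into UNIV \<rho> y" "inv_into UNIV \<rho> (x * y) = inv_into UNIV \<rho> x * inv_into UNIV \<rho> y"
      using i[of "inv_into UNIV \<rho> x + inv_into UNIV \<rho> y"] i[of "inv_into UNIV \<rho> x * inv_into UNIV \<rho> y"] h by (simp_all add: rhom_add rhom_mult s)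
  qed
  then show ?thesis using b f i by (auto simp: auts_def bij_imp_bij_inv) metis
qed

text \<open>The graph of a homomorphism between subfields. A graph carries its own domain, so
  inclusion of graphs is the order to which Zorn's lemma applies.\<close>

definition hom_graph :: "('b::field \<times> 'b) set \<Rightarrow> bool" where
  "hom_graph G \<longleftrightarrow> (1, 1) \<in> G \<and>
     (\<forall>x y x' y'. (x, y) \<in> G \<longrightarrow> (x', y') \<in> G \<longrightarrow> (x + x', y + y') \<in> G \<and> (x * x', y * y') \<in> G) \<and>
     (\<forall>x y. (x, y) \<in> G \<longrightarrow> (- x, - y) \<in> G \<and> (inverse x, inverse y) \<in> G) \<and>
     (\<forall>x y y'. (x, y) \<in> G \<longrightarrow> (x, y') \<in> G \<longrightarrow> y = y')"

lemma hom_graph_of_rhom: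
  assumes F: "subfld F" and \<phi>: "rhom F \<phi>" shows "hom_graph {(x, \<phi> x) | x. x \<in> F}"
  unfolding hom_graph_def using F rhom_1[OF \<phi>] rhom_add[OF \<phi>] rhom_mult[OF \<phi>]
    rhom_uminus[OF subfld_subrng[OF F] \<phi>] rhom_inverse[OF F \<phi>]
  by (auto intro: subfld_intros)

lemma hom_graphD:
  assumes "hom_graph G"
  shows "(1, 1) \<in> G" "(x, y) \<in> G \<Longrightarrow> (x', y') \<in> G \<Longrightarrow> (x + x', y + y') \<in> G"
    "(x, y) \<in> G \<Longrightarrow> (x', y') \<in> G \<Longrightarrow> (x * x', y * y') \<in> G"
    "(x, y) \<in> G \<Longrightarrow> (- x, - y) \<in> G" "(x, y) \<in> G \<Longrightarrow> (inverse x, inverse y) \<in> G"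
    "(x, y) \<in> G \<Longrightarrow> (x, z) \<in> G \<Longrightarrow> y = z"
  using assms unfolding hom_graph_def by simp_all

lemma rhom_of_hom_graph:
  assumes G: "hom_graph G"
  obtains \<phi> where "subfld (fst ` G)" "rhom (fst ` G) \<phi>" "\<And>x y. (x, y) \<in> G \<Longrightarrow> \<phi> x = y"
proof
  define \<phi> where "\<phi> x = (THE y. (x, y) \<in> G)" for x
  show \<phi>: "\<phi> x = y" if "(x, y) \<in> G" for x y
    unfolding \<phi>_def using that hom_graphD(6)[OF G] by (intro the_equality) auto
  note G1 = hom_graphD(1)[OF G] and Gadd = hom_graphD(2)[OF G] and Gmult = hom_graphD(3)[OF G]
    and Gm = hom_graphD(4)[OF G] and Gi = hom_graphD(5)[OF G]
  have G0: "(0, 0) \<in> G" using Gadd[OF G1 Gm[OF G1]] by simp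
  have mem: "\<exists>y. (x, y) \<in> G" if "x \<in> fst ` G" for x using that by force
  have fst: "x \<in> fst ` G" if "(x, y) \<in> G" for x y using that by force
  show "subfld (fst ` G)" unfolding subfld_def subrng_def
  proof (intro conjI ballI)
    show "0 \<in> fst ` G" "1 \<in> fst ` G" using fst G0 G1 by blast+
    fix x assume "x \<in> fst ` G"
    then obtain y where y: "(x, y) \<in> G" using mem by blast
    show "- x \<in> fst ` G" "inverse x \<in> fst ` G" using fst Gm[OF y] Gi[OF y] by blast+
    fix x' assume "x' \<in> fst ` G"
    then obtain y' where y': "(x', y') \<in> G" using mem by blast
    show "x + x' \<in> fst ` G" "x * x' \<in> fst ` G" using fst Gadd[OF y y'] Gmult[OF y y'] by blast+
  qed
  show "rhom (fst ` G) \<phi>" unfolding rhom_def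
  proof (intro conjI ballI)
    show "\<phi> 1 = 1" using \<phi>[OF G1] .
    fix x x' assume "x \<in> fst ` G" "x' \<in> fst ` G"
    then obtain y y' where y: "(x, y) \<in> G" "(x', y') \<in> G" using mem by blast
    show "\<phi> (x + x') = \<phi> x + \<phi> x'" "\<phi> (x * x') = \<phi> x * \<phi> x'"
      using \<phi>[OF y(1)] \<phi>[OF y(2)] \<phi>[OF Gadd[OF y]] \<phi>[OF Gmult[OF y]] by simp_all
  qed
qed

lemma hom_graph_Union:
  assumes ne: "\<C> \<noteq> {}" and hg: "\<And>G. G \<in> \<C> \<Longrightarrow> hom_graph G"
    and ch: "\<And>G H. G \<in> \<C> \<Longrightarrow> H \<in> \<C> \<Longrightarrow> G \<subseteq> H \<or> H \<subseteq> G"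
  shows "hom_graph (\<Union>\<C>)"
proof -
  have two: "\<exists>G\<in>\<C>. p \<in> G \<and> q \<in> G" if pq: "p \<in> \<Union>\<C>" "q \<in> \<Union>\<C>" for p q
  proof -
    from pq obtain A B where AB: "A \<in> \<C>" "B \<in> \<C>" "p \<in> A" "q \<in> B" by auto
    then show ?thesis using ch[OF AB(1,2)] by auto
  qed
  show ?thesis unfolding hom_graph_def
  proof (intro conjI allI impI)
    from ne obtain G where G: "G \<in> \<C>" by auto
    show "(1, 1) \<in> \<Union>\<C>" by (rule UnionI[OF G hom_graphD(1)[OF hg[OF G]]])
  next
    fix x y x' y' assume "(x, y) \<in> \<Union>\<C>" "(x', y') \<in> \<Union>\<C>"
    from two[OF this] obtain G where G: "G \<in> \<C>" "(x, y) \<in> G" "(x', y') \<in> G" by auto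
    show "(x + x', y + y') \<in> \<Union>\<C>" by (rule UnionI[OF G(1) hom_graphD(2)[OF hg[OF G(1)] G(2,3)]])
    show "(x * x', y * y') \<in> \<Union>\<C>" by (rule UnionI[OF G(1) hom_graphD(3)[OF hg[OF G(1)] G(2,3)]])
  next
    fix x y assume "(x, y) \<in> \<Union>\<C>"
    then obtain G where G: "G \<in> \<C>" "(x, y) \<in> G" by auto
    show "(- x, - y) \<in> \<Union>\<C>" by (rule UnionI[OF G(1) hom_graphD(4)[OF hg[OF G(1)] G(2)]])
    show "(inverse x, inverse y) \<in> \<Union>\<C>" by (rule UnionI[OF G(1) hom_graphD(5)[OF hg[OF G(1)] G(2)]])
  next
    fix x y y' assume "(x, y) \<in> \<Union>\<C>" "(x, y') \<in> \<Union>\<C>"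
    from two[OF this] obtain G where G: "G \<in> \<C>" "(x, y) \<in> G" "(x, y') \<in> G" by auto
    show "y = y'" by (rule hom_graphD(6)[OF hg[OF G(1)] G(2,3)])
  qed
qed

lemma rhom_extend_alg:
  fixes L :: "'b::alg_closed_field set"
  assumes L: "subfld L" "rhom L \<rho>" and x: "alg_over L x"
  shows "\<exists>\<psi>. rhom (sext L x) \<psi> \<and> (\<forall>z\<in>L. \<psi> z = \<rho> z)"
proof -
  note LR = subfld_subrng[OF L(1)]
  obtain f where f: "is_min_poly L x f" using min_poly_exists[OF L(1) x] by blast
  note fD = is_min_polyD[OF f]
  have "coeff (map_poly \<rho> f) (degree f) = 1" using fD L by (simp add: coeff_map_rhom[OF LR L(2)] rhom_1)
  then have "degree (map_poly \<rho> f) \<ge> degree f" by (intro le_degree) simp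
  then have "degree (map_poly \<rho> f) > 0" using fD(5) by simp
  then obtain x' where x': "poly (map_poly \<rho> f) x' = 0" using alg_closed_imp_poly_has_root by blast
  have "\<exists>\<psi>. rhom (sext L x) \<psi> \<and> (\<forall>h\<in>polys_over L. \<psi> (poly h x) = poly (map_poly \<rho> h) x') \<and>
         (\<forall>z\<in>L. \<psi> z = \<rho> z) \<and> \<psi> x = x'"
  proof (rule rhom_extend[OF LR L(2)])
    fix h assume h: "h \<in> polys_over L" "poly h x = 0"
    obtain k where k: "k \<in> polys_over L" "h = f * k"
      using polys_over_dvdE[OF LR fD(1,2) h(1) min_poly_dvd[OF L(1) f h]] by blast
    then show "poly (map_poly \<rho> h) x' = 0" using fD x' by (simp add: map_rhom_mult[OF LR L(2)])
  qed
  then show ?thesis by blast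
qed

lemma poly_map_fixed:
  assumes "subrng K" "rhom UNIV \<rho>" "\<And>x. x \<in> K \<Longrightarrow> \<rho> x = x" "p \<in> polys_over K"
  shows "\<rho> (poly p x) = poly p (\<rho> x)"
proof -
  have "map_poly \<rho> p = p" by (rule map_poly_id_on[OF assms(4,3)]) (use assms in \<open>auto intro: subrng_intros\<close>)
  then show ?thesis
    using poly_map_rhom[OF subfld_subrng[OF subfld_UNIV] assms(2), of p x] by (simp add: polys_over_def)
qed

text \<open>Surjectivity comes from algebraicity: \<open>\<rho>\<close> maps the finite root set of
  a polynomial over \<open>K\<close> injectively into itself, hence onto itself.\<close>

lemma autsI:
  assumes K: "subfld K" and alg: "\<And>x. alg_over K x"
    and h: "rhom UNIV \<rho>" and \<rho>K: "\<And>x. x \<in> K \<Longrightarrow> \<rho> x = x"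
  shows "\<rho> \<in> auts K"
proof -
  note RU = subfld_subrng[OF subfld_UNIV]
  have inj: "inj \<rho>"
  proof (rule injI)
    fix x y assume "\<rho> x = \<rho> y"
    then have "\<rho> (x - y) = 0" using rhom_diff[OF RU h] by simp
    then show "x = y" using rhom_eq_0[OF subfld_UNIV h, of "x - y"] by simp
  qed
  have "y \<in> range \<rho>" for y
  proof -
    obtain p where p: "p \<in> polys_over K" "p \<noteq> 0" "poly p y = 0" using alg[of y] by (auto simp: alg_over_def)
    let ?S = "{z. poly p z = 0}"
    have "\<rho> ` ?S \<subseteq> ?S"
      using poly_map_fixed[OF subfld_subrng[OF K] h \<rho>K p(1)] rhom_0[OF RU h] by (auto, metis)
    moreover have "finite ?S" using p poly_roots_finite by blast
    ultimately have "\<rho> ` ?S = ?S" using inj by (meson endo_inj_surj inj_on_subset subset_UNIV)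
    then show ?thesis using p(3) by blast
  qed
  then have "surj \<rho>" by auto
  then show ?thesis using inj h \<rho>K by (auto simp: auts_def bij_def)
qed

theorem aut_extending:
  fixes K :: "'b::alg_closed_field set"
  assumes K: "subfld K" and alg: "\<And>x. alg_over K x"
    and F: "subfld F" "K \<subseteq> F" and \<phi>: "rhom F \<phi>" "\<And>x. x \<in> K \<Longrightarrow> \<phi> x = x"
  shows "\<exists>\<rho>\<in>auts K. \<forall>x\<in>F. \<rho> x = \<phi> x"
proof -
  define G0 where "G0 = {(x, \<phi> x) | x. x \<in> F}"
  define \<A> where "\<A> = {G. hom_graph G \<and> G0 \<subseteq> G}"
  have "G0 \<in> \<A>" using hom_graph_of_rhom[OF F(1) \<phi>(1)] by (simp add: \<A>_def G0_def)
  then have "\<A> \<noteq> {}" by auto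
  have "\<exists>M\<in>\<A>. \<forall>Z\<in>\<A>. M \<subseteq> Z \<longrightarrow> Z = M"
  proof (rule subset_Zorn_nonempty[OF \<open>\<A> \<noteq> {}\<close>])
    fix \<C> assume ne: "\<C> \<noteq> {}" and ch: "subset.chain \<A> \<C>"
    have sub: "\<C> \<subseteq> \<A>" and lin: "\<And>G H. G \<in> \<C> \<Longrightarrow> H \<in> \<C> \<Longrightarrow> G \<subseteq> H \<or> H \<subseteq> G"
      using ch by (simp_all add: subset_chain_def)
    have "hom_graph (\<Union>\<C>)" by (rule hom_graph_Union[OF ne]) (use sub lin in \<open>auto simp: \<A>_def\<close>)
    moreover have "G0 \<subseteq> \<Union>\<C>"
    proof -
      from ne obtain G where "G \<in> \<C>" by auto
      then show ?thesis using sub by (auto simp: \<A>_def)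
    qed
    ultimately show "\<Union>\<C> \<in> \<A>" by (simp add: \<A>_def)
  qed
  then obtain G where "G \<in> \<A>" and "\<forall>Z\<in>\<A>. G \<subseteq> Z \<longrightarrow> Z = G" by blast
  then have G: "hom_graph G" "G0 \<subseteq> G" and max: "\<And>Z. hom_graph Z \<Longrightarrow> G \<subseteq> Z \<Longrightarrow> Z = G"
    by (auto simp: \<A>_def)
  obtain \<rho> where \<rho>: "subfld (fst ` G)" "rhom (fst ` G) \<rho>" "\<And>x y. (x, y) \<in> G \<Longrightarrow> \<rho> x = y"
    using rhom_of_hom_graph[OF G(1)] by metis
  define L where "L = fst ` G"
  note L = \<rho>(1,2)[folded L_def] and LR = subfld_subrng[OF \<rho>(1)[folded L_def]]
  have FL: "F \<subseteq> L" using G(2) by (force simp: G0_def L_def)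
  have "L = UNIV"
  \<comment> \<open>A proper domain \<open>L\<close> could be enlarged by one algebraic element,
    since its minimal polynomial, transported by \<open>\<rho>\<close>, has a root; this contradicts
    the maximality of the graph.\<close>
  proof (rule ccontr)
    assume "L \<noteq> UNIV"
    then obtain x where x: "x \<notin> L" by auto
    have ax: "alg_over L x" by (rule alg_over_mono[OF alg]) (use F FL in auto)
    obtain \<psi> where \<psi>: "rhom (sext L x) \<psi>" "\<forall>z\<in>L. \<psi> z = \<rho> z" using rhom_extend_alg[OF L ax] by blast
    define G' where "G' = {(z, \<psi> z) | z. z \<in> sext L x}"
    have hg: "hom_graph G'" unfolding G'_def by (rule hom_graph_of_rhom[OF sext_subfld[OF L(1) ax] \<psi>(1)])
    have "G \<subseteq> G'"
    proof (rule subrelI)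
      fix u v assume uv: "(u, v) \<in> G"
      then have "u \<in> L" by (force simp: L_def)
      moreover have "\<psi> u = v" using \<rho>(3)[OF uv] \<psi>(2) \<open>u \<in> L\<close> by simp
      ultimately show "(u, v) \<in> G'" unfolding G'_def using sext_incl[OF LR, of x] by auto
    qed
    then have "G' = G" using max[OF hg] by blast
    moreover have "(x, \<psi> x) \<in> G'" using sext_mem[OF LR, of x] by (auto simp: G'_def)
    ultimately show False using x by (force simp: L_def)
  qed
  then have h: "rhom UNIV \<rho>" using L by simp
  have \<rho>F: "\<rho> x = \<phi> x" if "x \<in> F" for x
    by (rule \<rho>(3)) (use G(2) that in \<open>auto simp: G0_def\<close>)
  have "\<rho> x = x" if "x \<in> K" for x using \<rho>F[of x] \<phi>(2)[of x] F that by auto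
  then have "\<rho> \<in> auts K" by (rule autsI[OF K alg h])
  then show ?thesis using \<rho>F by blast
qed

corollary aut_conjugate:
  fixes F :: "'b::alg_closed_field set"
  assumes F: "subfld F" and alg: "\<And>x. alg_over F x" and f: "is_min_poly F x f" and y: "poly f y = 0"
  shows "\<exists>\<rho>\<in>auts F. \<rho> x = y"
proof -
  note R = subfld_subrng[OF F] and fD = is_min_polyD[OF f]
  have id: "rhom F (\<lambda>x. x)" by (simp add: rhom_def)
  have "\<exists>\<psi>. rhom (sext F x) \<psi> \<and> (\<forall>h\<in>polys_over F. \<psi> (poly h x) = poly (map_poly (\<lambda>x. x) h) y) \<and>
           (\<forall>z\<in>F. \<psi> z = z) \<and> \<psi> x = y"
  proof (rule rhom_extend[OF R id])
    fix h assume h: "h \<in> polys_over F" "poly h x = 0"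
    have "f dvd h" using min_poly_dvd[OF F f h] .
    then show "poly (map_poly (\<lambda>x. x) h) y = 0" using y by (auto elim!: dvdE)
  qed
  then obtain \<psi> where \<psi>: "rhom (sext F x) \<psi>" "\<forall>z\<in>F. \<psi> z = z" "\<psi> x = y" by blast
  have "\<exists>\<rho>\<in>auts F. \<forall>z\<in>sext F x. \<rho> z = \<psi> z"
    by (rule aut_extending[OF F alg sext_subfld[OF F alg] sext_incl[OF R] \<psi>(1)]) (use \<psi> in auto)
  then show ?thesis using \<psi>(3) sext_mem[OF R, of x] by auto
qed

section \<open>Separable elements\<close>

lemma separable_overI:
  assumes "subfld F" "g \<in> polys_over F" "rsquarefree g" "poly g x = 0"
  shows "separable_over F x"
proof -
  have "alg_over F x" using assms by (auto simp: alg_over_def rsquarefree_def)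
  then obtain f where f: "is_min_poly F x f" using min_poly_exists assms(1) by blast
  show ?thesis unfolding separable_over_def
    using f rsquarefree_dvd[OF assms(3) min_poly_dvd[OF assms(1) f assms(2,4)]] by blast
qed

lemma separable_over_mono:
  assumes "subfld F" "K \<subseteq> F" "separable_over K x" shows "separable_over F x"
  using assms polys_over_mono[of K F] unfolding separable_over_def[of K]
  by (auto intro!: separable_overI dest: is_min_polyD)

lemma separable_over_mem: "subfld F \<Longrightarrow> x \<in> F \<Longrightarrow> separable_over F x"
  unfolding separable_over_def using min_poly_of_mem[of F x]
  by (intro exI[of _ "[:- x, 1:]"]) (auto simp: rsquarefree_iff pderiv_pCons)

text \<open>Write z = r(s) with deg r < deg f. If every automorphism over \<open>F\<close> fixed
  \<open>z\<close>, all conjugates of \<open>s\<close> would be roots of r - z; separability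
  provides deg f of them, too many for the degree.\<close>

lemma sep_move:
  fixes F :: "'b::alg_closed_field set"
  assumes F: "subfld F" and alg: "\<And>x. alg_over F x" and s: "separable_over F s"
    and z: "z \<in> sext F s" "z \<notin> F"
  shows "\<exists>\<rho>\<in>auts F. \<rho> z \<noteq> z"
proof (rule ccontr)
  assume "\<not> ?thesis"
  then have fix_z: "\<rho> z = z" if "\<rho> \<in> auts F" for \<rho> using that by blast
  note R = subfld_subrng[OF F]
  obtain f where f: "is_min_poly F s f" "rsquarefree f" using s by (auto simp: separable_over_def)
  note fD = is_min_polyD[OF f(1)]
  obtain h where h: "h \<in> polys_over F" "z = poly h s" using z by (auto simp: sext_def)
  obtain k r where kr: "k \<in> polys_over F" "r \<in> polys_over F" "h = f * k + r" "r = 0 \<or> degree r < degree f"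
    using polys_over_division[OF R fD(1,2) h(1)] by blast
  have zr: "z = poly r s" using h kr fD by simp
  define g where "g = r - [:z:]"
  have "{y. poly f y = 0} \<subseteq> {y. poly g y = 0}"
  proof clarify
    fix y assume "poly f y = 0"
    then obtain \<rho> where \<rho>: "\<rho> \<in> auts F" "\<rho> s = y" using aut_conjugate[OF F alg f(1)] by blast
    have "\<rho> (poly r s) = poly r (\<rho> s)"
      by (rule poly_map_fixed[OF R _ _ kr(2)]) (use \<rho> in \<open>auto simp: auts_def\<close>)
    then show "poly g y = 0" using fix_z[OF \<rho>(1)] \<rho>(2) zr by (simp add: g_def)
  qed
  moreover have g0: "g \<noteq> 0"
  proof
    assume "g = 0"
    then have "coeff r 0 = z" by (simp add: g_def)
    then show False using z(2) polys_overD[OF kr(2), of 0] by simp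
  qed
  ultimately have "degree f \<le> degree g"
    using rsquarefree_card_roots[OF f(2)] card_mono[OF poly_roots_finite[OF g0]] card_poly_roots_bound[OF g0]
    by (metis (no_types, lifting) order_trans)
  moreover have "degree g < degree f"
  proof -
    have "degree g \<le> degree r" unfolding g_def by (rule degree_diff_le) auto
    then show ?thesis using kr(4) fD(5) by auto
  qed
  ultimately show False by simp
qed

text \<open>The separable elements needed for \<open>z\<close> are peeled off one after the other:
  by \<open>sep_move\<close>, a fixed element of F(s) already lies in F. The restriction to
  separable generators is essential, as purely inseparable elements are fixed too.\<close>

lemma fixed_in_fgen_sep:
  fixes K :: "'b::alg_closed_field set"
  assumes K: "subfld K" and alg: "\<And>x. alg_over K x"
    and z: "z \<in> fgen (K \<union> sep_closure K)" and fx: "\<And>\<rho>. \<rho> \<in> auts K \<Longrightarrow> \<rho> z = z"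
  shows "z \<in> K"
proof -
  obtain T where T: "finite T" "T \<subseteq> sep_closure K" "z \<in> fgen (K \<union> T)" using fgen_finitary[OF z] by blast
  from T show ?thesis
  proof (induction T)
    case empty
    then show ?case using fgen_least[OF K, of K] by auto
  next
    case (insert s T)
    let ?F = "fgen (K \<union> T)"
    have KF: "K \<subseteq> ?F" using fgen_incl[of "K \<union> T"] by auto
    have aF: "alg_over ?F x" for x by (rule alg_over_mono[OF alg KF])
    have "separable_over ?F s" by (rule separable_over_mono[OF fgen_subfld KF]) (use insert.prems in \<open>auto simp: sep_closure_def\<close>)
    moreover have "z \<in> sext ?F s" using fgen_insert_alg[OF aF, of s] insert.prems by simp
    ultimately have "z \<in> ?F" using sep_move[OF fgen_subfld aF] auts_mono[OF KF] fx by blast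
    then show ?case using insert by auto
  qed
qed

text \<open>Squarefree by construction, with invariant coefficients. In characteristic p invariance
  alone does not put the coefficients into \<open>K\<close>; it must first be known that they lie in
  a field generated by separable elements.\<close>

definition orbit_poly :: "'b::field set \<Rightarrow> 'b \<Rightarrow> 'b poly" where
  "orbit_poly K z = (\<Prod>o'\<in>(\<lambda>\<rho>. \<rho> z) ` auts K. [:- o', 1:])"

lemma map_rhom_UNIV_prod:
  fixes \<rho> :: "'b::field \<Rightarrow> 'b"
  assumes "rhom UNIV \<rho>" shows "map_poly \<rho> (\<Prod>i\<in>A. f i) = (\<Prod>i\<in>A. map_poly \<rho> (f i))"
proof -
  note RU = subfld_subrng[OF subfld_UNIV]
  have "map_poly \<rho> (p * q) = map_poly \<rho> p * map_poly \<rho> q" for p q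
    by (rule map_rhom_mult[OF RU assms]) (simp_all add: polys_over_def)
  moreover have "map_poly \<rho> 1 = 1"
    using map_rhom_pCons[OF RU assms, of 1 0] map_rhom_0[OF RU assms] rhom_1[OF assms] by (simp add: one_pCons)
  ultimately show ?thesis by (induction A rule: infinite_finite_induct) simp_all
qed

lemma auts_hom: "\<rho> \<in> auts K \<Longrightarrow> rhom UNIV \<rho>" and auts_fix: "\<rho> \<in> auts K \<Longrightarrow> x \<in> K \<Longrightarrow> \<rho> x = x"
  and auts_bij: "\<rho> \<in> auts K \<Longrightarrow> bij \<rho>"
  by (auto simp: auts_def)

context
  fixes K :: "'b::alg_closed_field set"
  assumes K: "subfld K" and alg: "\<And>x. alg_over K x"
begin

lemma finite_orbit: "finite ((\<lambda>\<rho>. \<rho> z) ` auts K)"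
proof -
  obtain p where p: "p \<in> polys_over K" "p \<noteq> 0" "poly p z = 0" using alg[of z] by (auto simp: alg_over_def)
  have "(\<lambda>\<rho>. \<rho> z) ` auts K \<subseteq> {y. poly p y = 0}"
  proof clarify
    fix \<rho> assume \<rho>: "\<rho> \<in> auts K"
    have "poly p (\<rho> z) = \<rho> (poly p z)"
      by (rule poly_map_fixed[symmetric, OF subfld_subrng[OF K] auts_hom[OF \<rho>] auts_fix[OF \<rho>] p(1)])
    then show "poly p (\<rho> z) = 0" using p rhom_0[OF subfld_subrng[OF subfld_UNIV] auts_hom[OF \<rho>]] by simp
  qed
  then show ?thesis using poly_roots_finite[OF p(2)] finite_subset by blast
qed

lemma orbit_poly_root: "poly (orbit_poly K z) z = 0"
  unfolding orbit_poly_def poly_prod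
  by (rule prod_zero[OF finite_orbit]) (use auts_id[of K] in \<open>auto intro!: bexI[of _ z] image_eqI[of _ _ "\<lambda>x. x"]\<close>)

lemma prod_linear_rsquarefree:
  assumes "finite A" shows "rsquarefree (\<Prod>x\<in>A. [:- x, 1:] :: 'b poly)"
proof -
  have lin: "order a [:- x, 1:] = (if x = a then 1 else 0)" for a x :: 'b
    using order_power_n_n[of a 1] by (auto intro: order_0I)
  have "order a (\<Prod>x\<in>A. [:- x, 1:]) = (if a \<in> A then 1 else 0)" for a :: 'b
    using assms
  proof (induction A)
    case (insert x A)
    have "(\<Prod>x\<in>A. [:- x, 1:]) \<noteq> 0" using insert by auto
    then have "order a ([:- x, 1:] * (\<Prod>x\<in>A. [:- x, 1:])) = order a [:- x, 1:] + order a (\<Prod>x\<in>A. [:- x, 1:])"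
      by (intro order_mult) (simp del: mult_pCons_left)
    then show ?case using insert lin by (auto simp del: mult_pCons_left)
  qed (simp add: order_1_eq_0)
  then have "order a (\<Prod>x\<in>A. [:- x, 1:]) \<le> 1" for a :: 'b by simp
  moreover have "(\<Prod>x\<in>A. [:- x, 1:] :: 'b poly) \<noteq> 0" using assms by auto
  ultimately show ?thesis unfolding rsquarefree_def by (metis le_0_eq le_SucE One_nat_def)
qed

lemma orbit_poly_coeff_fixed:
  assumes \<rho>: "\<rho> \<in> auts K" shows "\<rho> (coeff (orbit_poly K z) i) = coeff (orbit_poly K z) i"
proof -
  note RU = subfld_subrng[OF subfld_UNIV] and h = auts_hom[OF \<rho>]
  let ?O = "(\<lambda>\<rho>. \<rho> z) ` auts K"
  have inj: "inj_on \<rho> ?O" using auts_bij[OF \<rho>] by (meson bij_is_inj inj_on_subset subset_UNIV)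
  have "\<rho> ` ?O \<subseteq> ?O" using auts_comp[OF \<rho>] by force
  then have im: "\<rho> ` ?O = ?O" by (rule endo_inj_surj[OF finite_orbit _ inj])
  have "map_poly \<rho> (orbit_poly K z) = (\<Prod>x\<in>?O. [:- \<rho> x, 1:])"
    unfolding orbit_poly_def map_rhom_UNIV_prod[OF h]
    by (simp add: map_rhom_pCons[OF RU h] map_rhom_0[OF RU h] rhom_uminus[OF RU h] rhom_1[OF h])
  also have "\<dots> = (\<Prod>x\<in>\<rho> ` ?O. [:- x, 1:])" by (subst prod.reindex[OF inj]) simp
  also have "\<dots> = orbit_poly K z" by (simp only: im orbit_poly_def)
  finally show ?thesis by (metis coeff_map_rhom[OF RU h])
qed

lemma separable_over_orbit:
  assumes "orbit_poly K z \<in> polys_over K" shows "separable_over K z"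
  by (rule separable_overI[OF K assms _ orbit_poly_root])
     (unfold orbit_poly_def, rule prod_linear_rsquarefree[OF finite_orbit])

text \<open>Here \<open>\<rho>\<close> preserves \<open>F\<close> only as a set, so it carries the
  minimal polynomial to a possibly different squarefree polynomial over \<open>F\<close>. The case
  where \<open>F\<close> is the separable closure needs this generality.\<close>

lemma auts_separable_over:
  assumes "subfld F" "K \<subseteq> F" "\<rho> \<in> auts K" "\<And>x. x \<in> F \<Longrightarrow> \<rho> x \<in> F" "separable_over F z"
  shows "separable_over F (\<rho> z)"
proof -
  note RU = subfld_subrng[OF subfld_UNIV] and h = auts_hom[OF assms(3)]
  obtain f where f: "is_min_poly F z f" "rsquarefree f" using assms(5) by (auto simp: separable_over_def)
  note fD = is_min_polyD[OF f(1)]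
  have all: "p \<in> polys_over UNIV" for p :: "'b poly" by (simp add: polys_over_def)
  have ev: "poly (map_poly \<rho> p) (\<rho> x) = \<rho> (poly p x)" for p x by (rule poly_map_rhom[OF RU h all]) simp
  have inj: "\<rho> x = 0 \<longleftrightarrow> x = 0" for x using rhom_eq_0[OF subfld_UNIV h, of x] rhom_0[OF RU h] by auto
  show ?thesis
  proof (rule separable_overI[OF assms(1), of "map_poly \<rho> f"])
    show "map_poly \<rho> f \<in> polys_over F" unfolding polys_over_def mem_Collect_eq coeff_map_rhom[OF RU h]
      using assms(4) polys_overD[OF fD(1)] by blast
    show "poly (map_poly \<rho> f) (\<rho> z) = 0" using fD ev inj by simp
    show "rsquarefree (map_poly \<rho> f)" unfolding rsquarefree_iff
    proof (intro conjI allI notI)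
      assume "map_poly \<rho> f = 0"
      then have "\<rho> (lead_coeff f) = 0" using coeff_map_rhom[OF RU h] by (metis coeff_0)
      then show False using fD by (simp add: inj)
    next
      fix a assume a: "poly (map_poly \<rho> f) a = 0 \<and> poly (pderiv (map_poly \<rho> f)) a = 0"
      obtain b where b: "a = \<rho> b" using auts_bij[OF assms(3)] by (meson bij_pointE)
      have "poly f b = 0" "poly (pderiv f) b = 0"
        using a by (simp_all add: b ev inj pderiv_map_rhom[OF RU h all])
      then show False using f(2) by (auto simp: rsquarefree_iff)
    qed
  qed
qed

lemma sep_closure_auts: "\<rho> \<in> auts K \<Longrightarrow> x \<in> sep_closure K \<Longrightarrow> \<rho> x \<in> sep_closure K"
  unfolding sep_closure_def using auts_separable_over[OF K order_refl] auts_fix by fastforce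

lemma base_subset_sep_closure: "K \<subseteq> sep_closure K"
  using separable_over_mem[OF K] by (auto simp: sep_closure_def)

lemma auts_fgen:
  assumes "\<rho> \<in> auts K" "\<And>x. x \<in> S \<Longrightarrow> \<rho> x \<in> fgen S" "x \<in> fgen S" shows "\<rho> x \<in> fgen S"
proof -
  note RU = subfld_subrng[OF subfld_UNIV] and h = auts_hom[OF assms(1)]
  have "subfld {x. \<rho> x \<in> fgen S}" unfolding subfld_def subrng_def
    by (auto simp: rhom_0[OF RU h] rhom_1[OF h] rhom_add[OF h] rhom_mult[OF h] rhom_uminus[OF RU h]
        rhom_inverse[OF subfld_UNIV h] intro!: subfld_intros(1-5)[OF fgen_subfld] subfld_inverse[OF fgen_subfld])
  then show ?thesis using fgen_least[of "{x. \<rho> x \<in> fgen S}" S] assms by auto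
qed

text \<open>Sums and products are not treated separately. The field \<open>?N\<close> generated by
  the separable elements is stable under automorphisms, so for \<open>z\<close> in it the orbit
  polynomial has coefficients that lie in \<open>?N\<close> and are fixed, hence lie in
  \<open>K\<close>.\<close>

lemma sep_closure_subfld: "subfld (sep_closure K)"
proof -
  let ?N = "fgen (K \<union> sep_closure K)"
  have "z \<in> sep_closure K" if z: "z \<in> ?N" for z
  proof -
    have "orbit_poly K z \<in> polys_over ?N"
      unfolding orbit_poly_def
    proof (rule polys_over_prod[OF subfld_subrng[OF fgen_subfld]], clarify)
      fix \<rho> assume \<rho>: "\<rho> \<in> auts K"
      have "\<rho> z \<in> ?N"
        by (rule auts_fgen[OF \<rho> _ z]) (use sep_closure_auts[OF \<rho>] auts_fix[OF \<rho>] fgen_incl[of "K \<union> sep_closure K"] in auto)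
      then show "[:- \<rho> z, 1:] \<in> polys_over ?N"
        by (simp add: polys_over_pCons_iff[OF subfld_subrng[OF fgen_subfld]] polys_over_0[OF subfld_subrng[OF fgen_subfld]]
            subfld_intros(2,5)[OF fgen_subfld])
    qed
    then have "orbit_poly K z \<in> polys_over K"
      using fixed_in_fgen_sep[OF K alg] orbit_poly_coeff_fixed by (auto simp: polys_over_def)
    then show ?thesis using separable_over_orbit by (simp add: sep_closure_def)
  qed
  then have "?N = sep_closure K" using fgen_incl[of "K \<union> sep_closure K"] by auto
  then show ?thesis using fgen_subfld[of "K \<union> sep_closure K"] by simp
qed

text \<open>Transitivity of separability. The coefficients of the orbit polynomial descend in two
  stages: to the separable closure, over which all conjugates of \<open>y\<close> are separable, and
  from there to \<open>K\<close>.\<close>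

lemma separable_over_sep_closure:
  assumes "separable_over (sep_closure K) y" shows "y \<in> sep_closure K"
proof -
  let ?S = "sep_closure K"
  let ?N = "fgen (?S \<union> sep_closure ?S)"
  note S = sep_closure_subfld and KS = base_subset_sep_closure
  have algS: "alg_over ?S x" for x by (rule alg_over_mono[OF alg KS])
  have "coeff (orbit_poly K y) i \<in> ?N" for i
  proof -
    have "orbit_poly K y \<in> polys_over ?N"
      unfolding orbit_poly_def
    proof (rule polys_over_prod[OF subfld_subrng[OF fgen_subfld]], clarify)
      fix \<rho> assume \<rho>: "\<rho> \<in> auts K"
      have "separable_over ?S (\<rho> y)" by (rule auts_separable_over[OF S KS \<rho> _ assms]) (rule sep_closure_auts[OF \<rho>])
      then have "\<rho> y \<in> ?N" using fgen_incl[of "?S \<union> sep_closure ?S"] by (auto simp: sep_closure_def)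
      then show "[:- \<rho> y, 1:] \<in> polys_over ?N"
        by (simp add: polys_over_pCons_iff[OF subfld_subrng[OF fgen_subfld]] polys_over_0[OF subfld_subrng[OF fgen_subfld]]
            subfld_intros(2,5)[OF fgen_subfld])
    qed
    then show ?thesis by (rule polys_overD)
  qed
  then have "coeff (orbit_poly K y) i \<in> ?S" for i
    using fixed_in_fgen_sep[OF S algS] orbit_poly_coeff_fixed auts_mono[OF KS] by blast
  then have "coeff (orbit_poly K y) i \<in> fgen (K \<union> ?S)" for i using fgen_incl[of "K \<union> ?S"] by blast
  then have "orbit_poly K y \<in> polys_over K"
    using fixed_in_fgen_sep[OF K alg] orbit_poly_coeff_fixed by (auto simp: polys_over_def)
  then show ?thesis using separable_over_orbit by (simp add: sep_closure_def)
qed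

end

section \<open>Euclidean subrings with finite residue fields\<close>

text \<open>The property of powers of the characteristic exponent that is needed: q = 1 always
  qualifies, and so do the powers of a positive characteristic. It avoids a case
  distinction.\<close>

definition addexp :: "'b::field itself \<Rightarrow> nat \<Rightarrow> bool" where
  "addexp _ q \<longleftrightarrow> q > 0 \<and> (\<forall>x y :: 'b. (x + y) ^ q = x ^ q + y ^ q)"

lemma addexp_diff: assumes "addexp TYPE('b::field) q" shows "((x :: 'b::field) - y) ^ q = x ^ q - y ^ q"
proof -
  have "((x - y) + y) ^ q = (x - y) ^ q + y ^ q" using assms unfolding addexp_def by blast
  then show ?thesis by simp
qed

text \<open>Common properties of Z with the absolute value and of F_p[t] with 2^deg. Finite balls
  together with division make all residue rings finite; multiplicativity identifies the units as the
  elements of size 1 and makes the size drop when a prime factor is removed.\<close>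

locale euclid =
  fixes D :: "'b::field set" and \<delta> :: "'b \<Rightarrow> nat"
  assumes D: "subrng D" and infinite_D: "infinite D"
    and finite_ball: "finite {x \<in> D. \<delta> x \<le> n}"
    and division: "a \<in> D \<Longrightarrow> b \<in> D \<Longrightarrow> b \<noteq> 0 \<Longrightarrow> \<exists>q\<in>D. \<exists>r\<in>D. a = b * q + r \<and> \<delta> r < \<delta> b"
    and \<delta>_mult: "a \<in> D \<Longrightarrow> b \<in> D \<Longrightarrow> \<delta> (a * b) = \<delta> a * \<delta> b"
    and \<delta>_eq_0: "a \<in> D \<Longrightarrow> \<delta> a = 0 \<longleftrightarrow> a = 0"
begin

text \<open>The library relation \<open>dvd\<close> is trivial on a field type, hence the explicit
  quotient in \<open>D\<close>.\<close>

definition ddvd :: "'b \<Rightarrow> 'b \<Rightarrow> bool" where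
  "ddvd a b \<longleftrightarrow> (\<exists>z\<in>D. b = a * z)"

lemma ddvd_0: "ddvd a 0" unfolding ddvd_def using subrng_0[OF D] by force

lemma ddvd_self: "ddvd a a" unfolding ddvd_def using subrng_1[OF D] by force

lemma ddvd_mult: "ddvd a b \<Longrightarrow> c \<in> D \<Longrightarrow> ddvd a (b * c)"
  unfolding ddvd_def using subrng_mult[OF D] by (force simp: mult.assoc)

lemma ddvd_mult2: "ddvd a b \<Longrightarrow> c \<in> D \<Longrightarrow> ddvd a (c * b)"
  using ddvd_mult[of a b c] by (simp add: mult.commute)

lemma ddvd_add: "ddvd a b \<Longrightarrow> ddvd a c \<Longrightarrow> ddvd a (b + c)"
  unfolding ddvd_def using subrng_add[OF D] by (force simp flip: distrib_left)

lemma ddvd_uminus: "ddvd a b \<Longrightarrow> ddvd a (- b)"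
  using ddvd_mult[of a b "- 1"] subrng_uminus[OF D subrng_1[OF D]] by simp

lemma ddvd_diff: "ddvd a b \<Longrightarrow> ddvd a c \<Longrightarrow> ddvd a (b - c)"
  using ddvd_add[OF _ ddvd_uminus, of a b c] by simp

lemma ddvd_lin: "ddvd a b \<Longrightarrow> ddvd a c \<Longrightarrow> x \<in> D \<Longrightarrow> y \<in> D \<Longrightarrow> z = b * x + c * y \<Longrightarrow> ddvd a z"
  by (simp add: ddvd_add ddvd_mult)

lemma ddvd_trans: "ddvd a b \<Longrightarrow> ddvd b c \<Longrightarrow> ddvd a c"
  unfolding ddvd_def using subrng_mult[OF D] by (force simp: mult.assoc)

lemma ddvd_sym: "ddvd a (x - y) \<Longrightarrow> ddvd a (y - x)"
  using ddvd_uminus[of a "x - y"] by simp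

lemma \<delta>_1: "\<delta> 1 = 1"
  using \<delta>_mult[of 1 1] \<delta>_eq_0[of 1] subrng_1[OF D] by simp

lemma unit_iff: assumes "u \<in> D" shows "ddvd u 1 \<longleftrightarrow> \<delta> u = 1"
proof
  assume "ddvd u 1"
  then obtain z where "z \<in> D" "1 = u * z" by (auto simp: ddvd_def)
  then show "\<delta> u = 1" using \<delta>_mult[OF assms, of z] \<delta>_1 by simp
next
  assume u: "\<delta> u = 1"
  then have "u \<noteq> 0" using \<delta>_eq_0[OF assms] by auto
  then obtain q r where "q \<in> D" "r \<in> D" "1 = u * q + r" "\<delta> r < 1"
    using division[OF subrng_1[OF D] assms] u by auto
  then show "ddvd u 1" using \<delta>_eq_0[of r] by (auto simp: ddvd_def)
qed

text \<open>Equivalently, \<open>D/\<pi>D\<close> is a field.\<close>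
definition pr :: "'b \<Rightarrow> bool" where
  "pr \<pi> \<longleftrightarrow> \<pi> \<in> D \<and> \<pi> \<noteq> 0 \<and> \<not> ddvd \<pi> 1 \<and> (\<forall>x\<in>D. \<not> ddvd \<pi> x \<longrightarrow> (\<exists>y\<in>D. ddvd \<pi> (x * y - 1)))"

text \<open>A nonunit divisor of \<open>u\<close> of least size works; invertibility modulo it is a
  Bezout argument.\<close>

lemma exists_pr:
  assumes u: "u \<in> D" "u \<noteq> 0" "\<not> ddvd u 1"
  shows "\<exists>\<pi>. pr \<pi> \<and> ddvd \<pi> u"
proof -
  define P where "P \<pi> \<longleftrightarrow> \<pi> \<in> D \<and> ddvd \<pi> u \<and> \<not> ddvd \<pi> 1" for \<pi>
  have "P u" using u ddvd_self by (simp add: P_def)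
  then obtain \<pi> where \<pi>: "P \<pi>" and min: "\<And>\<rho>. P \<rho> \<Longrightarrow> \<delta> \<pi> \<le> \<delta> \<rho>"
    using ex_has_least_nat[of P u \<delta>] by blast
  have \<pi>D: "\<pi> \<in> D" "ddvd \<pi> u" "\<not> ddvd \<pi> 1" using \<pi> by (auto simp: P_def)
  have \<pi>0: "\<pi> \<noteq> 0" using \<pi>D(2) u by (auto simp: ddvd_def)
  have "\<exists>y\<in>D. ddvd \<pi> (x * y - 1)" if x: "x \<in> D" "\<not> ddvd \<pi> x" for x
  proof -
    \<comment> \<open>The ideal generated by \<open>\<pi>\<close> and \<open>x\<close>; its nonzero
      element \<open>g\<close> of least size divides all of it.\<close>
    define I where "I = {\<pi> * a + x * b | a b. a \<in> D \<and> b \<in> D}"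
    have I_D: "I \<subseteq> D" unfolding I_def using D \<pi>D x by (auto intro!: subrng_intros)
    have \<pi>I: "\<pi> \<in> I" unfolding I_def using subrng_0[OF D] subrng_1[OF D] by force
    have xI: "x \<in> I" unfolding I_def using subrng_0[OF D] subrng_1[OF D] by force
    obtain g where g: "g \<in> I \<and> g \<noteq> 0" and gmin: "\<And>h. h \<in> I \<and> h \<noteq> 0 \<Longrightarrow> \<delta> g \<le> \<delta> h"
      using ex_has_least_nat[of "\<lambda>g. g \<in> I \<and> g \<noteq> 0" \<pi> \<delta>] \<pi>I \<pi>0 by blast
    have dv: "ddvd g h" if h: "h \<in> I" for h
    proof -
      obtain q r where qr: "q \<in> D" "r \<in> D" "h = g * q + r" "\<delta> r < \<delta> g"
        using division[of h g] g h I_D by blast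
      obtain a b a' b' where ab: "g = \<pi> * a + x * b" "h = \<pi> * a' + x * b'" "a \<in> D" "b \<in> D" "a' \<in> D" "b' \<in> D"
        using g h unfolding I_def by blast
      have "r = \<pi> * (a' - a * q) + x * (b' - b * q)" using qr(3) ab by (simp add: algebra_simps)
      moreover have "a' - a * q \<in> D" "b' - b * q \<in> D" using ab qr D by (auto intro!: subrng_intros)
      ultimately have "r \<in> I" unfolding I_def by blast
      then have "r = 0" using gmin[of r] qr(4) by auto
      then show ?thesis using qr by (auto simp: ddvd_def)
    qed
    have gD: "g \<in> D" using g I_D by auto
    have "ddvd g 1"
    proof (rule ccontr)
      assume ng: "\<not> ddvd g 1"
      \<comment> \<open>As a nonunit divisor of \<open>u\<close>, \<open>g\<close> is at least as
        large as \<open>\<pi>\<close>. So the cofactor \<open>k\<close> is a unit, and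
        \<open>\<pi>\<close> divides \<open>g\<close> and therefore \<open>x\<close>.\<close>
      obtain k where k: "k \<in> D" "\<pi> = g * k" using dv[OF \<pi>I] by (auto simp: ddvd_def)
      have "\<delta> \<pi> \<le> \<delta> g" by (rule min) (use gD ng ddvd_trans[OF dv[OF \<pi>I] \<pi>D(2)] in \<open>simp add: P_def\<close>)
      moreover have "\<delta> \<pi> = \<delta> g * \<delta> k" using \<delta>_mult[OF gD k(1)] k by simp
      moreover have "\<delta> g > 0" "\<delta> k > 0" using g gD k \<pi>0 \<delta>_eq_0 by (auto simp: neq0_conv[symmetric])
      ultimately have "\<delta> k = 1" by (cases "\<delta> k") auto
      then obtain k' where "k' \<in> D" "1 = k * k'" using unit_iff[OF k(1)] by (auto simp: ddvd_def)
      then have "ddvd \<pi> g" unfolding ddvd_def using k by (intro bexI[of _ k']) (simp_all add: mult.assoc)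
      then show False using x(2) ddvd_trans dv[OF xI] by blast
    qed
    then obtain y where y: "y \<in> D" "1 = g * y" by (auto simp: ddvd_def)
    obtain a b where ab: "g = \<pi> * a + x * b" "a \<in> D" "b \<in> D" using g unfolding I_def by blast
    have "x * (b * y) - 1 = \<pi> * (- (a * y))" using y(2) ab(1) by (simp add: algebra_simps)
    then have "ddvd \<pi> (x * (b * y) - 1)" unfolding ddvd_def
      using ab y D by (intro bexI[of _ "- (a * y)"]) (auto intro!: subrng_intros)
    then show ?thesis using ab y D by (auto intro: subrng_intros)
  qed
  then show ?thesis using \<pi>D \<pi>0 by (auto simp: pr_def)
qed

lemma pr_mult:
  assumes \<pi>: "pr \<pi>" and xy: "x \<in> D" "y \<in> D" "ddvd \<pi> (x * y)" shows "ddvd \<pi> x \<or> ddvd \<pi> y"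
proof (rule disjCI)
  assume "\<not> ddvd \<pi> y"
  then obtain z where z: "z \<in> D" "ddvd \<pi> (y * z - 1)" using \<pi> xy by (auto simp: pr_def)
  show "ddvd \<pi> x"
    by (rule ddvd_lin[OF xy(3) z(2) z(1) subrng_uminus[OF D xy(1)]]) (simp add: algebra_simps)
qed

lemma pr_power: "pr \<pi> \<Longrightarrow> x \<in> D \<Longrightarrow> ddvd \<pi> (x ^ n) \<Longrightarrow> ddvd \<pi> x"
proof (induction n)
  case 0 then show ?case by (simp add: pr_def)
next
  case (Suc n) then show ?case using pr_mult[of \<pi> x "x ^ n"] D by (auto intro: subrng_power)
qed

lemma pr_\<delta>: assumes "pr \<pi>" shows "\<delta> \<pi> \<ge> 2"
proof -
  have "\<delta> \<pi> \<noteq> 0" "\<delta> \<pi> \<noteq> 1" using assms \<delta>_eq_0[of \<pi>] unit_iff[of \<pi>] by (auto simp: pr_def)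
  then show ?thesis by linarith
qed

section \<open>Residue classes modulo a prime\<close>

context
  fixes \<pi> :: 'b
  assumes \<pi>: "pr \<pi>"
begin

definition rep :: "'b \<Rightarrow> 'b" where "rep x = (SOME y. y \<in> D \<and> ddvd \<pi> (x - y))"

lemma rep: assumes "x \<in> D" shows "rep x \<in> D" "ddvd \<pi> (x - rep x)"
proof -
  have "rep x \<in> D \<and> ddvd \<pi> (x - rep x)"
    unfolding rep_def by (rule someI[of _ x]) (use assms ddvd_0 in simp)
  then show "rep x \<in> D" "ddvd \<pi> (x - rep x)" by auto
qed

lemma rep_eq: assumes "ddvd \<pi> (x - y)" shows "rep x = rep y"
proof -
  have "ddvd \<pi> (x - z) \<longleftrightarrow> ddvd \<pi> (y - z)" for z
    using ddvd_add[OF assms, of "y - z"] ddvd_diff[OF _ assms, of "x - z"] by auto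
  then show ?thesis by (simp add: rep_def)
qed

lemma rep_eq_iff: assumes "x \<in> D" "y \<in> D" shows "rep x = rep y \<longleftrightarrow> ddvd \<pi> (x - y)"
proof
  assume e: "rep x = rep y"
  then have "ddvd \<pi> ((x - rep x) - (y - rep y))" by (intro ddvd_diff rep assms)
  then show "ddvd \<pi> (x - y)" using e by simp
qed (rule rep_eq)

lemma rep_rep: "x \<in> D \<Longrightarrow> rep (rep x) = rep x"
  by (rule rep_eq[OF ddvd_sym[OF rep(2)]])

lemma finite_rep: "finite (rep ` D)"
proof -
  have "rep x \<in> rep ` {r \<in> D. \<delta> r \<le> \<delta> \<pi>}" if x: "x \<in> D" for x
  proof -
    obtain q r where qr: "q \<in> D" "r \<in> D" "x = \<pi> * q + r" "\<delta> r < \<delta> \<pi>"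
      using division[OF x, of \<pi>] \<pi> unfolding pr_def by blast
    have "x - r = \<pi> * q" using qr(3) by simp
    then have "rep x = rep r" using qr(1) by (intro rep_eq) (auto simp: ddvd_def)
    then show ?thesis using qr by auto
  qed
  then have "rep ` D \<subseteq> rep ` {r \<in> D. \<delta> r \<le> \<delta> \<pi>}" by auto
  then show ?thesis by (rule finite_subset[OF _ finite_imageI[OF finite_ball]])
qed

lemma mod_inj_surj:
  assumes f: "\<And>x. x \<in> D \<Longrightarrow> f x \<in> D" and inj: "\<And>x y. x \<in> D \<Longrightarrow> y \<in> D \<Longrightarrow> ddvd \<pi> (f x - f y) \<Longrightarrow> ddvd \<pi> (x - y)"
    and y: "y \<in> D"
  shows "\<exists>x\<in>D. ddvd \<pi> (f x - y)"
proof -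
  let ?R = "rep ` D"
  have RD: "r \<in> D" if "r \<in> ?R" for r using that rep(1) by (elim imageE) simp
  have rr: "rep r = r" if "r \<in> ?R" for r using that rep_rep by (elim imageE) simp
  have "inj_on (\<lambda>r. rep (f r)) ?R"
  proof (rule inj_onI)
    fix r s assume rs: "r \<in> ?R" "s \<in> ?R" "rep (f r) = rep (f s)"
    note rs' = RD[OF rs(1)] RD[OF rs(2)]
    have "ddvd \<pi> (f r - f s)" using rep_eq_iff[OF f[OF rs'(1)] f[OF rs'(2)]] rs(3) by simp
    from rep_eq[OF inj[OF rs' this]] have "rep r = rep s" .
    then show "r = s" unfolding rr[OF rs(1)] rr[OF rs(2)] .
  qed
  moreover have "(\<lambda>r. rep (f r)) ` ?R \<subseteq> ?R" using imageI[OF f[OF RD], of _ rep] by blast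
  ultimately have "(\<lambda>r. rep (f r)) ` ?R = ?R" using endo_inj_surj[OF finite_rep] by blast
  then have "rep y \<in> (\<lambda>r. rep (f r)) ` ?R" using y by blast
  then obtain r where r: "r \<in> ?R" "rep y = rep (f r)" by (rule imageE)
  then show ?thesis using rep_eq_iff[OF f[OF RD[OF r(1)]] y] RD[OF r(1)] r(2) by auto
qed

text \<open>Pigeonhole: a self-map of the finite residue ring that identifies two classes misses a
  third one. All unsolvable congruences below originate here.\<close>

lemma mod_not_surj:
  assumes f: "\<And>x. x \<in> D \<Longrightarrow> f x \<in> D" and cong: "\<And>x y. x \<in> D \<Longrightarrow> y \<in> D \<Longrightarrow> ddvd \<pi> (x - y) \<Longrightarrow> ddvd \<pi> (f x - f y)"
    and ab: "a \<in> D" "b \<in> D" "\<not> ddvd \<pi> (a - b)" "f a = f b"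
  shows "\<exists>y\<in>D. \<forall>x\<in>D. \<not> ddvd \<pi> (f x - y)"
proof (rule ccontr)
  assume "\<not> ?thesis"
  then have surj: "\<exists>x\<in>D. ddvd \<pi> (f x - y)" if "y \<in> D" for y using that by blast
  let ?R = "rep ` D"
  have RD: "r \<in> D" if "r \<in> ?R" for r using that rep(1) by (elim imageE) simp
  have rr: "rep r = r" if "r \<in> ?R" for r using that rep_rep by (elim imageE) simp
  let ?g = "\<lambda>r. rep (f r)"
  have gg: "?g (rep x) = ?g x" if x: "x \<in> D" for x
    by (rule rep_eq[OF cong[OF rep(1)[OF x] x ddvd_sym[OF rep(2)[OF x]]]])
  have "?g ` ?R = ?R"
  proof
    show "?g ` ?R \<subseteq> ?R" using imageI[OF f[OF RD], of _ rep] by blast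
    show "?R \<subseteq> ?g ` ?R"
    proof clarify
      fix y assume "y \<in> D"
      then obtain x where x: "x \<in> D" "ddvd \<pi> (f x - y)" using surj by blast
      have "?g (rep x) = rep y" using gg[OF x(1)] rep_eq[OF x(2)] by simp
      then show "rep y \<in> ?g ` ?R" using x(1) by (metis imageI)
    qed
  qed
  then have "inj_on ?g ?R" using finite_rep by (simp add: eq_card_imp_inj_on)
  moreover have "?g (rep a) = ?g (rep b)" unfolding gg[OF ab(1)] gg[OF ab(2)] ab(4) by (rule refl)
  ultimately have "rep a = rep b" using ab(1,2) by (metis imageI inj_onD)
  then show False using ab(3) rep_eq_iff[OF ab(1,2)] by simp
qed

end

section \<open>Residues for which the equations are unsolvable\<close>

lemma mod_power_surj:
  assumes "pr \<pi>" "addexp TYPE('b) q" "y \<in> D" shows "\<exists>x\<in>D. ddvd \<pi> (x ^ q - y)"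
proof (rule mod_inj_surj[OF assms(1)])
  fix x y assume "x \<in> D" "y \<in> D" "ddvd \<pi> (x ^ q - y ^ q)"
  then show "ddvd \<pi> (x - y)"
    using pr_power[OF assms(1), of "x - y" q] addexp_diff[OF assms(2), of x y] D by (simp add: subrng_diff)
qed (use assms D in \<open>auto intro: subrng_power\<close>)

lemma ddvd_power_diff: "x \<in> D \<Longrightarrow> y \<in> D \<Longrightarrow> ddvd \<pi> (x - y) \<Longrightarrow> ddvd \<pi> (x ^ n - y ^ n)"
proof (induction n)
  case (Suc n)
  have "ddvd \<pi> ((x - y) * x ^ n)" using Suc.prems D by (intro ddvd_mult) (auto intro: subrng_intros)
  moreover have "ddvd \<pi> ((x ^ n - y ^ n) * y)" using Suc D by (intro ddvd_mult) auto
  moreover have "x ^ Suc n - y ^ Suc n = (x - y) * x ^ n + (x ^ n - y ^ n) * y" by (simp add: algebra_simps)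
  ultimately show ?case by (simp add: ddvd_add)
qed (simp add: ddvd_0)

text \<open>w^2 + w vanishes at 0 and at -1, which differ modulo every prime, 2 included.\<close>

lemma not_artin_schreier:
  assumes \<pi>: "pr \<pi>" shows "\<exists>y\<in>D. \<forall>w\<in>D. \<not> ddvd \<pi> (w ^ 2 + w - y)"
proof (rule mod_not_surj[OF \<pi>, of "\<lambda>w. w ^ 2 + w" 0 "- 1"])
  fix x y assume xy: "x \<in> D" "y \<in> D" "ddvd \<pi> (x - y)"
  have "x ^ 2 + x - (y ^ 2 + y) = (x - y) * (x + y + 1)" by (simp add: algebra_simps power2_eq_square)
  then show "ddvd \<pi> (x ^ 2 + x - (y ^ 2 + y))"
    using ddvd_mult[OF xy(3), of "x + y + 1"] xy D by (auto intro: subrng_intros)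
qed (use \<pi> D in \<open>auto simp: pr_def intro: subrng_intros\<close>)

lemma generic_linear:
  assumes \<pi>: "pr \<pi>" and q: "addexp TYPE('b) q" and a: "a \<in> D" "\<not> ddvd \<pi> a"
  shows "\<exists>c0\<in>D. \<forall>c\<in>D. ddvd \<pi> (c - c0) \<longrightarrow> (\<forall>w\<in>D. \<not> ddvd \<pi> (w ^ 2 + w - c ^ q * a))"
proof -
  obtain y where y: "y \<in> D" "\<And>w. w \<in> D \<Longrightarrow> \<not> ddvd \<pi> (w ^ 2 + w - y)" using not_artin_schreier[OF \<pi>] by blast
  obtain a' where a': "a' \<in> D" "ddvd \<pi> (a * a' - 1)" using \<pi> a by (auto simp: pr_def)
  have ya: "y * a' \<in> D" using y a' D by (auto intro: subrng_intros)
  \<comment> \<open>Chosen so that c0^q a is congruent to \<open>y\<close>, a residue that w^2 + w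
    omits.\<close>
  obtain c0 where c0: "c0 \<in> D" "ddvd \<pi> (c0 ^ q - y * a')" using mod_power_surj[OF \<pi> q ya] by blast
  have "\<not> ddvd \<pi> (w ^ 2 + w - c ^ q * a)" if c: "c \<in> D" "ddvd \<pi> (c - c0)" and w: "w \<in> D" for c w
  proof
    assume *: "ddvd \<pi> (w ^ 2 + w - c ^ q * a)"
    have "ddvd \<pi> (c ^ q - c0 ^ q)" using ddvd_power_diff[OF c(1) c0(1) c(2)] .
    from ddvd_add[OF this c0(2)] have "ddvd \<pi> ((c ^ q - y * a') * a)" using a by (intro ddvd_mult) simp_all
    moreover have "ddvd \<pi> ((a * a' - 1) * y)" by (rule ddvd_mult[OF a'(2) y(1)])
    ultimately have "ddvd \<pi> ((w ^ 2 + w - c ^ q * a) + ((c ^ q - y * a') * a + (a * a' - 1) * y))"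
      by (intro ddvd_add *)
    then have "ddvd \<pi> (w ^ 2 + w - y)" by (simp add: algebra_simps)
    then show False using y(2)[OF w] by simp
  qed
  then show ?thesis using c0(1) by blast
qed

lemma not_square:
  assumes \<pi>: "pr \<pi>" and two: "\<not> ddvd \<pi> 2" shows "\<exists>y\<in>D. \<forall>w\<in>D. \<not> ddvd \<pi> (w ^ 2 - y)"
proof (rule mod_not_surj[OF \<pi>, of "\<lambda>w. w ^ 2" 1 "- 1"])
  fix x y assume "x \<in> D" "y \<in> D" "ddvd \<pi> (x - y)"
  then show "ddvd \<pi> (x ^ 2 - y ^ 2)" by (rule ddvd_power_diff)
qed (use two D in \<open>auto intro: subrng_intros\<close>)

text \<open>Put k = c^q. If 2 = 0, the expression is k (a - b) and the linear case applies.
  Otherwise multiplication by 4 and adding 1 turns solvability into (1 + 4 k a)(1 + 4 k b) being a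
  square modulo \<open>\<pi>\<close>. So k is chosen with 1 + 4 k a congruent to n (1 + 4 k b) for a
  nonsquare n.\<close>

lemma generic_quadratic:
  assumes \<pi>: "pr \<pi>" and q: "addexp TYPE('b) q" and a: "a \<in> D" "\<not> ddvd \<pi> a" and b: "b \<in> D" "\<not> ddvd \<pi> b"
    and ab: "\<not> ddvd \<pi> (a - b)"
    and char: "(2::'b) = 0 \<or> (\<not> ddvd \<pi> 2 \<and> (\<exists>u\<in>D. \<not> ddvd \<pi> u \<and> \<not> ddvd \<pi> (u ^ 2 - 1)))"
  shows "\<exists>c0\<in>D. \<forall>c\<in>D. ddvd \<pi> (c - c0) \<longrightarrow>
    (\<forall>w\<in>D. \<not> ddvd \<pi> (w ^ 2 + w - (c ^ q * (a + b) + 4 * (c ^ q) ^ 2 * (a * b))))"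
  using char
proof
  assume two: "(2::'b) = 0"
  have "(4::'b) = 2 * 2" by simp
  then have four: "(4::'b) = 0" using two by simp
  have "a + b = a - b + 2 * b" by simp
  then have diff: "a + b = a - b" using two by simp
  show ?thesis unfolding diff four
    using generic_linear[OF \<pi> q subrng_diff[OF D a(1) b(1)] ab] by simp
next
  assume "\<not> ddvd \<pi> 2 \<and> (\<exists>u\<in>D. \<not> ddvd \<pi> u \<and> \<not> ddvd \<pi> (u ^ 2 - 1))"
  then obtain u where two: "\<not> ddvd \<pi> 2" and u: "u \<in> D" "\<not> ddvd \<pi> u" "\<not> ddvd \<pi> (u ^ 2 - 1)" by blast
  note I = subrng_intros[OF D]
  note M = pr_mult[OF \<pi>]
  have four: "\<not> ddvd \<pi> 4" using M[of 2 2] two I by auto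
  obtain n0 where n0: "n0 \<in> D" "\<And>w. w \<in> D \<Longrightarrow> \<not> ddvd \<pi> (w ^ 2 - n0)" using not_square[OF \<pi> two] by blast
  have n00: "\<not> ddvd \<pi> n0" using n0(2)[of 0] I ddvd_uminus[of \<pi> n0] by auto
  \<comment> \<open>The congruence for k is solvable if a - n b is a unit. Of the nonsquares n0 and
    u^2 n0 at least one achieves this, because their difference (u^2 - 1) n0 does not vanish modulo
    \<open>\<pi>\<close>, nor does b.\<close>
  have "\<exists>n\<in>D. (\<forall>w\<in>D. \<not> ddvd \<pi> (w ^ 2 - n)) \<and> \<not> ddvd \<pi> (a - n * b)"
  proof (cases "ddvd \<pi> (a - n0 * b)")
    case True
    obtain u' where u': "u' \<in> D" "ddvd \<pi> (u * u' - 1)" using \<pi> u by (auto simp: pr_def)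
    have "\<not> ddvd \<pi> (w ^ 2 - u ^ 2 * n0)" if w: "w \<in> D" for w
    proof
      assume *: "ddvd \<pi> (w ^ 2 - u ^ 2 * n0)"
      have "ddvd \<pi> ((w * u') ^ 2 - n0)"
        by (rule ddvd_lin[OF * u'(2), of "u' ^ 2" "n0 * (u * u' + 1)"])
           (use u' u n0 w I in \<open>auto simp: algebra_simps power2_eq_square\<close>)
      then show False using n0(2)[of "w * u'"] w u' I by auto
    qed
    moreover have "\<not> ddvd \<pi> (a - u ^ 2 * n0 * b)"
    proof
      assume "ddvd \<pi> (a - u ^ 2 * n0 * b)"
      from ddvd_diff[OF True this] have "ddvd \<pi> ((u ^ 2 - 1) * (n0 * b))" by (simp add: algebra_simps)
      then have "ddvd \<pi> (u ^ 2 - 1) \<or> ddvd \<pi> n0 \<or> ddvd \<pi> b"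
        using M[of "u ^ 2 - 1" "n0 * b"] M[of n0 b] u n0 b I by auto
      then show False using u n00 b by auto
    qed
    ultimately show ?thesis using u n0 I by (intro bexI[of _ "u ^ 2 * n0"]) auto
  qed (use n0 in auto)
  then obtain n where n: "n \<in> D" "\<And>w. w \<in> D \<Longrightarrow> \<not> ddvd \<pi> (w ^ 2 - n)" "\<not> ddvd \<pi> (a - n * b)" by blast
  have "\<not> ddvd \<pi> (4 * (a - n * b))" using M[of 4 "a - n * b"] four n a b I by auto
  then obtain z where z: "z \<in> D" "ddvd \<pi> (4 * (a - n * b) * z - 1)"
    using \<pi> n a b I unfolding pr_def by (metis)
  \<comment> \<open>The solution of 1 + 4 r a = n (1 + 4 r b) modulo \<open>\<pi>\<close>.\<close>
  define r where "r = (n - 1) * z"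
  have r: "r \<in> D" using n z I by (auto simp: r_def)
  have r1: "ddvd \<pi> (4 * r * (a - n * b) - (n - 1))"
    using ddvd_mult[OF z(2), of "n - 1"] n I by (simp add: r_def algebra_simps)
  obtain c0 where c0: "c0 \<in> D" "ddvd \<pi> (c0 ^ q - r)" using mod_power_surj[OF \<pi> q r] by blast
  have "\<not> ddvd \<pi> (w ^ 2 + w - (c ^ q * (a + b) + 4 * (c ^ q) ^ 2 * (a * b)))"
    if c: "c \<in> D" "ddvd \<pi> (c - c0)" and w: "w \<in> D" for c w
  proof
    define k where "k = c ^ q"
    have k: "k \<in> D" using c I by (auto simp: k_def)
    assume "ddvd \<pi> (w ^ 2 + w - (c ^ q * (a + b) + 4 * (c ^ q) ^ 2 * (a * b)))"
    then have "ddvd \<pi> ((w ^ 2 + w - (k * (a + b) + 4 * k ^ 2 * (a * b))) * 4)"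
      using I by (intro ddvd_mult) (simp_all add: k_def)
    moreover have "(w ^ 2 + w - (k * (a + b) + 4 * k ^ 2 * (a * b))) * 4 = (2 * w + 1) ^ 2 - (1 + 4 * k * a) * (1 + 4 * k * b)"
      by (simp add: algebra_simps power2_eq_square)
    ultimately have sq: "ddvd \<pi> ((2 * w + 1) ^ 2 - (1 + 4 * k * a) * (1 + 4 * k * b))" by simp
    have kr: "ddvd \<pi> (k - r)"
      using ddvd_add[OF ddvd_power_diff[OF c(1) c0(1) c(2), of q] c0(2)] by (simp add: k_def)
    have k1: "ddvd \<pi> ((1 + 4 * k * a) - n * (1 + 4 * k * b))"
      by (rule ddvd_lin[OF kr r1, of "4 * (a - n * b)" 1]) (use a b n I in \<open>auto simp: algebra_simps\<close>)
    define B where "B = 1 + 4 * k * b"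
    have B: "B \<in> D" using k b I by (auto simp: B_def)
    show False
    proof (cases "ddvd \<pi> B")
      case True
      \<comment> \<open>If both factors vanish modulo \<open>\<pi>\<close>, so does their difference
        4 k (a - b), hence k; but then B would be 1.\<close>
      have "ddvd \<pi> (1 + 4 * k * a)" by (rule ddvd_lin[OF k1 True, of 1 n]) (use n I in \<open>auto simp: B_def\<close>)
      from ddvd_diff[OF this True] have "ddvd \<pi> (4 * (k * (a - b)))" by (simp add: B_def algebra_simps)
      then have "ddvd \<pi> k" using M[of 4 "k * (a - b)"] M[of k "a - b"] four ab k a b I by auto
      have "ddvd \<pi> 1" by (rule ddvd_lin[OF True \<open>ddvd \<pi> k\<close>, of 1 "- (4 * b)"]) (use b I in \<open>auto simp: B_def\<close>)
      then show False using \<pi> by (simp add: pr_def)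
    next
      case False
      then obtain B' where B': "B' \<in> D" "ddvd \<pi> (B * B' - 1)" using \<pi> B by (auto simp: pr_def)
      have sq2: "ddvd \<pi> ((2 * w + 1) ^ 2 - n * B ^ 2)"
        by (rule ddvd_lin[OF sq k1, of 1 B]) (use B I in \<open>auto simp: B_def algebra_simps power2_eq_square\<close>)
      have "ddvd \<pi> (((2 * w + 1) * B') ^ 2 - n)"
        by (rule ddvd_lin[OF sq2 B'(2), of "B' ^ 2" "n * (B * B' + 1)"])
           (use B B' n I in \<open>auto simp: algebra_simps power2_eq_square\<close>)
      then show False using n(2)[of "(2 * w + 1) * B'"] w B' I by auto
    qed
  qed
  then show ?thesis using c0(1) by blast
qed

section \<open>Primes dividing values and reduction at simple roots\<close>

lemma synthetic_division:
  assumes p: "p \<in> polys_over D" and m: "m \<in> D"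
  shows "\<exists>g\<in>polys_over D. p = [:- m, 1:] * g + [:poly p m:]"
proof -
  have "[:- m, 1:] \<in> polys_over D" using m D by (simp add: polys_over_pCons_iff polys_over_0 subrng_1 subrng_uminus)
  then obtain k r where kr: "k \<in> polys_over D" "p = [:- m, 1:] * k + r" "r = 0 \<or> degree r < 1"
    using polys_over_division[OF D _ _ p, of "[:- m, 1:]"] by auto
  then obtain c where "r = [:c:]" using degree_eq_zeroE[of r] by (metis less_one pCons_0_0)
  moreover have "poly p m = poly r m" using kr(2) by simp
  ultimately show ?thesis using kr by auto
qed

text \<open>Euclid's argument for infinitely many primes: with f0 = f(m0) nonzero, the value at m0 +
  N f0 y is f0 times a number congruent to 1 modulo N.\<close>

lemma prime_dividing_value:
  assumes f: "f \<in> polys_over D" "degree f > 0" and N: "N \<in> D" "N \<noteq> 0"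
  shows "\<exists>\<pi>. \<exists>m\<in>D. pr \<pi> \<and> ddvd \<pi> (poly f m) \<and> \<not> ddvd \<pi> N"
proof -
  have fin: "finite {x. poly f x = c}" for c
  proof -
    have "f - [:c:] \<noteq> 0" using f by auto
    then have "finite {x. poly (f - [:c:]) x = 0}" by (rule poly_roots_finite)
    then show ?thesis by simp
  qed
  have "\<not> D \<subseteq> {x. poly f x = 0}" using infinite_D fin finite_subset by blast
  then obtain m0 where m0: "m0 \<in> D" "poly f m0 \<noteq> 0" by auto
  define f0 where "f0 = poly f m0"
  have f0: "f0 \<in> D" "f0 \<noteq> 0" using m0 f D by (auto simp: f0_def intro: poly_in_subrng)
  obtain g where g: "g \<in> polys_over D" "f = [:- m0, 1:] * g + [:f0:]"
    using synthetic_division[OF f(1) m0(1)] by (auto simp: f0_def)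
  define h where "h y = m0 + N * f0 * y" for y
  define v where "v y = 1 + N * y * poly g (h y)" for y
  have fv: "poly f (h y) = f0 * v y" for y
    by (subst g(2)) (simp add: h_def v_def algebra_simps)
  have inj: "inj h" using f0 N by (auto simp: h_def inj_def)
  \<comment> \<open>Zero and the units. The second factor \<open>v y\<close> lands in this finite
    set for only finitely many \<open>y\<close>, so some \<open>v y\<close> has a prime
    divisor.\<close>
  define U where "U = {x \<in> D. \<delta> x \<le> 1}"
  have "{y \<in> D. v y \<in> U} \<subseteq> h -` (\<Union>c\<in>U. {x. poly f x = f0 * c})" using fv by auto
  moreover have "finite (h -` (\<Union>c\<in>U. {x. poly f x = f0 * c}))"
    using inj fin finite_ball[of 1] by (intro finite_vimageI) (auto simp: U_def)
  ultimately have "finite {y \<in> D. v y \<in> U}" by (rule finite_subset)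
  then have "\<not> D \<subseteq> {y \<in> D. v y \<in> U}" using infinite_D finite_subset by blast
  then obtain y where y: "y \<in> D" "v y \<notin> U" by auto
  have hD: "h y \<in> D" using y m0 N f0 D by (auto simp: h_def intro!: subrng_intros)
  have vD: "v y \<in> D" using y N g hD D by (auto simp: v_def intro!: subrng_intros intro: poly_in_subrng)
  have "\<delta> (v y) > 1" using y(2) vD by (auto simp: U_def)
  then obtain \<pi> where \<pi>: "pr \<pi>" "ddvd \<pi> (v y)" using exists_pr[OF vD] unit_iff[OF vD] \<delta>_eq_0[OF vD] by auto
  have "\<not> ddvd \<pi> N"
  proof
    assume "ddvd \<pi> N"
    then have "ddvd \<pi> 1"
      by (rule ddvd_lin[OF \<pi>(2) _, of _ 1 "- (y * poly g (h y))"])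
         (use y g hD D in \<open>auto simp: v_def algebra_simps intro!: subrng_intros intro: poly_in_subrng\<close>)
    then show False using \<pi> by (simp add: pr_def)
  qed
  moreover have "ddvd \<pi> (poly f (h y))" unfolding fv by (rule ddvd_mult2[OF \<pi>(2) f0(1)])
  ultimately show ?thesis using \<pi> hD by blast
qed

text \<open>
  A solution \<open>h / (d * G)\<close> of \<open>e * (w\<^sup>2 + w) = A\<close> in \<open>Frac(D)[X]/f\<close> reduces modulo \<open>\<pi>\<close> at a simple
  root \<open>m\<close> of \<open>f\<close>, although \<open>d\<close> may be divisible by \<open>\<pi>\<close>: the cofactor of \<open>X - m\<close> in \<open>f\<close> is invertible
  at \<open>m\<close>, and multiplying by it allows one to cancel a factor \<open>\<pi>\<close>.
\<close>
lemma reduce_at_simple_root: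
  assumes \<pi>: "pr \<pi>" and f: "f \<in> polys_over D" "lead_coeff f = 1"
    and m: "m \<in> D" "ddvd \<pi> (poly f m)" "\<not> ddvd \<pi> (poly (pderiv f) m)"
    and e: "e \<in> D" "\<not> ddvd \<pi> e" and A: "A \<in> polys_over D"
    and d: "d \<in> D" "d \<noteq> 0" and h: "h \<in> polys_over D"
    and G: "G \<in> polys_over D" "\<not> ddvd \<pi> (poly G m)"
    and dv: "f dvd smult e (h ^ 2 + smult d (G * h)) - smult (d ^ 2) (G ^ 2 * A)"
  shows "\<exists>w\<in>D. ddvd \<pi> (e * (w ^ 2 + w) - poly A m)"
  using d h G dv
proof (induction "\<delta> d" arbitrary: d h G rule: less_induct)
  case less
  note I = subrng_intros[OF D] and J = polys_over_intros[OF D] and P = poly_in_subrng[OF D]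
  define E where "E = smult e (h ^ 2 + smult d (G * h)) - smult (d ^ 2) (G ^ 2 * A)"
  have E: "E \<in> polys_over D" unfolding E_def using less.prems e A by (auto intro!: J I)
  obtain K where K: "K \<in> polys_over D" "E = f * K"
    using polys_over_dvdE[OF D f E] less.prems(6) by (auto simp: E_def)
  have Em: "ddvd \<pi> (poly E m)" unfolding K(2) poly_mult using K m by (intro ddvd_mult P)
  define H where "H = poly h m"
  define g0 where "g0 = poly G m"
  have HD: "H \<in> D" "g0 \<in> D" using less.prems m by (auto simp: H_def g0_def intro: P)
  have Em': "ddvd \<pi> (e * (H ^ 2 + d * (g0 * H)) - d ^ 2 * (g0 ^ 2 * poly A m))"
    using Em by (simp add: E_def H_def g0_def)
  have Am: "poly A m \<in> D" using A m by (intro P)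
  show ?case
  proof (cases "ddvd \<pi> d")
    case False
    have "\<not> ddvd \<pi> (d * g0)" using pr_mult[OF \<pi>, of d g0] False less.prems HD by (auto simp: g0_def)
    then obtain y where y: "y \<in> D" "ddvd \<pi> (d * g0 * y - 1)" using \<pi> less.prems HD I by (auto simp: pr_def)
    have "ddvd \<pi> (e * ((H * y) ^ 2 + H * y) - poly A m)"
      by (rule ddvd_lin[OF Em' y(2), of "y ^ 2" "poly A m * (d * g0 * y + 1) - e * H * y"])
         (use y HD e Am less.prems I in \<open>auto simp: algebra_simps power2_eq_square\<close>)
    then show ?thesis using HD y I by blast
  next
    case True
    then obtain d1 where d1: "d1 \<in> D" "d = \<pi> * d1" by (auto simp: ddvd_def)
    have \<pi>D: "\<pi> \<in> D" "\<pi> \<noteq> 0" using \<pi> by (auto simp: pr_def)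
    have d10: "d1 \<noteq> 0" using d1 less.prems by auto
    have "\<delta> d = \<delta> \<pi> * \<delta> d1" using \<delta>_mult[OF \<pi>D(1) d1(1)] d1 by simp
    moreover have "\<delta> d1 > 0" using \<delta>_eq_0[OF d1(1)] d10 by simp
    ultimately have lt: "\<delta> d1 < \<delta> d" using pr_\<delta>[OF \<pi>] by simp
    \<comment> \<open>When \<open>\<pi>\<close> divides the denominator \<open>d\<close>, the
      equation forces it to divide the numerator at \<open>m\<close> too.\<close>
    have "ddvd \<pi> (e * H ^ 2)"
      by (rule ddvd_lin[OF Em' True, of 1 "d * (g0 ^ 2 * poly A m) - e * (g0 * H)"])
         (use less.prems HD e Am I in \<open>auto simp: algebra_simps power2_eq_square\<close>)
    then have "ddvd \<pi> H" using pr_mult[OF \<pi>, of e "H ^ 2"] pr_power[OF \<pi>, of H 2] e HD I by auto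
    then obtain H1 where H1: "H1 \<in> D" "H = \<pi> * H1" by (auto simp: ddvd_def)
    obtain f1 where f1: "f1 \<in> D" "poly f m = \<pi> * f1" using m by (auto simp: ddvd_def)
    obtain g where g: "g \<in> polys_over D" "f = [:- m, 1:] * g + [:poly f m:]"
      using synthetic_division[OF f(1) m(1)] by blast
    obtain h' where h': "h' \<in> polys_over D" "h = [:- m, 1:] * h' + [:H:]"
      using synthetic_division[OF less.prems(3) m(1)] by (auto simp: H_def)
    \<comment> \<open>Modulo \<open>f\<close> one has g h = \<pi> h1, by \<open>gh\<close> below.
      Expanding h / (d G) by \<open>g\<close> therefore gives \<pi> h1 / (\<pi> d1 G g), and
      \<open>\<pi>\<close> cancels.\<close>
    define h1 where "h1 = smult H1 g - smult f1 h'"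
    have h1: "h1 \<in> polys_over D" unfolding h1_def using H1 f1 g h' by (auto intro!: J)
    define l where "l = [:- m, 1:]"
    have fl: "f = l * g + smult \<pi> [:f1:]" using g(2) f1 by (simp add: l_def)
    have hl: "h = l * h' + smult \<pi> [:H1:]" using h'(2) H1 by (simp add: l_def)
    have gh: "g * h - smult \<pi> h1 = f * h'"
      unfolding fl hl h1_def by (simp add: algebra_simps smult_diff_right)
    have l: "poly l m = 0" "pderiv l = 1" by (simp_all add: l_def pderiv_pCons)
    have "pderiv f = l * pderiv g + g" unfolding fl by (simp add: pderiv_add pderiv_mult pderiv_smult l pderiv_pCons)
    \<comment> \<open>The root is simple, so the new denominator factor G g is still a unit at
      \<open>m\<close>.\<close>
    then have gm: "poly g m = poly (pderiv f) m" using l by simp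
    have "\<not> ddvd \<pi> (poly (G * g) m)"
      using pr_mult[OF \<pi>, of "poly G m" "poly g m"] less.prems(5) m gm P[OF less.prems(4) m(1)] P[OF g(1) m(1)] by auto
    define E1 where "E1 = smult e (h1 ^ 2 + smult d1 ((G * g) * h1)) - smult (d1 ^ 2) ((G * g) ^ 2 * A)"
    have "g ^ 2 * E - smult (\<pi> ^ 2) E1 = (g * h - smult \<pi> h1) * (smult e (g * h + smult \<pi> h1) + smult (e * d) (G * g))"
      unfolding E_def E1_def d1(2)
      by (simp add: algebra_simps power2_eq_square smult_diff_right smult_add_right)
    then have "smult (\<pi> ^ 2) E1 = f * (g ^ 2 * K - h' * (smult e (g * h + smult \<pi> h1) + smult (e * d) (G * g)))"
      unfolding gh K(2) by (simp add: algebra_simps)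
    then have "f dvd smult (\<pi> ^ 2) E1" by simp
    then have "f dvd E1" using \<pi>D by (simp add: dvd_smult_iff)
    then show ?thesis
      by (intro less.hyps[OF lt d1(1) d10 h1, of "G * g"])
         (use less.prems g \<open>\<not> ddvd \<pi> (poly (G * g) m)\<close> in \<open>auto simp: E1_def intro!: J\<close>)
  qed
qed

end

section \<open>Specialization and primitive elements\<close>

definition fracs :: "'b::field set \<Rightarrow> 'b set" where
  "fracs R = {a / b | a b. a \<in> R \<and> b \<in> R \<and> b \<noteq> 0}"

lemma fracs_incl: assumes "subrng R" shows "R \<subseteq> fracs R"
  unfolding fracs_def using subrng_1[OF assms] by force

lemma fracs_subfld: assumes R: "subrng R" shows "subfld (fracs R)"
  unfolding subfld_def subrng_def
proof safe
  note I = subrng_intros[OF R]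
  show "0 \<in> fracs R" "1 \<in> fracs R" using fracs_incl[OF R] I by auto
  fix x assume x: "x \<in> fracs R"
  then obtain a b where ab: "x = a / b" "a \<in> R" "b \<in> R" "b \<noteq> 0" by (auto simp: fracs_def)
  show "- x \<in> fracs R" unfolding fracs_def mem_Collect_eq using ab I(5)[of a] by (intro exI[of _ "- a"] exI[of _ b]) auto
  show "inverse x \<in> fracs R"
  proof (cases "a = 0")
    case True then show ?thesis using ab x by simp
  next
    case False
    then show ?thesis unfolding fracs_def mem_Collect_eq using ab by (intro exI[of _ b] exI[of _ a]) auto
  qed
  fix y assume "y \<in> fracs R"
  then obtain c d where cd: "y = c / d" "c \<in> R" "d \<in> R" "d \<noteq> 0" by (auto simp: fracs_def)
  have "x + y = (a * d + c * b) / (b * d)" using ab cd by (simp add: field_simps)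
  then show "x + y \<in> fracs R" unfolding fracs_def mem_Collect_eq
    using ab cd by (intro exI[of _ "a * d + c * b"] exI[of _ "b * d"]) (auto intro!: I)
  show "x * y \<in> fracs R" unfolding fracs_def mem_Collect_eq
    using ab cd by (intro exI[of _ "a * c"] exI[of _ "b * d"]) (auto intro!: I)
qed

lemma clear_denominators:
  assumes R: "subrng R" and "p \<in> polys_over (fracs R)"
  shows "\<exists>b\<in>R. b \<noteq> 0 \<and> smult b p \<in> polys_over R"
  using assms(2)
proof (induction p)
  case 0
  then show ?case using R by (intro bexI[of _ 1]) (auto intro: polys_over_0 subrng_1)
next
  case (pCons a p)
  have ap: "a \<in> fracs R" "p \<in> polys_over (fracs R)"
    using pCons.prems polys_over_pCons_iff[OF subfld_subrng[OF fracs_subfld[OF R]]] by auto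
  obtain b where b: "b \<in> R" "b \<noteq> 0" "smult b p \<in> polys_over R" using pCons.IH[OF ap(2)] by blast
  obtain c d where cd: "a = c / d" "c \<in> R" "d \<in> R" "d \<noteq> 0" using ap(1) by (auto simp: fracs_def)
  have "smult (b * d) (pCons a p) = pCons (b * c) (smult d (smult b p))" using cd by (simp add: mult.commute)
  then show ?case using b cd R
    by (intro bexI[of _ "b * d"]) (auto simp: polys_over_pCons_iff intro!: subrng_mult polys_over_smult simp del: smult_smult)
qed

section \<open>Retractions of polynomial rings onto the base ring\<close>

context euclid
begin

definition Dhom :: "'b set \<Rightarrow> ('b \<Rightarrow> 'b) \<Rightarrow> bool" where
  "Dhom R \<psi> \<longleftrightarrow> rhom R \<psi> \<and> (\<forall>x\<in>R. \<psi> x \<in> D) \<and> (\<forall>x\<in>D. \<psi> x = x)"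

text \<open>\<open>R\<close> has enough retractions onto \<open>D\<close>, like a polynomial ring over \<open>D\<close>.\<close>
definition spec :: "'b set \<Rightarrow> bool" where
  "spec R \<longleftrightarrow> subrng R \<and> D \<subseteq> R \<and> (\<exists>\<psi>. Dhom R \<psi>) \<and>
     (\<forall>\<psi> \<pi> d. Dhom R \<psi> \<longrightarrow> \<pi> \<in> D \<longrightarrow> \<pi> \<noteq> 0 \<longrightarrow> d \<in> R \<longrightarrow> d \<noteq> 0 \<longrightarrow>
        (\<exists>\<psi>'. Dhom R \<psi>' \<and> (\<forall>x\<in>R. ddvd \<pi> (\<psi>' x - \<psi> x)) \<and> \<psi>' d \<noteq> 0))"

lemma specD:
  assumes "spec R" shows "subrng R" "D \<subseteq> R" "\<exists>\<psi>. Dhom R \<psi>"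
    "Dhom R \<psi> \<Longrightarrow> \<pi> \<in> D \<Longrightarrow> \<pi> \<noteq> 0 \<Longrightarrow> d \<in> R \<Longrightarrow> d \<noteq> 0 \<Longrightarrow>
       \<exists>\<psi>'. Dhom R \<psi>' \<and> (\<forall>x\<in>R. ddvd \<pi> (\<psi>' x - \<psi> x)) \<and> \<psi>' d \<noteq> 0"
  using assms unfolding spec_def by blast+

lemma spec_D: "spec D"
proof -
  have "Dhom D (\<lambda>x. x)" by (simp add: Dhom_def rhom_def)
  moreover have "\<psi> d \<noteq> 0" if "Dhom D \<psi>" "d \<in> D" "d \<noteq> 0" for \<psi> d using that by (simp add: Dhom_def)
  ultimately show ?thesis unfolding spec_def using D ddvd_0 by auto
qed

lemma Dhom_poly_cong:
  assumes R: "subrng R" and \<phi>: "Dhom R \<phi>" and \<psi>: "Dhom R \<psi>"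
    and c: "\<And>x. x \<in> R \<Longrightarrow> ddvd \<pi> (\<psi> x - \<phi> x)" and st: "s \<in> D" "t \<in> D" "ddvd \<pi> (s - t)" and h: "h \<in> polys_over R"
  shows "ddvd \<pi> (poly (map_poly \<psi> h) s - poly (map_poly \<phi> h) t)"
  using h
proof (induction h)
  case 0
  have "map_poly \<psi> 0 = 0" "map_poly \<phi> 0 = 0" by simp_all
  then show ?case by (simp add: ddvd_0)
next
  case (pCons a h)
  have ah: "a \<in> R" "h \<in> polys_over R" using pCons.prems R by (auto simp: polys_over_pCons_iff)
  have \<phi>h: "rhom R \<phi>" and \<psi>h: "rhom R \<psi>" using \<phi> \<psi> by (auto simp: Dhom_def)
  have in_D: "map_poly \<phi> h \<in> polys_over D" "map_poly \<psi> h \<in> polys_over D"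
    using \<phi> \<psi> ah map_poly_rhom_in[OF R \<phi>h] map_poly_rhom_in[OF R \<psi>h] by (auto simp: Dhom_def)
  have "ddvd \<pi> ((s - t) * poly (map_poly \<psi> h) s + (poly (map_poly \<psi> h) s - poly (map_poly \<phi> h) t) * t)"
    by (rule ddvd_add[OF ddvd_mult[OF st(3) poly_in_subrng[OF D in_D(2) st(1)]] ddvd_mult[OF pCons.IH[OF ah(2)] st(2)]])
  then have "ddvd \<pi> ((\<psi> a - \<phi> a) + ((s - t) * poly (map_poly \<psi> h) s + (poly (map_poly \<psi> h) s - poly (map_poly \<phi> h) t) * t))"
    by (rule ddvd_add[OF c[OF ah(1)]])
  then show ?case by (simp add: map_rhom_pCons[OF R \<phi>h] map_rhom_pCons[OF R \<psi>h] algebra_simps)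
qed

text \<open>A retraction is extended by sending the transcendental \<open>t\<close> to any value in
  \<open>D\<close>. To keep a given nonzero \<open>d\<close> = h(t) nonzero without changing
  residues modulo \<open>\<pi>\<close>, the leading coefficient of \<open>h\<close> is kept nonzero,
  and then the value of \<open>t\<close> is moved within its residue class away from the
  roots.\<close>

lemma spec_sext:
  assumes R: "spec R" and t: "\<not> alg_over R t" shows "spec (sext R t)"
proof -
  note RS = specD(1)[OF R] and DR = specD(2)[OF R]
  note S = sext_subrng[OF RS, of t] and RT = sext_incl[OF RS, of t]
  have ext: "\<exists>\<psi>'. Dhom (sext R t) \<psi>' \<and> (\<forall>h\<in>polys_over R. \<psi>' (poly h t) = poly (map_poly \<psi> h) \<tau>)"
    if \<psi>: "Dhom R \<psi>" and \<tau>: "\<tau> \<in> D" for \<psi> \<tau>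
  proof -
    have h: "rhom R \<psi>" using \<psi> by (simp add: Dhom_def)
    have "\<exists>\<psi>'. rhom (sext R t) \<psi>' \<and> (\<forall>h\<in>polys_over R. \<psi>' (poly h t) = poly (map_poly \<psi> h) \<tau>) \<and>
           (\<forall>x\<in>R. \<psi>' x = \<psi> x) \<and> \<psi>' t = \<tau>"
    proof (rule rhom_extend[OF RS h])
      fix p assume "p \<in> polys_over R" "poly p t = 0"
      then have "p = 0" using t by (auto simp: alg_over_def)
      then show "poly (map_poly \<psi> p) \<tau> = 0" by simp
    qed
    then obtain \<psi>' where \<psi>': "rhom (sext R t) \<psi>'" "\<forall>h\<in>polys_over R. \<psi>' (poly h t) = poly (map_poly \<psi> h) \<tau>"
      "\<forall>x\<in>R. \<psi>' x = \<psi> x" by blast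
    have "\<psi>' x \<in> D" if x: "x \<in> sext R t" for x
    proof -
      obtain p where p: "x = poly p t" "p \<in> polys_over R" using x by (auto simp: sext_def)
      have "map_poly \<psi> p \<in> polys_over D" by (rule map_poly_rhom_in[OF RS h _ p(2)]) (use \<psi> in \<open>simp add: Dhom_def\<close>)
      then show ?thesis using \<psi>'(2) p poly_in_subrng[OF D] \<tau> by simp
    qed
    moreover have "\<psi>' x = x" if "x \<in> D" for x using \<psi>'(3) \<psi> DR that by (auto simp: Dhom_def)
    ultimately show ?thesis using \<psi>' by (auto simp: Dhom_def)
  qed
  have "\<exists>\<psi>. Dhom (sext R t) \<psi>" using specD(3)[OF R] ext subrng_0[OF D] by blast
  moreover have "\<exists>\<psi>'. Dhom (sext R t) \<psi>' \<and> (\<forall>x\<in>sext R t. ddvd \<pi> (\<psi>' x - \<psi> x)) \<and> \<psi>' d \<noteq> 0"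
    if \<psi>: "Dhom (sext R t) \<psi>" and \<pi>: "\<pi> \<in> D" "\<pi> \<noteq> 0" and d: "d \<in> sext R t" "d \<noteq> 0" for \<psi> \<pi> d
  proof -
    have \<psi>h: "rhom (sext R t) \<psi>" and \<psi>R: "Dhom R \<psi>" using \<psi> rhom_subset[OF _ RT] RT by (auto simp: Dhom_def)
    obtain h where h: "d = poly h t" "h \<in> polys_over R" using d by (auto simp: sext_def)
    have "h \<noteq> 0" using h d by auto
    then have "lead_coeff h \<noteq> 0" by simp
    then obtain \<psi>1 where \<psi>1: "Dhom R \<psi>1" "\<And>x. x \<in> R \<Longrightarrow> ddvd \<pi> (\<psi>1 x - \<psi> x)" "\<psi>1 (lead_coeff h) \<noteq> 0"
      using specD(4)[OF R \<psi>R \<pi> polys_overD[OF h(2)]] by blast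
    have \<psi>1h: "rhom R \<psi>1" using \<psi>1 by (simp add: Dhom_def)
    have "map_poly \<psi>1 h \<noteq> 0" using \<psi>1(3) coeff_map_rhom[OF RS \<psi>1h, of h] by (metis coeff_0)
    then have fin: "finite {x. poly (map_poly \<psi>1 h) x = 0}" by (rule poly_roots_finite)
    define \<tau>0 where "\<tau>0 = \<psi> t"
    have \<tau>0: "\<tau>0 \<in> D" using \<psi> sext_mem[OF RS, of t] by (simp add: \<tau>0_def Dhom_def)
    \<comment> \<open>Infinitely many values are congruent to \<tau>0 modulo \<open>\<pi>\<close>,
      and only finitely many are roots.\<close>
    have "inj_on (\<lambda>k. \<tau>0 + \<pi> * k) D" using \<pi> by (auto intro!: inj_onI)
    then have "infinite ((\<lambda>k. \<tau>0 + \<pi> * k) ` D)" using infinite_D by (simp add: finite_image_iff)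
    then have "\<not> (\<lambda>k. \<tau>0 + \<pi> * k) ` D \<subseteq> {x. poly (map_poly \<psi>1 h) x = 0}" using fin finite_subset by blast
    then obtain k where k: "k \<in> D" "poly (map_poly \<psi>1 h) (\<tau>0 + \<pi> * k) \<noteq> 0" by blast
    define \<tau> where "\<tau> = \<tau>0 + \<pi> * k"
    have \<tau>: "\<tau> \<in> D" "ddvd \<pi> (\<tau> - \<tau>0)" using \<tau>0 \<pi> k D by (auto simp: \<tau>_def ddvd_def intro: subrng_intros)
    obtain \<psi>' where \<psi>': "Dhom (sext R t) \<psi>'" "\<And>h. h \<in> polys_over R \<Longrightarrow> \<psi>' (poly h t) = poly (map_poly \<psi>1 h) \<tau>"
      using ext[OF \<psi>1(1) \<tau>(1)] by blast
    have "ddvd \<pi> (\<psi>' x - \<psi> x)" if x: "x \<in> sext R t" for x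
    proof -
      obtain p where p: "x = poly p t" "p \<in> polys_over R" using x by (auto simp: sext_def)
      have "\<psi> x = poly (map_poly \<psi> p) \<tau>0"
        unfolding p(1) \<tau>0_def using polys_over_mono[OF RT] p(2) sext_mem[OF RS]
        by (intro poly_map_rhom[OF S \<psi>h, symmetric]) auto
      then show ?thesis
        using Dhom_poly_cong[OF RS \<psi>R \<psi>1(1,2) \<tau>(1) \<tau>0 \<tau>(2) p(2)] \<psi>'(2)[OF p(2)] p(1) by simp
    qed
    moreover have "\<psi>' d \<noteq> 0" using \<psi>'(2)[OF h(2)] h(1) k(2) by (simp add: \<tau>_def)
    ultimately show ?thesis using \<psi>'(1) by blast
  qed
  ultimately show ?thesis unfolding spec_def using S RT DR by blast
qed

text \<open>A transcendence basis is built greedily: an element is adjoined only if it is not yet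
  algebraic over the ring.\<close>

lemma exists_spec:
  assumes "finite S" shows "\<exists>R. spec R \<and> (\<forall>s\<in>S. alg_over R s)"
  using assms
proof (induction S)
  case empty then show ?case using spec_D by blast
next
  case (insert s S)
  then obtain R where R: "spec R" "\<forall>s\<in>S. alg_over R s" by blast
  show ?case
  proof (cases "alg_over R s")
    case False
    note RS = specD(1)[OF R(1)]
    have "alg_over (sext R s) s" by (rule alg_over_self[OF sext_subrng[OF RS] sext_mem[OF RS]])
    moreover have "\<forall>u\<in>S. alg_over (sext R s) u" using R(2) alg_over_mono[OF _ sext_incl[OF RS]] by blast
    ultimately show ?thesis using spec_sext[OF R(1) False] by blast
  qed (use R in blast)
qed

end

section \<open>Characteristic exponent and separable powers\<close>

lemma addexp_1: "addexp TYPE('b::field) 1"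
  by (simp add: addexp_def)

lemma addexp_mult: "addexp TYPE('b::field) q \<Longrightarrow> addexp TYPE('b) r \<Longrightarrow> addexp TYPE('b) (q * r)"
  by (simp add: addexp_def power_mult)

lemma addexp_CHAR: "CHAR('b::field) > 0 \<Longrightarrow> addexp TYPE('b) (CHAR('b))"
  unfolding addexp_def using freshmans_dream[where ?'a = 'b] prime_CHAR_semidom[where ?'a = 'b] by auto

text \<open>Reduces the claim that all q-th powers from a field lie in \<open>S\<close> to its
  generators.\<close>

lemma addexp_preimage:
  fixes S :: "'b::field set"
  assumes q: "addexp TYPE('b) q" and S: "subfld S" shows "subfld {x. x ^ q \<in> S}"
proof -
  have q0: "q > 0" and add: "\<And>x y :: 'b. (x + y) ^ q = x ^ q + y ^ q" using q by (auto simp: addexp_def)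
  have "(- x) ^ q = - (x ^ q)" for x :: 'b using addexp_diff[OF q, of 0 x] q0 by simp
  then show ?thesis unfolding subfld_def subrng_def
    using S q0 by (auto simp: add power_mult_distrib power_inverse intro: subfld_intros)
qed

text \<open>With zero derivative only exponents divisible by p survive, so g(X) = h(X^p). The
  coefficients are merely reindexed; no p-th roots are taken, so they stay in
  \<open>R\<close>.\<close>

lemma frobenius_root_poly:
  fixes g :: "'b::field poly"
  assumes g: "pderiv g = 0" "degree g > 0" and R: "g \<in> polys_over R" "0 \<in> R"
  shows "CHAR('b) > 0 \<and> (\<exists>h\<in>polys_over R. h \<noteq> 0 \<and> degree h < degree g \<and> (\<forall>x. poly g x = poly h (x ^ CHAR('b))))"
proof -
  define p where "p = CHAR('b)"
  have dv: "p dvd j" if j: "coeff g j \<noteq> 0" for j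
  proof (cases j)
    case (Suc i)
    have "coeff (pderiv g) i = 0" using g by simp
    then have "of_nat j = (0::'b)" using j Suc by (simp add: coeff_pderiv del: of_nat_Suc)
    then show ?thesis by (simp add: of_nat_eq_0_iff_char_dvd p_def)
  qed simp
  define N where "N = degree g"
  have gN: "coeff g N \<noteq> 0" using g by (auto simp: N_def)
  have pN: "p dvd N" using dv[OF gN] .
  have p0: "p > 0" using pN g(2) by (auto simp: N_def intro: Nat.gr0I)
  then have "prime p" unfolding p_def by (rule prime_CHAR_semidom)
  then have p2: "p \<ge> 2" by (rule prime_ge_2_nat)
  \<comment> \<open>The summation bound is generous: beyond degree g the coefficients read off are
    0.\<close>
  define h where "h = (\<Sum>i\<le>N. monom (coeff g (i * p)) i)"
  have ch: "coeff h i = (if i \<le> N then coeff g (i * p) else 0)" for i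
    by (simp add: h_def coeff_sum)
  have "poly g x = poly h (x ^ p)" for x
  proof -
    let ?F = "\<lambda>j. coeff g j * x ^ j"
    have "poly h (x ^ p) = (\<Sum>i\<le>N. ?F (i * p))"
      by (simp add: h_def poly_sum poly_monom power_mult mult.commute[of _ p])
    also have "\<dots> = sum ?F ((\<lambda>i. i * p) ` {..N})"
      by (subst sum.reindex) (use p0 in \<open>auto simp: inj_on_def\<close>)
    also have "\<dots> = sum ?F {..N}"
    proof (rule sum.mono_neutral_cong)
      show "\<And>i. i \<in> (\<lambda>i. i * p) ` {..N} - {..N} \<Longrightarrow> ?F i = 0" by (auto simp: N_def coeff_eq_0)
      fix j assume j: "j \<in> {..N} - (\<lambda>i. i * p) ` {..N}"
      show "?F j = 0"
      proof (rule ccontr)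
        assume "?F j \<noteq> 0"
        then have "p dvd j" using dv by auto
        then obtain i where i: "j = p * i" by auto
        have "1 * i \<le> p * i" by (rule mult_le_mono1) (use p0 in simp)
        moreover have "p * i \<le> N" using i j by simp
        ultimately have "i \<le> N" by linarith
        then show False using j i by (auto simp: mult.commute)
      qed
    qed auto
    also have "\<dots> = poly g x" by (simp add: poly_altdef N_def)
    finally show ?thesis by simp
  qed
  moreover have h0: "h \<noteq> 0"
  proof
    assume "h = 0"
    then have "coeff h (N div p) = 0" by simp
    then show False using gN pN by (simp add: ch)
  qed
  moreover have "degree h < degree g"
  proof -
    have "coeff h (degree h) \<noteq> 0" using h0 by simp
    then have "coeff g (degree h * p) \<noteq> 0" by (simp add: ch split: if_splits)
    then have *: "degree h * p \<le> N" unfolding N_def by (rule le_degree)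
    show ?thesis
    proof (cases "degree h = 0")
      case False
      moreover have "degree h * 2 \<le> degree h * p" by (rule mult_le_mono2[OF p2])
      ultimately show ?thesis using * unfolding N_def by linarith
    qed (use g in simp)
  qed
  moreover have "h \<in> polys_over R" using R by (auto simp: polys_over_def ch)
  ultimately show ?thesis using p0 unfolding p_def by blast
qed

text \<open>Among all \<open>q\<close> and nonzero \<open>f\<close> with f(s^q) = 0 take the least
  degree. If the minimal polynomial of s^q had a multiple root, its derivative would vanish, and
  passing to the p-th power of s^q would lower the degree.\<close>

lemma separable_power:
  fixes F :: "'b::alg_closed_field set"
  assumes F: "subfld F" and s: "alg_over F s"
  shows "\<exists>q. addexp TYPE('b) q \<and> separable_over F (s ^ q)"
proof -
  define P where "P n \<longleftrightarrow> (\<exists>q f. addexp TYPE('b) q \<and> f \<in> polys_over F \<and> f \<noteq> 0 \<and> poly f (s ^ q) = 0 \<and> degree f = n)" for n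
  have "\<exists>n. P n" using s addexp_1[where ?'b = 'b] unfolding alg_over_def P_def by (metis power_one_right)
  then obtain n where n: "P n" "\<And>m. P m \<Longrightarrow> n \<le> m" using exists_least_iff[of P] by (metis not_le)
  obtain q f where qf: "addexp TYPE('b) q" "f \<in> polys_over F" "f \<noteq> 0" "poly f (s ^ q) = 0" "degree f = n"
    using n(1) by (auto simp: P_def)
  have "alg_over F (s ^ q)" using qf by (auto simp: alg_over_def)
  then obtain g where g: "is_min_poly F (s ^ q) g" using min_poly_exists[OF F] by blast
  note gD = is_min_polyD[OF g]
  have dg: "degree g \<le> n" using g qf by (auto simp: is_min_poly_def)
  have "rsquarefree g"
  proof (rule ccontr)
    assume "\<not> rsquarefree g"
    then obtain a where a: "poly g a = 0" "poly (pderiv g) a = 0" using gD by (auto simp: rsquarefree_iff)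
    have "pderiv g = 0"
    proof (rule ccontr)
      assume "pderiv g \<noteq> 0"
      then have "degree g \<le> degree (pderiv g)"
        using min_poly_other_root[OF F g a(1)] a(2) polys_over_pderiv[OF subfld_subrng[OF F] gD(1)]
        unfolding is_min_poly_def by blast
      moreover have "degree (pderiv g) \<le> degree g - 1" by (rule degree_le) (auto simp: coeff_pderiv coeff_eq_0)
      ultimately show False using gD(5) by simp
    qed
    then obtain h where h: "CHAR('b) > 0" "h \<in> polys_over F" "h \<noteq> 0" "degree h < degree g"
      "\<And>x. poly g x = poly h (x ^ CHAR('b))"
      using frobenius_root_poly[OF _ gD(5,1)] subrng_0[OF subfld_subrng[OF F]] by blast
    have "poly h (s ^ (q * CHAR('b))) = 0" using h(5)[of "s ^ q"] gD by (simp add: power_mult)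
    moreover have "addexp TYPE('b) (q * CHAR('b))" by (rule addexp_mult[OF qf(1) addexp_CHAR[OF h(1)]])
    ultimately have "P (degree h)" unfolding P_def using h by blast
    then show False using n(2)[of "degree h"] h(4) dg by simp
  qed
  then show ?thesis using qf(1) g by (auto simp: separable_over_def)
qed

text \<open>HOL-Algebra lists coefficients from the leading one downwards, hence \<open>rev\<close>.
  With this bridge its results on algebraic elements become available.\<close>

lemma eval_ring_of_type: "ring.eval (ring_of_type_algebra :: 'b::field ring) xs x = poly (Poly (rev xs)) x"
proof -
  interpret field "ring_of_type_algebra :: 'b ring" by (rule field_from_type_algebra)
  have pow: "x [^]\<^bsub>ring_of_type_algebra\<^esub> n = x ^ n" for n :: nat
    by (induction n) (auto simp: ring_of_type_algebra_simps)
  show ?thesis by (induction xs) (auto simp: ring_of_type_algebra_simps pow Poly_append poly_monom)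
qed

lemma alg_over_iff:
  assumes K: "subfld (K :: 'b::field set)"
  shows "alg_over K x \<longleftrightarrow> (ring.algebraic (ring_of_type_algebra :: 'b ring) over K) x"
proof -
  interpret field "ring_of_type_algebra :: 'b ring" by (rule field_from_type_algebra)
  have sr: "subring K ring_of_type_algebra" using K subfield_of_type_iff subfieldE(1) by blast
  show ?thesis
  proof
    assume "alg_over K x"
    then obtain p where p: "p \<in> polys_over K" "p \<noteq> 0" "poly p x = 0" by (auto simp: alg_over_def)
    let ?P = "rev (coeffs p)"
    have "?P \<in> carrier (K[X]\<^bsub>ring_of_type_algebra\<^esub>)"
    proof -
      have "set (coeffs p) \<subseteq> K" using polys_overD[OF p(1)] by (auto simp: coeffs_def)
      moreover have "hd ?P \<noteq> 0" using p(2) by (simp add: hd_rev last_coeffs_eq_coeff_degree)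
      ultimately show ?thesis by (simp add: univ_poly_def polynomial_def ring_of_type_algebra_simps)
    qed
    moreover have "?P \<noteq> []" using p(2) by simp
    moreover have "eval ?P x = \<zero>\<^bsub>ring_of_type_algebra\<^esub>" using p(3) by (simp add: eval_ring_of_type ring_of_type_algebra_simps)
    ultimately show "(algebraic over K) x" by (rule algebraicI)
  next
    assume alg: "(algebraic over K) x"
    have x: "x \<in> carrier ring_of_type_algebra" by (simp add: ring_of_type_algebra_simps)
    obtain P where P: "P \<in> carrier (K[X]\<^bsub>ring_of_type_algebra\<^esub>)" "P \<noteq> []" "eval P x = \<zero>\<^bsub>ring_of_type_algebra\<^esub>"
      by (rule algebraicE[OF sr x alg])
    have set: "set P \<subseteq> K" "hd P \<noteq> 0" using P(1,2) by (simp_all add: univ_poly_def polynomial_def ring_of_type_algebra_simps)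
    have "Poly (rev P) \<in> polys_over K"
      unfolding polys_over_def mem_Collect_eq coeff_Poly_eq nth_default_def
      using set(1) subrng_0[OF subfld_subrng[OF K]] nth_mem[of _ "rev P"] by (simp add: subset_iff)
    moreover have "Poly (rev P) \<noteq> 0"
    proof
      assume "Poly (rev P) = 0"
      then obtain n where n: "rev P = replicate n 0" by (auto simp: Poly_eq_0)
      then have "last (rev P) = 0" using P(2) by (metis last_replicate rev_is_Nil_conv replicate_0)
      then show False using set(2) P(2) by (simp add: last_rev)
    qed
    ultimately show "alg_over K x" unfolding alg_over_def using P(3)
      by (auto simp: eval_ring_of_type ring_of_type_algebra_simps)
  qed
qed

lemma algebraic_subfld:
  assumes K: "subfld (K :: 'b::field set)" shows "subfld {x. alg_over K x}"
proof -
  interpret field "ring_of_type_algebra :: 'b ring" by (rule field_from_type_algebra)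
  have "subfield {x \<in> carrier ring_of_type_algebra. (algebraic over K) x} (ring_of_type_algebra :: 'b ring)"
    by (rule subfield_of_algebraics) (use K subfield_of_type_iff in blast)
  then show ?thesis by (simp add: subfield_of_type_iff alg_over_iff[OF K] ring_of_type_algebra_simps)
qed

text \<open>The classical generator \<theta> + c z. Only \<open>z\<close> has to be separable: the
  minimal polynomial of \<open>z\<close> over F(\<gamma>) divides both g and f(\<gamma> - c X),
  which for good \<open>c\<close> share no root except \<open>z\<close>.\<close>

lemma primitive_element:
  fixes F :: "'b::alg_closed_field set"
  assumes F: "subfld F" "infinite F" and \<theta>: "alg_over F \<theta>" and z: "separable_over F z"
  shows "\<exists>\<gamma>. alg_over F \<gamma> \<and> \<theta> \<in> sext F \<gamma> \<and> z \<in> sext F \<gamma>"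
proof -
  obtain f where f: "f \<in> polys_over F" "f \<noteq> 0" "poly f \<theta> = 0" using \<theta> by (auto simp: alg_over_def)
  obtain g where g: "is_min_poly F z g" "rsquarefree g" using z by (auto simp: separable_over_def)
  note gD = is_min_polyD[OF g(1)]
  \<comment> \<open>The values of \<open>c\<close> for which \<gamma> - c b is a root a of
    \<open>f\<close> with b different from z. For b = z the quotient is 0 by convention, which at
    most excludes c = 0.\<close>
  define B where "B = (\<lambda>(a, b). (a - \<theta>) / (z - b)) ` ({a. poly f a = 0} \<times> {b. poly g b = 0})"
  have "finite B" using poly_roots_finite[OF f(2)] poly_roots_finite[OF gD(4)] by (simp add: B_def)
  then have "\<not> F \<subseteq> B" using F(2) finite_subset by blast
  then obtain c where c: "c \<in> F" "c \<notin> B" by auto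
  define \<gamma> where "\<gamma> = \<theta> + c * z"
  have "alg_over F z" using gD by (auto simp: alg_over_def)
  then have "alg_over F \<gamma>"
    using \<theta> alg_over_self[OF subfld_subrng[OF F(1)] c(1)] subfld_intros(3,4)[OF algebraic_subfld[OF F(1)]]
    unfolding \<gamma>_def by blast
  note L = sext_subfld[OF F(1) this] and FL = sext_incl[OF subfld_subrng[OF F(1)], of \<gamma>]
  let ?L = "sext F \<gamma>"
  have \<gamma>L: "\<gamma> \<in> ?L" by (rule sext_mem[OF subfld_subrng[OF F(1)]])
  obtain k where k: "is_min_poly ?L z k" using min_poly_exists[OF L alg_over_mono[OF \<open>alg_over F z\<close> FL]] by blast
  have gL: "g \<in> polys_over ?L" and fL: "f \<in> polys_over ?L" using gD(1) f(1) polys_over_mono[OF FL] by auto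
  have kg: "k dvd g" by (rule min_poly_dvd[OF L k gL gD(3)])
  have "pcompose f [:\<gamma>, - c:] \<in> polys_over ?L"
    using L fL \<gamma>L c FL by (intro polys_over_pcompose) (auto simp: polys_over_pCons_iff subfld_subrng intro!: polys_over_0 subfld_intros)
  then have kf: "k dvd pcompose f [:\<gamma>, - c:]"
    by (rule min_poly_dvd[OF L k]) (use f in \<open>simp add: poly_pcompose \<gamma>_def\<close>)
  have "b = z" if b: "poly k b = 0" for b
  proof (rule ccontr)
    assume "b \<noteq> z"
    obtain g' where "g = k * g'" using kg by (rule dvdE)
    then have gb: "poly g b = 0" using b by simp
    obtain f' where "pcompose f [:\<gamma>, - c:] = k * f'" using kf by (rule dvdE)
    then have "poly (pcompose f [:\<gamma>, - c:]) b = 0" using b by simp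
    then have fb: "poly f (\<gamma> - c * b) = 0" by (simp add: poly_pcompose mult.commute)
    have "c = ((\<gamma> - c * b) - \<theta>) / (z - b)" using \<open>b \<noteq> z\<close> by (simp add: \<gamma>_def field_simps)
    then have "c \<in> B" unfolding B_def by (intro image_eqI[of _ _ "(\<gamma> - c * b, b)"]) (simp_all add: gb fb)
    then show False using c by simp
  qed
  then have "{b. poly k b = 0} = {z}" using is_min_polyD(3)[OF k] by blast
  then have "degree k = 1" using rsquarefree_card_roots[OF rsquarefree_dvd[OF g(2) kg]] by simp
  then have zL: "z \<in> ?L" using degree_1_root_in[OF L is_min_polyD(1)[OF k] _ is_min_polyD(3)[OF k]] by simp
  moreover have "\<theta> = \<gamma> - c * z" by (simp add: \<gamma>_def)
  then have "\<theta> \<in> ?L" using \<gamma>L zL c FL L by (auto intro!: subfld_intros)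
  ultimately show ?thesis using \<open>alg_over F \<gamma>\<close> by blast
qed

lemma sext_power:
  fixes F :: "'b::field set"
  assumes F: "subfld F" and q: "addexp TYPE('b) q" and w: "w \<in> sext F \<gamma>" and a: "alg_over F (\<gamma> ^ q)"
  shows "w ^ q \<in> sext F (\<gamma> ^ q)"
proof -
  note R = subfld_subrng[OF F]
  have "sext F \<gamma> \<subseteq> {x. x ^ q \<in> sext F (\<gamma> ^ q)}"
    by (rule sext_least[OF subfld_subrng[OF addexp_preimage[OF q sext_subfld[OF F a]]]])
       (use sext_incl[OF R] sext_mem[OF R] in \<open>auto intro: subrng_power[OF R]\<close>)
  then show ?thesis using w by auto
qed

lemma separable_imp_alg_over: assumes "separable_over F x" shows "alg_over F x"
proof -
  obtain f where "is_min_poly F x f" using assms by (auto simp: separable_over_def)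
  from is_min_polyD[OF this] show ?thesis unfolding alg_over_def by blast
qed

text \<open>A new element is first replaced by a separable power, so that a primitive element
  \<gamma> exists. As \<gamma> need not be separable, one more power makes it so, and the exponents
  multiply.\<close>

lemma primitive_up_to_power:
  fixes F :: "'b::alg_closed_field set"
  assumes F: "subfld F" "infinite F" and Z: "finite Z" "\<And>z. z \<in> Z \<Longrightarrow> alg_over F z"
  shows "\<exists>\<theta> q. separable_over F \<theta> \<and> addexp TYPE('b) q \<and> (\<forall>z\<in>Z. z ^ q \<in> sext F \<theta>)"
  using Z
proof (induction Z)
  case empty
  show ?case using separable_over_mem[OF F(1) subrng_0[OF subfld_subrng[OF F(1)]]] addexp_1 by blast
next
  case (insert s Z)
  note alg = separable_imp_alg_over
  obtain \<theta> q where \<theta>: "separable_over F \<theta>" "addexp TYPE('b) q" "\<And>z. z \<in> Z \<Longrightarrow> z ^ q \<in> sext F \<theta>"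
    using insert by auto
  obtain r where r: "addexp TYPE('b) r" "separable_over F (s ^ r)"
    using separable_power[OF F(1), of s] insert.prems by auto
  obtain \<gamma> where \<gamma>: "alg_over F \<gamma>" "\<theta> \<in> sext F \<gamma>" "s ^ r \<in> sext F \<gamma>"
    using primitive_element[OF F alg[OF \<theta>(1)] r(2)] by blast
  obtain t where t: "addexp TYPE('b) t" "separable_over F (\<gamma> ^ t)" using separable_power[OF F(1) \<gamma>(1)] by blast
  note S = sext_subrng[OF subfld_subrng[OF F(1)], of \<gamma>]
  have sub: "sext F \<theta> \<subseteq> sext F \<gamma>" by (rule sext_least[OF S sext_incl[OF subfld_subrng[OF F(1)]] \<gamma>(2)])
  have "z ^ (q * r * t) \<in> sext F (\<gamma> ^ t)" if z: "z \<in> insert s Z" for z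
  proof -
    have "z ^ (q * r) \<in> sext F \<gamma>"
    proof (cases "z = s")
      case True
      have "(s ^ r) ^ q \<in> sext F \<gamma>" by (rule subrng_power[OF S \<gamma>(3)])
      then show ?thesis using True by (simp add: power_mult mult.commute[of q])
    next
      case False
      then have "z ^ q \<in> sext F \<gamma>" using \<theta>(3)[of z] z sub by auto
      from subrng_power[OF S this] have "(z ^ q) ^ r \<in> sext F \<gamma>" .
      then show ?thesis by (simp add: power_mult)
    qed
    from sext_power[OF F(1) t(1) this alg[OF t(2)]] show ?thesis by (simp add: power_mult)
  qed
  then show ?case using t(2) addexp_mult[OF addexp_mult[OF \<theta>(2) r(1)] t(1)] by blast
qed

text \<open>If b clears the denominators of f and n = deg f, then b^n f(X / b) is monic with root b
  \<theta>, and its lower coefficients b^(n-i) a_i lie in \<open>R\<close> because b a_i does. A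
  monic polynomial over \<open>R\<close> can be specialized without losing degree.\<close>

lemma integral_generator:
  fixes R :: "'b::alg_closed_field set"
  assumes R: "subrng R" and s: "separable_over (fracs R) \<theta>"
  shows "\<exists>\<eta> f. f \<in> polys_over R \<and> is_min_poly (fracs R) \<eta> f \<and> poly (pderiv f) \<eta> \<noteq> 0 \<and>
           sext (fracs R) \<theta> \<subseteq> sext (fracs R) \<eta>"
proof -
  note Q = fracs_subfld[OF R] and QR = subfld_subrng[OF fracs_subfld[OF R]] and RQ = fracs_incl[OF R]
  obtain f where f: "is_min_poly (fracs R) \<theta> f" "rsquarefree f" using s by (auto simp: separable_over_def)
  note fD = is_min_polyD[OF f(1)]
  obtain b where b: "b \<in> R" "b \<noteq> 0" "smult b f \<in> polys_over R" using clear_denominators[OF R fD(1)] by blast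
  define n where "n = degree f"
  define F where "F = smult (b ^ n) (pcompose f [:0, inverse b:])"
  define \<eta> where "\<eta> = b * \<theta>"
  have cF: "coeff F i = b ^ n * (inverse b ^ i * coeff f i)" for i
    by (simp add: F_def coeff_pcompose_linear)
  have dF: "degree F = n" using b by (simp add: F_def n_def degree_pcompose)
  have cancel: "b * \<theta> * inverse b = \<theta>" "inverse b * (b * \<theta>) = \<theta>" using b by (simp_all add: field_simps)
  have lF: "lead_coeff F = 1" using fD b by (simp add: cF dF) (simp add: n_def power_inverse)
  have "coeff F i \<in> R" for i
  proof -
    consider "i < n" | "i = n" | "i > n" by linarith
    then show ?thesis
    proof cases
      case 1
      then obtain k where k: "n = i + Suc k" using less_imp_Suc_add by auto
      have "coeff F i = b ^ k * coeff (smult b f) i" using b by (simp add: cF k power_add power_inverse)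
      then show ?thesis using polys_overD[OF b(3), of i] b(1) R by (metis subrng_mult subrng_power)
    next
      case 2 then show ?thesis using lF dF R by (simp add: subrng_1)
    next
      case 3 then show ?thesis using dF R by (simp add: coeff_eq_0 subrng_0)
    qed
  qed
  then have F_R: "F \<in> polys_over R" by (simp add: polys_over_def)
  have "poly F \<eta> = b ^ n * poly f (b * \<theta> * inverse b)" by (simp add: F_def \<eta>_def poly_pcompose)
  then have F\<eta>: "poly F \<eta> = 0" unfolding cancel(1) using fD(3) by simp
  have min: "degree F \<le> degree q" if q: "q \<in> polys_over (fracs R)" "q \<noteq> 0" "poly q \<eta> = 0" for q
  proof -
    have bq: "b \<in> fracs R" using b RQ by auto
    have "pcompose q [:0, b:] \<in> polys_over (fracs R)"
      by (rule polys_over_pcompose[OF QR q(1)]) (simp add: polys_over_pCons_iff[OF QR] polys_over_0[OF QR] subrng_0[OF QR] bq)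
    moreover have "pcompose q [:0, b:] \<noteq> 0" using q(2) b(2) by (simp add: pcompose_eq_0_iff)
    moreover have "poly (pcompose q [:0, b:]) \<theta> = 0" using q(3) by (simp add: poly_pcompose \<eta>_def mult.commute)
    ultimately have "degree f \<le> degree (pcompose q [:0, b:])" using f(1) by (simp add: is_min_poly_def)
    then show ?thesis using b by (simp add: dF n_def degree_pcompose)
  qed
  have mF: "is_min_poly (fracs R) \<eta> F"
    unfolding is_min_poly_def using F_R polys_over_mono[OF RQ] lF F\<eta> min by blast
  have "poly (pderiv F) \<eta> = b ^ n * (inverse b * poly (pderiv f) (b * \<theta> * inverse b))"
    by (simp add: F_def \<eta>_def pderiv_smult pderiv_pcompose poly_pcompose pderiv_pCons)
  then have "poly (pderiv F) \<eta> = b ^ n * (inverse b * poly (pderiv f) \<theta>)" unfolding cancel(1) .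
  moreover have "poly (pderiv f) \<theta> \<noteq> 0" using f(2) fD(3) by (auto simp: rsquarefree_iff)
  ultimately have "poly (pderiv F) \<eta> \<noteq> 0" using b by simp
  moreover have "sext (fracs R) \<theta> \<subseteq> sext (fracs R) \<eta>"
  proof (rule sext_least[OF sext_subrng[OF QR] sext_incl[OF QR]])
    have "inverse b \<in> sext (fracs R) \<eta>"
      using sext_incl[OF QR, of \<eta>] subfld_inverse[OF Q, of b] RQ b by auto
    then have "inverse b * \<eta> \<in> sext (fracs R) \<eta>"
      by (rule subrng_mult[OF sext_subrng[OF QR] _ sext_mem[OF QR]])
    then show "\<theta> \<in> sext (fracs R) \<eta>" by (simp only: \<eta>_def cancel)
  qed
  ultimately show ?thesis using F_R mF by blast
qed

lemma sext_frac_numerator: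
  assumes R: "subrng R" and x: "x \<in> sext (fracs R) \<eta>"
  shows "\<exists>e\<in>R. \<exists>h\<in>polys_over R. e \<noteq> 0 \<and> e * x = poly h \<eta>"
proof -
  obtain p where p: "p \<in> polys_over (fracs R)" "x = poly p \<eta>" using x by (auto simp: sext_def)
  obtain e where "e \<in> R" "e \<noteq> 0" "smult e p \<in> polys_over R" using clear_denominators[OF R p(1)] by blast
  then show ?thesis using p by (intro bexI[of _ e] bexI[of _ "smult e p"]) auto
qed

section \<open>Places at which the equations can be reduced\<close>

context euclid
begin

text \<open>Inverting p(\<eta>) and clearing denominators gives p g - b = f k over \<open>R\<close>
  with b nonzero. After a specialization with \<psi> b nonzero, a prime dividing a value of \<psi> f
  at m but not N \<psi> b cannot divide the value of \<psi> p there.\<close>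

lemma choose_place:
  assumes R: "spec R" and f: "f \<in> polys_over R" "is_min_poly (fracs R) \<eta> f"
    and p: "p \<in> polys_over R" "poly p \<eta> \<noteq> 0" and N: "N \<in> D" "N \<noteq> 0"
  shows "\<exists>\<pi> m \<psi>. pr \<pi> \<and> \<not> ddvd \<pi> N \<and> Dhom R \<psi> \<and> m \<in> D \<and> ddvd \<pi> (poly (map_poly \<psi> f) m) \<and>
           \<not> ddvd \<pi> (poly (map_poly \<psi> p) m)"
proof -
  note RS = specD(1)[OF R]
  note Q = fracs_subfld[OF RS] and QR = subfld_subrng[OF fracs_subfld[OF RS]] and RQ = fracs_incl[OF RS]
  note fD = is_min_polyD[OF f(2)]
  have alg: "alg_over (fracs R) \<eta>" using fD by (auto simp: alg_over_def)
  have "poly p \<eta> \<in> sext (fracs R) \<eta>" using p polys_over_mono[OF RQ] by (auto simp: sext_def)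
  then have "inverse (poly p \<eta>) \<in> sext (fracs R) \<eta>" by (rule subfld_inverse[OF sext_subfld[OF Q alg]])
  then obtain b g where bg: "b \<in> R" "g \<in> polys_over R" "b \<noteq> 0" "b * inverse (poly p \<eta>) = poly g \<eta>"
    using sext_frac_numerator[OF RS] by blast
  have "poly (p * g - [:b:]) \<eta> = 0" using bg(4) p(2) by (simp add: field_simps flip: bg(4))
  moreover have pg: "p * g - [:b:] \<in> polys_over R" using p bg RS by (auto intro!: polys_over_intros)
  ultimately have "f dvd p * g - [:b:]" using min_poly_dvd[OF Q f(2)] polys_over_mono[OF RQ] by blast
  then obtain k where k: "k \<in> polys_over R" "p * g - [:b:] = f * k"
    using polys_over_dvdE[OF RS f(1) fD(2) pg] by blast
  obtain \<psi>0 where "Dhom R \<psi>0" using specD(3)[OF R] by blast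
  from specD(4)[OF R this subrng_1[OF D] one_neq_zero bg(1,3)]
  obtain \<psi> where \<psi>: "Dhom R \<psi>" "\<psi> b \<noteq> 0" by blast
  have h: "rhom R \<psi>" and \<psi>D: "\<And>x. x \<in> R \<Longrightarrow> \<psi> x \<in> D" using \<psi> by (auto simp: Dhom_def)
  note mp = map_poly_rhom_in[OF RS h \<psi>D]
  have "coeff (map_poly \<psi> f) (degree f) = 1" using fD by (simp add: coeff_map_rhom[OF RS h] rhom_1[OF h])
  then have "degree (map_poly \<psi> f) \<ge> degree f" by (intro le_degree) simp
  then have df: "degree (map_poly \<psi> f) > 0" using fD by simp
  have "N * \<psi> b \<in> D" "N * \<psi> b \<noteq> 0" using N \<psi> \<psi>D[OF bg(1)] D by (auto intro: subrng_mult)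
  from prime_dividing_value[OF mp[OF _ f(1)] df this]
  obtain \<pi> m where \<pi>: "pr \<pi>" "m \<in> D" "ddvd \<pi> (poly (map_poly \<psi> f) m)" "\<not> ddvd \<pi> (N * \<psi> b)" by blast
  have "\<not> ddvd \<pi> N" using \<pi>(4) ddvd_mult[OF _ \<psi>D[OF bg(1)]] by blast
  moreover have "\<not> ddvd \<pi> (poly (map_poly \<psi> p) m)"
  proof
    assume *: "ddvd \<pi> (poly (map_poly \<psi> p) m)"
    have "map_poly \<psi> p * map_poly \<psi> g - [:\<psi> b:] = map_poly \<psi> (p * g - [:b:])"
      using p bg(1,2) RS by (simp add: map_rhom_diff[OF RS h] map_rhom_mult[OF RS h] map_rhom_pCons[OF RS h]
          map_rhom_0[OF RS h] polys_over_intros)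
    also have "\<dots> = map_poly \<psi> f * map_poly \<psi> k"
      unfolding k(2) by (rule map_rhom_mult[OF RS h f(1) k(1)])
    finally have "map_poly \<psi> p * map_poly \<psi> g - [:\<psi> b:] = map_poly \<psi> f * map_poly \<psi> k" .
    from arg_cong[OF this, of "\<lambda>q. poly q m"]
    have "\<psi> b = poly (map_poly \<psi> p) m * poly (map_poly \<psi> g) m + poly (map_poly \<psi> f) m * (- poly (map_poly \<psi> k) m)"
      by (simp add: algebra_simps)
    then have "ddvd \<pi> (\<psi> b)"
      using poly_in_subrng[OF D mp[OF _ bg(2)] \<pi>(2)] subrng_uminus[OF D poly_in_subrng[OF D mp[OF _ k(1)] \<pi>(2)]]
      by (intro ddvd_lin[OF * \<pi>(3), of "poly (map_poly \<psi> g) m" "- poly (map_poly \<psi> k) m"]) auto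
    then show False using \<pi>(4) ddvd_mult2[OF _ N(1)] by blast
  qed
  ultimately show ?thesis using \<pi> \<psi> by blast
qed

lemma reduce_artin_schreier:
  assumes R: "spec R" and f: "f \<in> polys_over R" "is_min_poly (fracs R) \<eta> f"
    and \<pi>: "pr \<pi>" and \<psi>: "Dhom R \<psi>"
    and m: "m \<in> D" "ddvd \<pi> (poly (map_poly \<psi> f) m)" "\<not> ddvd \<pi> (poly (map_poly \<psi> (pderiv f)) m)"
    and e: "e \<in> R" "\<not> ddvd \<pi> (\<psi> e)" and A: "A \<in> polys_over R"
    and W: "W \<in> sext (fracs R) \<eta>" "e * (W ^ 2 + W) = poly A \<eta>"
  shows "\<exists>w\<in>D. ddvd \<pi> (\<psi> e * (w ^ 2 + w) - poly (map_poly \<psi> A) m)"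
proof -
  note RS = specD(1)[OF R]
  note Q = fracs_subfld[OF RS] and QR = subfld_subrng[OF fracs_subfld[OF RS]] and RQ = fracs_incl[OF RS]
  note fD = is_min_polyD[OF f(2)]
  have \<pi>D: "\<pi> \<in> D" "\<pi> \<noteq> 0" using \<pi> by (auto simp: pr_def)
  obtain d h where d: "d \<in> R" "h \<in> polys_over R" "d \<noteq> 0" "d * W = poly h \<eta>"
    using sext_frac_numerator[OF RS W(1)] by blast
  define E where "E = smult e (h ^ 2 + smult d h) - smult (d ^ 2) A"
  have d2: "d ^ 2 \<in> R" using d RS by (simp add: subrng_power)
  have E: "E \<in> polys_over R" unfolding E_def using d d2 e A RS by (auto intro!: polys_over_intros)
  have "poly E \<eta> = d ^ 2 * (e * (W ^ 2 + W) - poly A \<eta>)"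
    by (simp add: E_def algebra_simps power2_eq_square flip: d(4))
  then have "poly E \<eta> = 0" using W(2) by simp
  then have "f dvd E" using min_poly_dvd[OF Q f(2)] E polys_over_mono[OF RQ] by blast
  then obtain k where k: "k \<in> polys_over R" "E = f * k" using polys_over_dvdE[OF RS f(1) fD(2) E] by blast
  \<comment> \<open>The denominator \<open>d\<close> of \<open>W\<close> was not known when \<psi>
    was chosen and may specialize to 0. A congruent retraction with \<phi> d nonzero repairs this;
    \<phi> d may still be divisible by \<open>\<pi>\<close>, which
    \<open>reduce_at_simple_root\<close> tolerates.\<close>
  obtain \<phi> where \<phi>: "Dhom R \<phi>" "\<And>x. x \<in> R \<Longrightarrow> ddvd \<pi> (\<phi> x - \<psi> x)" "\<phi> d \<noteq> 0"
    using specD(4)[OF R \<psi> \<pi>D d(1,3)] by blast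
  have h\<phi>: "rhom R \<phi>" and \<phi>D: "\<And>x. x \<in> R \<Longrightarrow> \<phi> x \<in> D" using \<phi> by (auto simp: Dhom_def)
  note mp = map_poly_rhom_in[OF RS h\<phi> \<phi>D]
  have mm: "ddvd \<pi> (m - m)" by (simp add: ddvd_0)
  have cong: "ddvd \<pi> (poly (map_poly \<phi> p) m - poly (map_poly \<psi> p) m)" if p: "p \<in> polys_over R" for p
    by (rule Dhom_poly_cong[OF RS \<psi> \<phi>(1) _ m(1) m(1) mm p]) (rule \<phi>(2))
  have iff: "ddvd \<pi> (poly (map_poly \<phi> p) m) \<longleftrightarrow> ddvd \<pi> (poly (map_poly \<psi> p) m)" if p: "p \<in> polys_over R" for p
    using ddvd_add[OF cong[OF p], of "poly (map_poly \<psi> p) m"] ddvd_diff[OF _ cong[OF p], of "poly (map_poly \<phi> p) m"] by auto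
  have ffD: "map_poly \<phi> f \<in> polys_over D" using mp f(1) by blast
  have c1: "coeff (map_poly \<phi> f) (degree f) = 1" using fD by (simp add: coeff_map_rhom[OF RS h\<phi>] rhom_1[OF h\<phi>])
  have "degree (map_poly \<phi> f) \<le> degree f" by (rule degree_le) (simp add: coeff_map_rhom[OF RS h\<phi>] coeff_eq_0 rhom_0[OF RS h\<phi>])
  moreover have "degree (map_poly \<phi> f) \<ge> degree f" by (intro le_degree) (simp add: c1)
  ultimately have lc: "lead_coeff (map_poly \<phi> f) = 1" using c1 by simp
  have hh: "h ^ 2 \<in> polys_over R" "smult d h \<in> polys_over R" "h ^ 2 + smult d h \<in> polys_over R"
    "smult e (h ^ 2 + smult d h) \<in> polys_over R" "smult (d ^ 2) A \<in> polys_over R" "d ^ 2 \<in> R"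
    using d d2 e A RS by (auto intro!: polys_over_intros)
  have "map_poly \<phi> E = smult (\<phi> e) (map_poly \<phi> h ^ 2 + smult (\<phi> d) (1 * map_poly \<phi> h)) - smult (\<phi> d ^ 2) (1 ^ 2 * map_poly \<phi> A)"
    using d e A hh unfolding E_def
    by (simp add: map_rhom_diff[OF RS h\<phi>] map_rhom_smult[OF RS h\<phi>] map_rhom_add[OF RS h\<phi>]
        rhom_power[OF RS h\<phi>] power2_eq_square[of h] map_rhom_mult[OF RS h\<phi>] power2_eq_square[of "map_poly \<phi> h"])
  moreover have "map_poly \<phi> f dvd map_poly \<phi> E" using k f(1) by (simp add: map_rhom_mult[OF RS h\<phi>])
  ultimately have dv: "map_poly \<phi> f dvd smult (\<phi> e) (map_poly \<phi> h ^ 2 + smult (\<phi> d) (1 * map_poly \<phi> h)) - smult (\<phi> d ^ 2) (1 ^ 2 * map_poly \<phi> A)"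
    by simp
  have e1: "\<not> ddvd \<pi> (\<phi> e)"
    using e \<phi>(2)[OF e(1)] ddvd_diff[OF _ \<phi>(2)[OF e(1)], of "\<phi> e"] by auto
  have m2: "\<not> ddvd \<pi> (poly (pderiv (map_poly \<phi> f)) m)"
    using m(3) iff[OF polys_over_pderiv[OF RS f(1)]] pderiv_map_rhom[OF RS h\<phi> f(1)] by simp
  have m1: "ddvd \<pi> (poly (map_poly \<phi> f) m)" using m(2) iff[OF f(1)] by simp
  have "\<not> ddvd \<pi> (poly 1 m)" using \<pi> by (simp add: pr_def)
  from reduce_at_simple_root[OF \<pi> ffD lc m(1) m1 m2 \<phi>D[OF e(1)] e1 mp[OF _ A] \<phi>D[OF d(1)] \<phi>(3) mp[OF _ d(2)]
      polys_over_1[OF D] this dv]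
  obtain w where w: "w \<in> D" "ddvd \<pi> (\<phi> e * (w ^ 2 + w) - poly (map_poly \<phi> A) m)" by blast
  have "ddvd \<pi> ((\<phi> e - \<psi> e) * (w ^ 2 + w))" using \<phi>(2)[OF e(1)] w D by (intro ddvd_mult) (auto intro!: subrng_intros)
  from ddvd_add[OF ddvd_diff[OF w(2) this] cong[OF A]]
  have "ddvd \<pi> (\<psi> e * (w ^ 2 + w) - poly (map_poly \<psi> A) m)" by (simp add: algebra_simps)
  then show ?thesis using w by blast
qed

lemma crt_step:
  assumes \<pi>: "pr \<pi>" and P: "P \<in> D" "\<not> ddvd \<pi> P" and xz: "x \<in> D" "z \<in> D"
  shows "\<exists>c\<in>D. ddvd P (c - x) \<and> ddvd \<pi> (c - z)"
proof -
  obtain y where y: "y \<in> D" "ddvd \<pi> (P * y - 1)" using \<pi> P by (auto simp: pr_def)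
  define c where "c = x + P * (y * (z - x))"
  have "c \<in> D" using y P xz D by (auto simp: c_def intro!: subrng_intros)
  moreover have "ddvd P (c - x)" unfolding ddvd_def c_def
    using y xz D by (intro bexI[of _ "y * (z - x)"]) (auto intro!: subrng_intros)
  moreover have "ddvd \<pi> (c - z)"
  proof -
    have "c - z = (P * y - 1) * (z - x)" by (simp add: c_def algebra_simps)
    then show ?thesis using ddvd_mult[OF y(2), of "z - x"] xz D by (simp add: subrng_diff)
  qed
  ultimately show ?thesis by blast
qed

end

text \<open>If 2 is nonzero in the field F, membership of A means that 1 + 4 A is a square in F; if
  2 = 0, this is the image of the Artin-Schreier map.\<close>

definition as_image :: "'b::field set \<Rightarrow> 'b set" where
  "as_image F = {w ^ 2 + w | w. w \<in> F}"

locale euclid_alg_closed = euclid D \<delta> for D :: "'b::alg_closed_field set" and \<delta>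
begin

text \<open>If \<open>y\<^sup>2 + y = A\<close> and \<open>y'\<^sup>2 + y' = B\<close>, then \<open>z = y + y' + 2yy'\<close> satisfies
  \<open>z\<^sup>2 + z = A + B + 4AB\<close>, in every characteristic; hence the third condition.\<close>
lemma generic_at_place:
  assumes S: "finite S" and ab: "a \<in> fgen S" "b \<in> fgen S" "a \<noteq> 0" "b \<noteq> 0" "a \<noteq> b" and N: "N \<in> D" "N \<noteq> 0"
    and char: "(2::'b) = 0 \<or> (\<exists>u\<in>D. N = 2 * u * (u ^ 2 - 1) * N')" "N' \<in> D"
  shows "\<exists>\<pi>. pr \<pi> \<and> \<not> ddvd \<pi> N \<and>
    (\<exists>c0\<in>D. \<forall>c\<in>D. ddvd \<pi> (c - c0) \<longrightarrow> c * a \<notin> as_image (fgen S)) \<and>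
    (\<exists>c0\<in>D. \<forall>c\<in>D. ddvd \<pi> (c - c0) \<longrightarrow> c * b \<notin> as_image (fgen S)) \<and>
    (\<exists>c0\<in>D. \<forall>c\<in>D. ddvd \<pi> (c - c0) \<longrightarrow> c * a + c * b + 4 * (c * a) * (c * b) \<notin> as_image (fgen S))"
proof -
  let ?F = "fgen S"
  note FI = subfld_intros[OF fgen_subfld[of S]] and I = subrng_intros[OF D]
  obtain R where R: "spec R" "\<And>s. s \<in> S \<Longrightarrow> alg_over R s" using exists_spec[OF S] by blast
  note RS = specD(1)[OF R(1)] and DR = specD(2)[OF R(1)]
  note Q = fracs_subfld[OF RS] and QR = subfld_subrng[OF fracs_subfld[OF RS]] and RQ = fracs_incl[OF RS]
  have infQ: "infinite (fracs R)" using infinite_D DR RQ finite_subset by (metis subset_trans)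
  obtain \<theta> q where \<theta>: "separable_over (fracs R) \<theta>" and q: "addexp TYPE('b) q"
    and Sq: "\<And>s. s \<in> S \<Longrightarrow> s ^ q \<in> sext (fracs R) \<theta>"
    using primitive_up_to_power[OF Q infQ S alg_over_mono[OF R(2) RQ]] by blast
  obtain \<eta> f where f: "f \<in> polys_over R" "is_min_poly (fracs R) \<eta> f" "poly (pderiv f) \<eta> \<noteq> 0"
    "sext (fracs R) \<theta> \<subseteq> sext (fracs R) \<eta>" using integral_generator[OF RS \<theta>] by blast
  let ?E = "sext (fracs R) \<eta>"
  have "alg_over (fracs R) \<eta>" using is_min_polyD[OF f(2)] by (auto simp: alg_over_def)
  then have E: "subfld ?E" by (rule sext_subfld[OF Q])
  have "?F \<subseteq> {x. x ^ q \<in> ?E}" by (rule fgen_least[OF addexp_preimage[OF q E]]) (use Sq f(4) in auto)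
  then have Fq: "x ^ q \<in> ?E" if "x \<in> ?F" for x using that by auto
  have add: "(x + y) ^ q = x ^ q + y ^ q" and q0: "q > 0" for x y :: 'b using q by (auto simp: addexp_def)
  \<comment> \<open>The constant 4 of the third condition must survive raising to the q-th
    power.\<close>
  have four: "(4::'b) ^ q = 4"
    using add[of "1 + 1" "1 + 1"] add[of 1 1] by simp
  obtain e1 h1 where h1: "e1 \<in> R" "h1 \<in> polys_over R" "e1 \<noteq> 0" "e1 * a ^ q = poly h1 \<eta>"
    using sext_frac_numerator[OF RS Fq[OF ab(1)]] by blast
  obtain e2 h2 where h2: "e2 \<in> R" "h2 \<in> polys_over R" "e2 \<noteq> 0" "e2 * b ^ q = poly h2 \<eta>"
    using sext_frac_numerator[OF RS Fq[OF ab(2)]] by blast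
  define e where "e = e1 * e2"
  define ha where "ha = smult e2 h1"
  define hb where "hb = smult e1 h2"
  have e: "e \<in> R" "e \<noteq> 0" and ha: "ha \<in> polys_over R" "poly ha \<eta> = e * a ^ q"
    and hb: "hb \<in> polys_over R" "poly hb \<eta> = e * b ^ q"
    using h1 h2 RS by (auto simp: e_def ha_def hb_def intro: subrng_mult polys_over_smult simp flip: h1(4) h2(4))
  \<comment> \<open>At a place where \<open>p\<close> is a unit, all its factors are: the root is
    simple, the denominator \<open>e\<close> is invertible, and a^q, b^q have nonzero, distinct
    residues.\<close>
  define p where "p = smult e (pderiv f * ha * hb * (ha - hb))"
  have pR: "p \<in> polys_over R" unfolding p_def using f ha hb e RS by (auto intro!: polys_over_intros)
  have "a ^ q \<noteq> b ^ q" using addexp_diff[OF q, of a b] ab(5) q0 by (metis eq_iff_diff_eq_0 power_eq_0_iff)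
  then have p\<eta>: "poly p \<eta> \<noteq> 0" using f(3) e ab by (simp add: p_def ha(2) hb(2))
  obtain \<pi> m \<psi> where \<pi>: "pr \<pi>" "\<not> ddvd \<pi> N" and \<psi>: "Dhom R \<psi>" and m: "m \<in> D" "ddvd \<pi> (poly (map_poly \<psi> f) m)"
    "\<not> ddvd \<pi> (poly (map_poly \<psi> p) m)"
    using choose_place[OF R(1) f(1,2) pR p\<eta> N] by blast
  have h: "rhom R \<psi>" and \<psi>D: "\<And>x. x \<in> R \<Longrightarrow> \<psi> x \<in> D" and \<psi>id: "\<And>x. x \<in> D \<Longrightarrow> \<psi> x = x" using \<psi> by (auto simp: Dhom_def)
  note mp = map_poly_rhom_in[OF RS h \<psi>D]
  define \<epsilon> where "\<epsilon> = \<psi> e"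
  define \<alpha> where "\<alpha> = poly (map_poly \<psi> ha) m"
  define \<beta> where "\<beta> = poly (map_poly \<psi> hb) m"
  define f' where "f' = poly (map_poly \<psi> (pderiv f)) m"
  have mem: "\<epsilon> \<in> D" "\<alpha> \<in> D" "\<beta> \<in> D" "f' \<in> D"
    using \<psi>D[OF e(1)] poly_in_subrng[OF D mp[OF _ ha(1)] m(1)] poly_in_subrng[OF D mp[OF _ hb(1)] m(1)]
      poly_in_subrng[OF D mp[OF _ polys_over_pderiv[OF RS f(1)]] m(1)]
    by (auto simp: \<epsilon>_def \<alpha>_def \<beta>_def f'_def)
  have "poly (map_poly \<psi> p) m = f' * \<alpha> * \<beta> * (\<alpha> - \<beta>) * \<epsilon>"
    using f(1) ha(1) hb(1) e(1) RS unfolding p_def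
    by (simp add: map_rhom_smult[OF RS h] map_rhom_mult[OF RS h] map_rhom_diff[OF RS h]
        polys_over_intros \<epsilon>_def \<alpha>_def \<beta>_def f'_def)
  then have nd: "\<not> ddvd \<pi> (f' * \<alpha> * \<beta> * (\<alpha> - \<beta>) * \<epsilon>)" using m(3) by simp
  have n\<epsilon>: "\<not> ddvd \<pi> \<epsilon>" and n\<alpha>: "\<not> ddvd \<pi> \<alpha>" and n\<beta>: "\<not> ddvd \<pi> \<beta>" and n\<alpha>\<beta>: "\<not> ddvd \<pi> (\<alpha> - \<beta>)" and nf': "\<not> ddvd \<pi> f'"
    using nd mem I by (meson ddvd_mult ddvd_mult2)+
  obtain \<epsilon>' where \<epsilon>': "\<epsilon>' \<in> D" "ddvd \<pi> (\<epsilon> * \<epsilon>' - 1)" using \<pi>(1) mem(1) n\<epsilon> by (auto simp: pr_def)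
  have n\<epsilon>': "\<not> ddvd \<pi> \<epsilon>'"
  proof
    assume "ddvd \<pi> \<epsilon>'"
    then have "ddvd \<pi> 1" by (rule ddvd_lin[OF _ \<epsilon>'(2), of _ \<epsilon> "- 1"]) (use mem I in auto)
    then show False using \<pi> by (simp add: pr_def)
  qed
  \<comment> \<open>The residue of a^q, since \<open>ha\<close> represents e a^q and \<epsilon>'
    inverts the residue of \<open>e\<close>.\<close>
  define \<alpha>' where "\<alpha>' = \<epsilon>' * \<alpha>"
  define \<beta>' where "\<beta>' = \<epsilon>' * \<beta>"
  have mem': "\<alpha>' \<in> D" "\<beta>' \<in> D" using \<epsilon>' mem I by (auto simp: \<alpha>'_def \<beta>'_def)
  have "\<alpha>' - \<beta>' = \<epsilon>' * (\<alpha> - \<beta>)" by (simp add: \<alpha>'_def \<beta>'_def algebra_simps)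
  then have n': "\<not> ddvd \<pi> \<alpha>'" "\<not> ddvd \<pi> \<beta>'" "\<not> ddvd \<pi> (\<alpha>' - \<beta>')"
    using pr_mult[OF \<pi>(1)] n\<alpha> n\<beta> n\<alpha>\<beta> n\<epsilon>' \<epsilon>'(1) mem I by (metis \<alpha>'_def, metis \<beta>'_def, metis)
  note red = reduce_artin_schreier[OF R(1) f(1,2) \<pi>(1) \<psi> m(1,2) nf'[unfolded f'_def]]
  have as: "\<exists>W\<in>?E. W ^ 2 + W = x ^ q" if x: "x \<in> as_image ?F" for x
  proof -
    obtain w where w: "x = w ^ 2 + w" "w \<in> ?F" using x by (auto simp: as_image_def)
    then show ?thesis using Fq[OF w(2)] by (intro bexI[of _ "w ^ q"]) (simp_all add: add power_mult[symmetric] mult.commute)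
  qed
  have lin: "\<exists>w\<in>D. ddvd \<pi> (w ^ 2 + w - c ^ q * (\<epsilon>' * poly (map_poly \<psi> hx) m))"
    if c: "c \<in> D" and x: "c * x \<in> as_image ?F" and hx: "hx \<in> polys_over R" "poly hx \<eta> = e * x ^ q" for c x hx
  proof -
    obtain W where W: "W \<in> ?E" "W ^ 2 + W = (c * x) ^ q" using as[OF x] by blast
    have cq: "c ^ q \<in> D" using c I by auto
    have A: "smult (c ^ q) hx \<in> polys_over R" using cq DR hx RS by (auto intro: polys_over_smult)
    have "e * (W ^ 2 + W) = poly (smult (c ^ q) hx) \<eta>" using W(2) hx(2) by (simp add: power_mult_distrib)
    from red[OF e(1) n\<epsilon>[unfolded \<epsilon>_def] A W(1) this] obtain w where
      w: "w \<in> D" "ddvd \<pi> (\<epsilon> * (w ^ 2 + w) - c ^ q * poly (map_poly \<psi> hx) m)"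
      using cq DR hx(1) by (auto simp: map_rhom_smult[OF RS h] subsetD \<psi>id \<epsilon>_def)
    have "ddvd \<pi> (w ^ 2 + w - c ^ q * (\<epsilon>' * poly (map_poly \<psi> hx) m))"
      by (rule ddvd_lin[OF w(2) \<epsilon>'(2), of \<epsilon>' "- (w ^ 2 + w)"])
         (use \<epsilon>' w I in \<open>auto simp: algebra_simps\<close>)
    then show ?thesis using w by blast
  qed
  have quad: "\<exists>w\<in>D. ddvd \<pi> (w ^ 2 + w - (c ^ q * (\<alpha>' + \<beta>') + 4 * (c ^ q) ^ 2 * (\<alpha>' * \<beta>')))"
    if c: "c \<in> D" and x: "c * a + c * b + 4 * (c * a) * (c * b) \<in> as_image ?F" for c
  proof -
    obtain W where W: "W \<in> ?E" "W ^ 2 + W = (c * a + c * b + 4 * (c * a) * (c * b)) ^ q" using as[OF x] by blast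
    define k where "k = c ^ q"
    have k: "k \<in> D" "k \<in> R" "4 * k ^ 2 \<in> D" "4 * k ^ 2 \<in> R" using c I DR by (auto simp: k_def)
    \<comment> \<open>The product ha hb carries the factor e^2, so the whole equation is multiplied
      by e^2.\<close>
    define A where "A = smult (k * e) (ha + hb) + smult (4 * k ^ 2) (ha * hb)"
    have ke: "k * e \<in> R" "\<psi> (k * e) = k * \<epsilon>"
      using k e RS by (simp_all add: subrng_mult rhom_mult[OF h] \<psi>id \<epsilon>_def)
    have A: "A \<in> polys_over R" unfolding A_def using k ke ha hb RS by (auto intro!: polys_over_intros)
    have "W ^ 2 + W = k * (a ^ q + b ^ q) + 4 * k ^ 2 * (a ^ q * b ^ q)"
      unfolding W(2) by (simp add: add power_mult_distrib four k_def power2_eq_square algebra_simps)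
    then have "e ^ 2 * (W ^ 2 + W) = poly A \<eta>"
      by (simp add: A_def ha hb algebra_simps power2_eq_square)
    moreover have "\<psi> (e ^ 2) = \<epsilon> ^ 2" by (simp add: rhom_power[OF RS h e(1)] \<epsilon>_def)
    moreover have "\<not> ddvd \<pi> (\<epsilon> ^ 2)" using pr_power[OF \<pi>(1) mem(1)] n\<epsilon> by blast
    ultimately obtain w where w: "w \<in> D" "ddvd \<pi> (\<epsilon> ^ 2 * (w ^ 2 + w) - poly (map_poly \<psi> A) m)"
      using red[OF subrng_power[OF RS e(1)] _ A W(1), of 2] by auto
    have "poly (map_poly \<psi> A) m = k * (\<epsilon> * (\<alpha> + \<beta>)) + 4 * k ^ 2 * (\<alpha> * \<beta>)"
      using k ke ha(1) hb(1) RS unfolding A_def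
      by (simp add: map_rhom_mult[OF RS h] map_rhom_add[OF RS h] map_rhom_smult[OF RS h] \<psi>id
          polys_over_intros \<alpha>_def \<beta>_def)
    then have w2: "ddvd \<pi> (\<epsilon> ^ 2 * (w ^ 2 + w) - (k * (\<epsilon> * (\<alpha> + \<beta>)) + 4 * k ^ 2 * (\<alpha> * \<beta>)))" using w by simp
    have "ddvd \<pi> (w ^ 2 + w - (k * (\<alpha>' + \<beta>') + 4 * k ^ 2 * (\<alpha>' * \<beta>')))"
      by (rule ddvd_lin[OF w2 \<epsilon>'(2), of "\<epsilon>' ^ 2" "k * (\<alpha> + \<beta>) * \<epsilon>' - (w ^ 2 + w) * (\<epsilon> * \<epsilon>' + 1)"])
         (use \<epsilon>' w mem k I in \<open>auto simp: \<alpha>'_def \<beta>'_def algebra_simps power2_eq_square\<close>)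
    then show ?thesis using w unfolding k_def by blast
  qed
  have "\<exists>c0\<in>D. \<forall>c\<in>D. ddvd \<pi> (c - c0) \<longrightarrow> c * a \<notin> as_image ?F"
    using generic_linear[OF \<pi>(1) q mem'(1) n'(1)] lin[OF _ _ ha] unfolding \<alpha>'_def \<alpha>_def by meson
  moreover have "\<exists>c0\<in>D. \<forall>c\<in>D. ddvd \<pi> (c - c0) \<longrightarrow> c * b \<notin> as_image ?F"
    using generic_linear[OF \<pi>(1) q mem'(2) n'(2)] lin[OF _ _ hb] unfolding \<beta>'_def \<beta>_def by meson
  moreover have "(2::'b) = 0 \<or> (\<not> ddvd \<pi> 2 \<and> (\<exists>u\<in>D. \<not> ddvd \<pi> u \<and> \<not> ddvd \<pi> (u ^ 2 - 1)))"
  proof (cases "(2::'b) = 0")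
    case False
    then obtain u where u: "u \<in> D" "N = 2 * u * (u ^ 2 - 1) * N'" using char by auto
    have "u ^ 2 - 1 \<in> D" using u I by auto
    then have "\<not> ddvd \<pi> 2" "\<not> ddvd \<pi> u" "\<not> ddvd \<pi> (u ^ 2 - 1)"
      using \<pi>(2) u(1) char(2) I unfolding u(2) by (meson ddvd_mult ddvd_mult2)+
    then show ?thesis using u by blast
  qed simp
  from generic_quadratic[OF \<pi>(1) q mem'(1) n'(1) mem'(2) n'(2,3) this]
  have "\<exists>c0\<in>D. \<forall>c\<in>D. ddvd \<pi> (c - c0) \<longrightarrow> c * a + c * b + 4 * (c * a) * (c * b) \<notin> as_image ?F"
    using quad by meson
  ultimately show ?thesis using \<pi> by blast
qed

theorem exists_generic_multiple:
  assumes S: "finite S" and ab: "a \<in> fgen S" "b \<in> fgen S" "a \<noteq> 0" "b \<noteq> 0" "a \<noteq> b"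
  shows "\<exists>c\<in>D. c * a \<notin> as_image (fgen S) \<and> c * b \<notin> as_image (fgen S) \<and>
           c * a + c * b + 4 * (c * a) * (c * b) \<notin> as_image (fgen S)"
proof -
  note I = subrng_intros[OF D]
  have "finite {0, 1, -1 :: 'b}" by simp
  then have "\<not> D \<subseteq> {0, 1, -1}" using infinite_D finite_subset by blast
  then obtain u where u: "u \<in> D" "u \<noteq> 0" "u \<noteq> 1" "u \<noteq> -1" by auto
  then have u2: "u ^ 2 - 1 \<noteq> 0" by (simp add: power2_eq_1_iff)
  \<comment> \<open>If 2 is nonzero, a prime not dividing \<open>N\<close> has 2, u and u^2 - 1 as
    units, as the quadratic case demands. Multiplying \<open>N\<close> by the primes already found
    keeps the three primes apart for the Chinese remainder theorem.\<close>
  define N where "N = (if (2::'b) = 0 then 1 else 2 * u * (u ^ 2 - 1))"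
  have N: "N \<in> D" "N \<noteq> 0" using u u2 I by (auto simp: N_def)
  have ch: "(2::'b) = 0 \<or> (\<exists>u\<in>D. N * N' = 2 * u * (u ^ 2 - 1) * N')" for N' using u by (auto simp: N_def)
  note place = generic_at_place[OF S ab _ _ ch]
  obtain \<pi>1 c1 where 1: "pr \<pi>1" "c1 \<in> D" "\<And>c. c \<in> D \<Longrightarrow> ddvd \<pi>1 (c - c1) \<Longrightarrow> c * a \<notin> as_image (fgen S)"
    using place[of 1] N I by auto
  have P1: "\<pi>1 \<in> D" "\<pi>1 \<noteq> 0" using 1 by (auto simp: pr_def)
  obtain \<pi>2 c2 where 2: "pr \<pi>2" "\<not> ddvd \<pi>2 (N * \<pi>1)" "c2 \<in> D"
    "\<And>c. c \<in> D \<Longrightarrow> ddvd \<pi>2 (c - c2) \<Longrightarrow> c * b \<notin> as_image (fgen S)"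
    using place[of \<pi>1] N P1 I by auto
  have P2: "\<pi>1 * \<pi>2 \<in> D" "\<pi>1 * \<pi>2 \<noteq> 0" using 2(1) P1 I by (auto simp: pr_def)
  obtain \<pi>3 c3 where 3: "pr \<pi>3" "\<not> ddvd \<pi>3 (N * (\<pi>1 * \<pi>2))" "c3 \<in> D"
    "\<And>c. c \<in> D \<Longrightarrow> ddvd \<pi>3 (c - c3) \<Longrightarrow> c * a + c * b + 4 * (c * a) * (c * b) \<notin> as_image (fgen S)"
    using place[of "\<pi>1 * \<pi>2"] N P2 I by auto
  have "\<not> ddvd \<pi>2 \<pi>1" using 2(2) ddvd_mult2[OF _ N(1)] by blast
  from crt_step[OF 2(1) P1(1) this 1(2) 2(3)]
  obtain c12 where c12: "c12 \<in> D" "ddvd \<pi>1 (c12 - c1)" "ddvd \<pi>2 (c12 - c2)" by blast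
  have "\<not> ddvd \<pi>3 (\<pi>1 * \<pi>2)" using 3(2) ddvd_mult2[OF _ N(1)] by blast
  from crt_step[OF 3(1) P2(1) this c12(1) 3(3)]
  obtain c where c: "c \<in> D" "ddvd (\<pi>1 * \<pi>2) (c - c12)" "ddvd \<pi>3 (c - c3)" by blast
  have \<pi>2D: "\<pi>2 \<in> D" using 2(1) by (simp add: pr_def)
  have "ddvd \<pi>1 (c - c12)" "ddvd \<pi>2 (c - c12)"
    using ddvd_trans[OF ddvd_mult[OF ddvd_self \<pi>2D] c(2)] ddvd_trans[OF ddvd_mult2[OF ddvd_self P1(1)] c(2)] by auto
  then have "ddvd \<pi>1 (c - c1)" "ddvd \<pi>2 (c - c2)"
    using ddvd_add[OF _ c12(2), of "c - c12"] ddvd_add[OF _ c12(3), of "c - c12"] by auto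
  then show ?thesis using 1(3) 2(4) 3(4) c by blast
qed

end

section \<open>The base rings\<close>

lemma Ints_subrng: "subrng (\<int> :: 'b::field set)"
  by (auto simp: subrng_def)

lemma of_int_eq_0_CHAR_0: "CHAR('b::field) = 0 \<Longrightarrow> of_int z = (0::'b) \<longleftrightarrow> z = 0"
  by (simp add: of_int_eq_0_iff_char_dvd)

lemma euclid_Ints:
  assumes ch: "CHAR('b::field) = 0"
  shows "\<exists>\<delta>. euclid (\<int> :: 'b set) \<delta>"
proof -
  have inj: "inj (of_int :: int \<Rightarrow> 'b)"
  proof (rule injI)
    fix x y assume "of_int x = (of_int y :: 'b)"
    then have "of_int (x - y) = (0::'b)" by simp
    then show "x = y" using of_int_eq_0_CHAR_0[OF ch, of "x - y"] by simp
  qed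
  define \<delta> where "\<delta> x = nat \<bar>inv_into UNIV (of_int :: int \<Rightarrow> 'b) x\<bar>" for x
  have \<delta>: "\<delta> (of_int z) = nat \<bar>z\<bar>" for z using inj by (simp add: \<delta>_def)
  have "euclid (\<int> :: 'b set) \<delta>"
  proof
    show "subrng (\<int> :: 'b set)" by (rule Ints_subrng)
    show "infinite (\<int> :: 'b set)" unfolding Ints_def using inj by (metis finite_imageD infinite_UNIV_int)
    have "{x \<in> \<int>. \<delta> x \<le> n} \<subseteq> (of_int :: int \<Rightarrow> 'b) ` {- int n..int n}" for n
    proof clarify
      fix x :: 'b assume "x \<in> \<int>" "\<delta> x \<le> n"
      then obtain z where z: "x = of_int z" "nat \<bar>z\<bar> \<le> n" by (metis Ints_cases \<delta>)
      then show "x \<in> of_int ` {- int n..int n}" by (intro image_eqI[of _ _ z]) auto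
    qed
    then show "finite {x \<in> \<int> :: 'b set. \<delta> x \<le> n}" for n by (rule finite_subset) simp
  next
    fix a b :: 'b assume "a \<in> \<int>" "b \<in> \<int>" "b \<noteq> 0"
    then obtain u v where uv: "a = of_int u" "b = of_int v" "v \<noteq> 0" by (metis Ints_cases of_int_0)
    have "a = b * of_int (u div v) + of_int (u mod v)" unfolding uv by (simp flip: of_int_mult of_int_add)
    moreover have "\<delta> (of_int (u mod v)) < \<delta> b" using uv abs_mod_less[of v u] by (simp add: \<delta>)
    ultimately show "\<exists>q\<in>\<int>. \<exists>r\<in>\<int>. a = b * q + r \<and> \<delta> r < \<delta> b" by (metis Ints_of_int)
  next
    fix a b :: 'b assume "a \<in> \<int>" "b \<in> \<int>"
    then obtain u v where uv: "a = of_int u" "b = of_int v" by (auto elim!: Ints_cases)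
    then show "\<delta> (a * b) = \<delta> a * \<delta> b" using \<delta>[of "u * v"] by (simp add: \<delta> abs_mult nat_mult_distrib)
  next
    fix a :: 'b assume "a \<in> \<int>"
    then obtain u where "a = of_int u" by (auto elim!: Ints_cases)
    then show "\<delta> a = 0 \<longleftrightarrow> a = 0" using of_int_eq_0_CHAR_0[OF ch] by (simp add: \<delta>)
  qed
  then show ?thesis by blast
qed

lemma finite_polys_over:
  assumes "finite F" shows "finite {h \<in> polys_over F. degree h \<le> n}"
proof (rule finite_subset)
  show "finite (Poly ` {xs. set xs \<subseteq> F \<and> length xs = Suc n})"
    using finite_lists_length_eq[OF assms] by blast
  show "{h \<in> polys_over F. degree h \<le> n} \<subseteq> Poly ` {xs. set xs \<subseteq> F \<and> length xs = Suc n}"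
  proof clarify
    fix h assume h: "h \<in> polys_over F" "degree h \<le> n"
    show "h \<in> Poly ` {xs. set xs \<subseteq> F \<and> length xs = Suc n}"
    proof (rule image_eqI)
      show "h = Poly (map (coeff h) [0..<Suc n])"
        by (rule poly_eqI) (use h in \<open>auto simp: nth_default_def coeff_eq_0 simp del: upt_Suc\<close>)
      show "map (coeff h) [0..<Suc n] \<in> {xs. set xs \<subseteq> F \<and> length xs = Suc n}"
        using h by (auto simp: polys_over_def)
    qed
  qed
qed

lemma euclid_poly_ring:
  assumes F: "subfld F" "finite F" and t: "\<not> alg_over F t"
  shows "\<exists>\<delta>. euclid (sext F t) \<delta>"
proof -
  note R = subfld_subrng[OF F(1)]
  have inj: "h = k" if "h \<in> polys_over F" "k \<in> polys_over F" "poly h t = poly k t" for h k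
  proof (rule ccontr)
    assume "h \<noteq> k"
    then have "h - k \<noteq> 0" by simp
    then show False using t that polys_over_diff[OF R that(1,2)] by (auto simp: alg_over_def)
  qed
  \<comment> \<open>\<open>THE\<close> is legitimate because \<open>t\<close> is transcendental. The
    exponential of the degree is multiplicative and separates 0, of size 0, from the constants, of
    size 1.\<close>
  define \<delta> where "\<delta> x = (let h = THE h. h \<in> polys_over F \<and> poly h t = x in if h = 0 then 0 else (2::nat) ^ degree h)" for x
  have \<delta>: "\<delta> (poly h t) = (if h = 0 then 0 else 2 ^ degree h)" if "h \<in> polys_over F" for h
  proof -
    have "(THE k. k \<in> polys_over F \<and> poly k t = poly h t) = h" using that inj by (intro the_equality) auto
    then show ?thesis by (simp add: \<delta>_def)
  qed
  have "euclid (sext F t) \<delta>"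
  proof
    show "subrng (sext F t)" by (rule sext_subrng[OF R])
    have mon: "monom 1 n \<in> polys_over F" for n using R by (simp add: polys_over_monom subrng_1)
    have "inj (\<lambda>n. poly (monom 1 n) t)"
    proof (rule injI)
      fix m n assume "poly (monom 1 m) t = poly (monom 1 n) t"
      then have "monom 1 m = (monom 1 n :: 'a poly)" by (rule inj[OF mon mon])
      then show "m = n" by (metis degree_monom_eq zero_neq_one)
    qed
    then have "infinite (range (\<lambda>n. poly (monom 1 n) t))" by (metis finite_imageD infinite_UNIV_nat)
    moreover have "range (\<lambda>n. poly (monom 1 n) t) \<subseteq> sext F t" using mon by (auto simp: sext_def)
    ultimately show "infinite (sext F t)" using finite_subset by blast
    fix n
    have "{x \<in> sext F t. \<delta> x \<le> n} \<subseteq> (\<lambda>h. poly h t) ` {h \<in> polys_over F. degree h \<le> n}"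
    proof clarify
      fix x assume "x \<in> sext F t" "\<delta> x \<le> n"
      then obtain h where h: "x = poly h t" "h \<in> polys_over F" "\<delta> (poly h t) \<le> n" by (auto simp: sext_def)
      have "degree h \<le> n"
      proof (cases "h = 0")
        case False
        then have "2 ^ degree h \<le> n" using h \<delta> by simp
        then show ?thesis using less_exp[of "degree h"] by linarith
      qed simp
      then show "x \<in> (\<lambda>h. poly h t) ` {h \<in> polys_over F. degree h \<le> n}" using h by blast
    qed
    then show "finite {x \<in> sext F t. \<delta> x \<le> n}" by (rule finite_subset) (intro finite_imageI finite_polys_over F)
  next
    fix a b assume "a \<in> sext F t" "b \<in> sext F t" "b \<noteq> 0"
    then obtain h k where hk: "a = poly h t" "b = poly k t" "h \<in> polys_over F" "k \<in> polys_over F" "k \<noteq> 0"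
      unfolding sext_def mem_Collect_eq by (metis poly_0)
    define c where "c = inverse (lead_coeff k)"
    have c: "c \<in> F" "c \<noteq> 0" using hk F by (auto simp: c_def intro!: subfld_inverse polys_overD)
    have k': "smult c k \<in> polys_over F" "lead_coeff (smult c k) = 1"
      using c hk R by (auto simp: c_def intro: polys_over_smult)
    obtain q r where qr: "q \<in> polys_over F" "r \<in> polys_over F" "h = smult c k * q + r"
      "r = 0 \<or> degree r < degree (smult c k)"
      using polys_over_division[OF R k' hk(3)] by blast
    have "a = b * poly (smult c q) t + poly r t" using hk qr(3) by simp
    moreover have "poly (smult c q) t \<in> sext F t" "poly r t \<in> sext F t"
      using qr polys_over_smult[OF R c(1) qr(1)] unfolding sext_def by blast+
    moreover have "\<delta> (poly r t) < \<delta> b" using qr hk c by (auto simp: \<delta>)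
    ultimately show "\<exists>q\<in>sext F t. \<exists>r\<in>sext F t. a = b * q + r \<and> \<delta> r < \<delta> b" by blast
  next
    fix a b assume "a \<in> sext F t" "b \<in> sext F t"
    then obtain h k where hk: "a = poly h t" "b = poly k t" "h \<in> polys_over F" "k \<in> polys_over F"
      by (auto simp: sext_def)
    then show "\<delta> (a * b) = \<delta> a * \<delta> b"
      using \<delta>[OF polys_over_mult[OF R hk(3,4)]] by (auto simp: \<delta> degree_mult_eq power_add)
  next
    fix a assume "a \<in> sext F t"
    then obtain h where h: "a = poly h t" "h \<in> polys_over F" by (auto simp: sext_def)
    have "poly h t = 0 \<longleftrightarrow> h = 0" using inj[OF h(2) polys_over_0[OF R]] by auto
    then show "\<delta> a = 0 \<longleftrightarrow> a = 0" using h by (simp add: \<delta>)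
  qed
  then show ?thesis by blast
qed

text \<open>In positive characteristic the image of the integers is the prime field: multiplication
  by a nonzero element is injective on a finite set, hence hits 1.\<close>

lemma prime_subfld:
  assumes ch: "CHAR('b::field) > 0" shows "finite (\<int> :: 'b set)" "subfld (\<int> :: 'b set)"
proof -
  define p where "p = CHAR('b)"
  have "(\<int> :: 'b set) \<subseteq> of_int ` {0..<int p}"
  proof
    fix x :: 'b assume "x \<in> \<int>"
    then obtain z where z: "x = of_int z" by (auto elim: Ints_cases)
    have p0: "of_int (int p) = (0::'b)" by (simp add: p_def)
    have "x = of_int (int p * (z div int p) + z mod int p)" by (simp add: z)
    also have "\<dots> = of_int (z mod int p)" using p0 by (simp only: of_int_add of_int_mult) simp
    finally show "x \<in> of_int ` {0..<int p}" using ch by (auto simp: p_def)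
  qed
  then show fin: "finite (\<int> :: 'b set)" by (rule finite_subset) simp
  have "inverse x \<in> \<int>" if x: "x \<in> \<int>" for x :: 'b
  proof (cases "x = 0")
    case False
    have "(\<lambda>y. x * y) ` \<int> = \<int>" by (rule endo_inj_surj[OF fin]) (use x False in \<open>auto intro: inj_onI\<close>)
    then have "1 \<in> (\<lambda>y. x * y) ` \<int>" by auto
    then obtain y where "y \<in> \<int>" "1 = x * y" by blast
    then show ?thesis by (metis inverse_unique)
  qed simp
  then show "subfld (\<int> :: 'b set)" using Ints_subrng by (simp add: subfld_def)
qed

text \<open>The Euclidean ring from which \<open>c\<close> is taken. What matters is
  \<open>base_ring_subset\<close>: every subring containing \<open>t\<close>, in particular the
  unknown subfield E, contains it.\<close>

definition base_ring :: "'b::field \<Rightarrow> 'b set" where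
  "base_ring t = (if CHAR('b) = 0 then \<int> else sext \<int> t)"

definition admissible :: "'b::field \<Rightarrow> bool" where
  "admissible t \<longleftrightarrow> CHAR('b) = 0 \<or> \<not> alg_over \<int> t"

lemma base_ring_subset: assumes "subrng F" "t \<in> F" shows "base_ring t \<subseteq> F"
proof -
  have "\<int> \<subseteq> F" using assms by (auto elim!: Ints_cases intro: subrng_of_int)
  then show ?thesis using sext_least[OF assms(1) _ assms(2)] by (auto simp: base_ring_def)
qed

theorem exists_generic_multiple_base_ring:
  fixes t a b :: "'b::alg_closed_field"
  assumes "admissible t" "finite S" "a \<in> fgen S" "b \<in> fgen S" "a \<noteq> 0" "b \<noteq> 0" "a \<noteq> b"
  shows "\<exists>c\<in>base_ring t. c * a \<notin> as_image (fgen S) \<and> c * b \<notin> as_image (fgen S) \<and>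
           c * a + c * b + 4 * (c * a) * (c * b) \<notin> as_image (fgen S)"
proof -
  have "\<exists>\<delta>. euclid (base_ring t) \<delta>"
  proof (cases "CHAR('b) = 0")
    case True then show ?thesis using euclid_Ints by (simp add: base_ring_def)
  next
    case False
    then show ?thesis using euclid_poly_ring[OF prime_subfld(2,1)] assms(1) by (simp add: base_ring_def admissible_def)
  qed
  then obtain \<delta> where "euclid (base_ring t) \<delta>" by blast
  then have "euclid_alg_closed (base_ring t) \<delta>" by (simp add: euclid_alg_closed_def)
  from euclid_alg_closed.exists_generic_multiple[OF this assms(2-)] show ?thesis .
qed

section \<open>Galois extensions and the equations \<open>y\<^sup>2 + y = c x\<close>\<close>

text \<open>The polynomial ring E[z] is spanned by 1 and z over E[z^2 + z]; the induction rewrites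
  z^2 as (z^2 + z) - z.\<close>

lemma as_decomposition:
  assumes E: "subrng E" and q: "q \<in> polys_over E"
  shows "\<exists>u\<in>polys_over E. \<exists>v\<in>polys_over E. \<forall>z. poly q z = poly u (z ^ 2 + z) + poly v (z ^ 2 + z) * z"
  using q
proof (induction q)
  case 0 then show ?case using E by (intro bexI[of _ 0]) (auto intro: polys_over_0)
next
  case (pCons a q)
  have aq: "a \<in> E" "q \<in> polys_over E" using pCons.prems E by (auto simp: polys_over_pCons_iff)
  obtain u v where uv: "u \<in> polys_over E" "v \<in> polys_over E"
    "\<And>z. poly q z = poly u (z ^ 2 + z) + poly v (z ^ 2 + z) * z" using pCons.IH[OF aq(2)] by blast
  have "poly (pCons a q) z = poly (pCons a v) (z ^ 2 + z) + poly (u - v) (z ^ 2 + z) * z" for z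
    by (simp add: uv(3) algebra_simps power2_eq_square)
  then show ?case using uv aq E by (intro bexI[of _ "pCons a v"] bexI[of _ "u - v"]) (auto simp: polys_over_pCons_iff intro: polys_over_diff)
qed

lemma as_conjugate_norm:
  assumes E: "subrng E" and q: "q \<in> polys_over E"
  shows "\<exists>r\<in>polys_over E. \<forall>z. poly r (z ^ 2 + z) = poly q z * poly q (- 1 - z)"
proof -
  obtain u v where uv: "u \<in> polys_over E" "v \<in> polys_over E"
    "\<And>z. poly q z = poly u (z ^ 2 + z) + poly v (z ^ 2 + z) * z" using as_decomposition[OF assms] by blast
  \<comment> \<open>The norm of u + v z from E[z] to E[z^2 + z]: the conjugate of z is -1 - z, with
    trace -1 and product -(z^2 + z).\<close>
  define r where "r = u ^ 2 - u * v - v ^ 2 * [:0, 1:]"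
  have "(- 1 - z) ^ 2 + (- 1 - z) = z ^ 2 + z" for z :: 'a by (simp add: power2_eq_square algebra_simps)
  then have q': "poly q (- 1 - z) = poly u (z ^ 2 + z) + poly v (z ^ 2 + z) * (- 1 - z)" for z by (simp only: uv(3))
  have "poly r (z ^ 2 + z) = poly q z * poly q (- 1 - z)" for z
    unfolding q' uv(3)[of z] r_def by (simp add: algebra_simps power2_eq_square)
  moreover have "r \<in> polys_over E" unfolding r_def using uv E
    by (auto simp: polys_over_pCons_iff subrng_0 subrng_1 intro!: polys_over_intros)
  ultimately show ?thesis by blast
qed

text \<open>Roots are transported by polynomials, without extending an automorphism. If q is the
  minimal polynomial of y over E, its norm, evaluated at c X, vanishes at x, hence at x'. So y' or
  -1 - y' is a root of q, and normality puts it into M.\<close>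

lemma galois_conjugate_pair:
  fixes E M :: "'b::alg_closed_field set"
  assumes gal: "galois_extension E M" and ne: "E \<subset> M"
  shows "\<exists>x\<in>M. \<exists>x'\<in>M. x \<noteq> 0 \<and> x' \<noteq> 0 \<and> x \<noteq> x' \<and>
    (\<forall>c\<in>E. \<forall>y\<in>M. y ^ 2 + y = c * x \<longrightarrow> (\<forall>y'. y' ^ 2 + y' = c * x' \<longrightarrow> y' \<in> M))"
proof -
  have E: "subfld E" and M: "subfld M" and EM: "E \<subseteq> M" and sep: "separable_extension E M" and nor: "normal_extension E M"
    using gal by (auto simp: galois_extension_def subfield_of_type_iff)
  note R = subfld_subrng[OF E]
  obtain x where x: "x \<in> M" "x \<notin> E" using ne by blast
  obtain p where p: "is_min_poly E x p" "rsquarefree p"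
    using sep x by (auto simp: separable_extension_def separable_over_def)
  note pD = is_min_polyD[OF p(1)]
  have "degree p \<noteq> 1" using degree_1_root_in[OF E pD(1) _ pD(3)] x by auto
  then have "card {y. poly p y = 0} \<noteq> 1" using rsquarefree_card_roots[OF p(2)] by simp
  then have "{y. poly p y = 0} \<noteq> {x}" by auto
  then obtain x' where x': "poly p x' = 0" "x' \<noteq> x" using pD(3) by blast
  have p': "is_min_poly E x' p" by (rule min_poly_other_root[OF E p(1) x'(1)])
  have root_in: "y \<in> M" if f: "is_min_poly E z f" and z: "z \<in> M" and y: "poly f y = 0" for z f y
  proof -
    obtain g where g: "is_min_poly E z g" "\<forall>y. poly g y = 0 \<longrightarrow> y \<in> M"
      using nor z by (auto simp: normal_extension_def)
    then show ?thesis using min_poly_unique[OF E f g(1)] y by blast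
  qed
  have x'M: "x' \<in> M" by (rule root_in[OF p(1) x(1) x'(1)])
  have nE: "z \<notin> E" if "is_min_poly E z p" for z
  proof
    assume "z \<in> E"
    from min_poly_unique[OF E that min_poly_of_mem[OF E this]] have "degree p = 1" by simp
    then show False using \<open>degree p \<noteq> 1\<close> by simp
  qed
  have "x \<noteq> 0" "x' \<noteq> 0" using nE[OF p(1)] nE[OF p'] subrng_0[OF R] by auto
  moreover have "y' \<in> M" if c: "c \<in> E" and y: "y \<in> M" "y ^ 2 + y = c * x" and y': "y' ^ 2 + y' = c * x'" for c y y'
  proof -
    obtain q where q: "is_min_poly E y q" using nor y by (auto simp: normal_extension_def)
    note qD = is_min_polyD[OF q]
    obtain r where r: "r \<in> polys_over E" "\<And>z. poly r (z ^ 2 + z) = poly q z * poly q (- 1 - z)"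
      using as_conjugate_norm[OF R qD(1)] by blast
    define s where "s = pcompose r [:0, c:]"
    have s: "poly s z = poly r (c * z)" for z by (simp add: s_def poly_pcompose mult.commute)
    have "s \<in> polys_over E" unfolding s_def
      using polys_over_pcompose[OF R r(1), of "[:0, c:]"] c by (simp add: polys_over_pCons_iff[OF R] polys_over_0[OF R] subrng_0[OF R])
    moreover have "poly s x = 0" using r(2)[of y] qD y by (simp add: s)
    ultimately have "p dvd s" by (rule min_poly_dvd[OF E p(1)])
    then have "poly s x' = 0" using x'(1) by (auto elim!: dvdE)
    then have "poly q y' * poly q (- 1 - y') = 0" using r(2)[of y'] y' by (simp add: s)
    then have "y' \<in> M \<or> - 1 - y' \<in> M" using root_in[OF q y(1)] by auto
    moreover have "- 1 - (- 1 - y') = y'" by simp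
    ultimately show ?thesis using subfld_intros(2,5,6)[OF M] by metis
  qed
  ultimately show ?thesis using x x' x'M by blast
qed

section \<open>Finite fields and transcendental elements\<close>

lemma finite_extension_field:
  assumes k: "subfld k" "finite k" and s: "alg_over k s"
  shows "finite (sext k s)" "subfld (sext k s)"
proof -
  show "subfld (sext k s)" by (rule sext_subfld[OF k(1) s])
  obtain f where f: "is_min_poly k s f" using min_poly_exists[OF k(1) s] by blast
  note fD = is_min_polyD[OF f]
  have "sext k s \<subseteq> (\<lambda>h. poly h s) ` {h \<in> polys_over k. degree h \<le> degree f}"
  proof
    fix z assume "z \<in> sext k s"
    then obtain h where h: "z = poly h s" "h \<in> polys_over k" by (auto simp: sext_def)
    obtain q r where qr: "q \<in> polys_over k" "r \<in> polys_over k" "h = f * q + r" "r = 0 \<or> degree r < degree f"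
      using polys_over_division[OF subfld_subrng[OF k(1)] fD(1,2) h(2)] by blast
    then have "z = poly r s" "degree r \<le> degree f" using h fD by auto
    then show "z \<in> (\<lambda>h. poly h s) ` {h \<in> polys_over k. degree h \<le> degree f}" using qr by blast
  qed
  then show "finite (sext k s)" by (rule finite_subset) (intro finite_imageI finite_polys_over k)
qed

lemma finite_subfld_containing:
  assumes k: "subfld k" "finite k" and T: "finite T" "\<And>s. s \<in> T \<Longrightarrow> alg_over k s"
  shows "\<exists>k'. subfld k' \<and> finite k' \<and> k \<subseteq> k' \<and> T \<subseteq> k'"
  using T
proof (induction T)
  case empty then show ?case using k by blast
next
  case (insert s T)
  then obtain k' where k': "subfld k'" "finite k'" "k \<subseteq> k'" "T \<subseteq> k'" by auto
  have "alg_over k' s" using insert.prems k'(3) alg_over_mono by blast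
  from finite_extension_field[OF k'(1,2) this] show ?case
    using k' sext_incl[OF subfld_subrng[OF k'(1)], of s] sext_mem[OF subfld_subrng[OF k'(1)], of s]
    by (intro exI[of _ "sext k' s"]) auto
qed

text \<open>If the characteristic is p and E consists of algebraic elements, the finitely many
  coefficients witnessing that \<open>S\<close> is algebraic over E generate a finite field. Then
  \<open>S\<close> would lie in a finite field as well.\<close>

lemma exists_admissible:
  fixes E :: "'b::field set"
  assumes E: "subfld E" and S: "finite S" "infinite (fgen S)" "\<And>s. s \<in> S \<Longrightarrow> alg_over E s"
  shows "\<exists>t\<in>E. admissible t"
proof (rule ccontr)
  assume "\<not> ?thesis"
  then have n: "\<And>t. t \<in> E \<Longrightarrow> CHAR('b) > 0 \<and> alg_over \<int> t" by (auto simp: admissible_def)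
  have ch: "CHAR('b) > 0" using n[OF subrng_0[OF subfld_subrng[OF E]]] by simp
  have "\<forall>s\<in>S. \<exists>p. p \<in> polys_over E \<and> p \<noteq> 0 \<and> poly p s = 0" using S(3) by (auto simp: alg_over_def)
  then obtain p where p: "\<And>s. s \<in> S \<Longrightarrow> p s \<in> polys_over E \<and> p s \<noteq> 0 \<and> poly (p s) s = 0" by metis
  define T where "T = (\<Union>s\<in>S. set (coeffs (p s)))"
  have "finite T" using S by (simp add: T_def)
  have "T \<subseteq> E" using p by (auto simp: T_def coeffs_def polys_over_def split: if_splits)
  then obtain k where k: "subfld k" "finite k" "T \<subseteq> k"
    using finite_subfld_containing[OF prime_subfld(2,1)[OF ch] \<open>finite T\<close>] n by blast
  have "alg_over k s" if "s \<in> S" for s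
  proof -
    have "coeff (p s) i \<in> k" for i
    proof (cases "i \<le> degree (p s)")
      case True
      then have "coeff (p s) i \<in> set (coeffs (p s))" using p[OF that] by (auto simp: coeffs_def simp del: upt_Suc)
      then show ?thesis using k(3) that by (auto simp: T_def)
    next
      case False then show ?thesis using k(1) by (simp add: coeff_eq_0 subfld_intros(1))
    qed
    then show ?thesis using p[OF that] unfolding alg_over_def polys_over_def by blast
  qed
  then obtain k' where k': "subfld k'" "finite k'" "S \<subseteq> k'"
    using finite_subfld_containing[OF k(1,2) S(1)] by blast
  have "fgen S \<subseteq> k'" by (rule fgen_least[OF k'(1,3)])
  then show False using S(2) k'(2) finite_subset by blast
qed

section \<open>Adjoining two roots independently\<close>

lemma as_root_cases: "z ^ 2 + z = w ^ 2 + w \<Longrightarrow> w = z \<or> w = - 1 - z" for z w :: "'b::field"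
proof -
  assume "z ^ 2 + z = w ^ 2 + w"
  then have "(w - z) * (w + z + 1) = 0" by (simp add: algebra_simps power2_eq_square)
  then have "w - z = 0 \<or> w + z + 1 = 0" by simp
  then show ?thesis
  proof
    assume "w + z + 1 = 0"
    moreover have "w = (w + z + 1) - 1 - z" by simp
    ultimately have "w = - 1 - z" by simp
    then show ?thesis ..
  qed simp
qed

lemma as_root_exists: "\<exists>z. z ^ 2 + z = (A :: 'b::alg_closed_field)"
proof -
  obtain z where "poly [:- A, 1, 1:] z = 0" using alg_closed_imp_poly_has_root[of "[:- A, 1, 1:]"] by auto
  then have "z ^ 2 + z = A" by (simp add: algebra_simps power2_eq_square eq_neg_iff_add_eq_0)
  then show ?thesis ..
qed

text \<open>Coinciding roots would equal -1/2, which lies in every field where 2 is nonzero; if 2 =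
  0 they always differ.\<close>

lemma as_root_neq_conj:
  assumes F: "subfld F" and z: "z \<notin> F" shows "- 1 - z \<noteq> z"
proof
  assume *: "- 1 - z = z"
  then have two: "2 * z = - 1" by (simp add: algebra_simps)
  then have "(2::'a) \<noteq> 0" by auto
  then have "z = - 1 / 2" using two by (simp add: field_simps)
  moreover have "- 1 / 2 \<in> F" by (intro subfld_divide[OF F] subfld_intros(2,5,10)[OF F])
  ultimately show False using z by simp
qed

lemma as_root_auts:
  assumes "\<rho> \<in> auts F" "z ^ 2 + z \<in> F" shows "\<rho> z = z \<or> \<rho> z = - 1 - z" "\<rho> (- 1 - z) = - 1 - \<rho> z"
proof -
  note h = auts_hom[OF assms(1)] and RU = subfld_subrng[OF subfld_UNIV]
  have "\<rho> (z ^ 2 + z) = \<rho> z ^ 2 + \<rho> z" by (simp add: rhom_add[OF h] rhom_power[OF RU h])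
  then show "\<rho> z = z \<or> \<rho> z = - 1 - z" using auts_fix[OF assms] by (intro as_root_cases) simp
  show "\<rho> (- 1 - z) = - 1 - \<rho> z" by (simp add: rhom_diff[OF RU h] rhom_uminus[OF RU h] rhom_1[OF h])
qed

lemma as_root_flip:
  fixes F :: "'b::alg_closed_field set"
  assumes F: "subfld F" and alg: "\<And>x. alg_over F x" and z: "z ^ 2 + z \<in> F" "z \<notin> F"
  shows "\<exists>\<rho>\<in>auts F. \<rho> z = - 1 - z"
proof -
  note R = subfld_subrng[OF F]
  define A where "A = z ^ 2 + z"
  define q where "q = [:- A, 1, 1:]"
  have "A \<in> F" using z by (simp add: A_def)
  then have q: "q \<in> polys_over F" using R
    by (simp add: q_def polys_over_pCons_iff polys_over_0 subrng_1 subrng_uminus)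
  obtain p where p: "is_min_poly F z p" using min_poly_exists[OF F alg] by blast
  note pD = is_min_polyD[OF p]
  have "p dvd q" by (rule min_poly_dvd[OF F p q]) (simp add: q_def A_def algebra_simps power2_eq_square)
  moreover have "degree p \<noteq> 1" using degree_1_root_in[OF F pD(1) _ pD(3)] z(2) by auto
  then have "degree q \<le> degree p" using pD(5) by (simp add: q_def)
  ultimately have "p = q" using pD by (intro monic_dvd_same_degree_eq) (auto simp: q_def)
  moreover have "poly q (- 1 - z) = 0" by (simp add: q_def A_def algebra_simps power2_eq_square)
  ultimately show ?thesis using aut_conjugate[OF F alg p] by blast
qed

text \<open>The realizable pairs (a, b) form a subgroup of (Z/2)^2. It contains an element flipping
  y, one flipping y' and, thanks to \<open>w\<close>, one flipping exactly one of them; together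
  these generate the whole group.\<close>

lemma independent_flips:
  fixes F :: "'b::alg_closed_field set"
  assumes F: "subfld F" and alg: "\<And>x. alg_over F x"
    and y: "y ^ 2 + y \<in> F" "y ^ 2 + y \<notin> as_image F" and y': "y' ^ 2 + y' \<in> F" "y' ^ 2 + y' \<notin> as_image F"
    and yy': "(y ^ 2 + y) + (y' ^ 2 + y') + 4 * (y ^ 2 + y) * (y' ^ 2 + y') \<notin> as_image F"
  shows "\<exists>\<rho>\<in>auts F. \<rho> y = (if a then - 1 - y else y) \<and> \<rho> y' = (if b then - 1 - y' else y')"
proof -
  note R = subfld_subrng[OF F]
  define w where "w = y + y' + 2 * y * y'"
  have w2: "w ^ 2 + w = (y ^ 2 + y) + (y' ^ 2 + y') + 4 * (y ^ 2 + y) * (y' ^ 2 + y')"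
    by (simp add: w_def algebra_simps power2_eq_square)
  have nF: "y \<notin> F" "y' \<notin> F" "w \<notin> F" using y y' yy' unfolding w2[symmetric] by (auto simp: as_image_def)
  have wF: "w ^ 2 + w \<in> F" unfolding w2 by (intro subfld_intros[OF F] y(1) y'(1))
  have ne: "- 1 - y \<noteq> y" "- 1 - y' \<noteq> y'" "- 1 - w \<noteq> w" using nF as_root_neq_conj[OF F] by auto
  have hom: "\<rho> w = \<rho> y + \<rho> y' + 2 * \<rho> y * \<rho> y'" if "\<rho> \<in> auts F" for \<rho>
  proof -
    note h = auts_hom[OF that]
    have "\<rho> 2 = 2" using rhom_add[OF h, of 1 1] by (simp add: rhom_1[OF h])
    then show ?thesis by (simp add: w_def rhom_add[OF h] rhom_mult[OF h])
  qed
  have comp: "\<exists>\<rho>\<in>auts F. \<rho> y = (if a1 \<noteq> a2 then - 1 - y else y) \<and> \<rho> y' = (if b1 \<noteq> b2 then - 1 - y' else y')"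
    if "\<exists>\<rho>\<in>auts F. \<rho> y = (if a1 then - 1 - y else y) \<and> \<rho> y' = (if b1 then - 1 - y' else y')"
       "\<exists>\<rho>\<in>auts F. \<rho> y = (if a2 then - 1 - y else y) \<and> \<rho> y' = (if b2 then - 1 - y' else y')" for a1 a2 b1 b2
  proof -
    from that obtain \<rho> \<tau> where \<rho>: "\<rho> \<in> auts F" "\<rho> y = (if a1 then - 1 - y else y)" "\<rho> y' = (if b1 then - 1 - y' else y')"
      and \<tau>: "\<tau> \<in> auts F" "\<tau> y = (if a2 then - 1 - y else y)" "\<tau> y' = (if b2 then - 1 - y' else y')" by blast
    show ?thesis
      by (rule bexI[OF _ auts_comp[OF \<rho>(1) \<tau>(1)]])
         (use as_root_auts(2)[OF \<rho>(1) y(1)] as_root_auts(2)[OF \<rho>(1) y'(1)] \<rho> \<tau> in auto)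
  qed
  define P where "P a b \<longleftrightarrow> (\<exists>\<rho>\<in>auts F. \<rho> y = (if a then - 1 - y else y) \<and> \<rho> y' = (if b then - 1 - y' else y'))" for a b
  have Pc: "P a1 b1 \<Longrightarrow> P a2 b2 \<Longrightarrow> P (a1 \<noteq> a2) (b1 \<noteq> b2)" for a1 a2 b1 b2 unfolding P_def by (rule comp)
  have P_of: "P (\<rho> y \<noteq> y) (\<rho> y' \<noteq> y')" if "\<rho> \<in> auts F" for \<rho>
    unfolding P_def using that as_root_auts(1)[OF that y(1)] as_root_auts(1)[OF that y'(1)] by (intro bexI[OF _ that]) auto
  obtain \<rho>1 where \<rho>1: "\<rho>1 \<in> auts F" "\<rho>1 y = - 1 - y" using as_root_flip[OF F alg y(1) nF(1)] by blast
  obtain \<rho>2 where \<rho>2: "\<rho>2 \<in> auts F" "\<rho>2 y' = - 1 - y'" using as_root_flip[OF F alg y'(1) nF(2)] by blast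
  obtain \<rho>3 where \<rho>3: "\<rho>3 \<in> auts F" "\<rho>3 w = - 1 - w" using as_root_flip[OF F alg wF nF(3)] by blast
  have P1: "P True (\<rho>1 y' \<noteq> y')" using P_of[OF \<rho>1(1)] \<rho>1(2) ne(1) by simp
  have P2: "P (\<rho>2 y \<noteq> y) True" using P_of[OF \<rho>2(1)] \<rho>2(2) ne(2) by simp
  \<comment> \<open>Flipping both y and y' leaves w = y + y' + 2 y y' unchanged, just as flipping
    neither. Hence \<rho>3, which moves w, flips exactly one.\<close>
  have "(\<rho>3 y \<noteq> y) \<noteq> (\<rho>3 y' \<noteq> y')"
  proof
    assume *: "(\<rho>3 y \<noteq> y) = (\<rho>3 y' \<noteq> y')"
    have "\<rho>3 w = w"
    proof (cases "\<rho>3 y = y")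
      case True then show ?thesis using * hom[OF \<rho>3(1)] by (simp add: w_def)
    next
      case False
      then have "\<rho>3 y = - 1 - y" "\<rho>3 y' = - 1 - y'"
        using * as_root_auts(1)[OF \<rho>3(1) y(1)] as_root_auts(1)[OF \<rho>3(1) y'(1)] by auto
      then have "\<rho>3 w = (- 1 - y) + (- 1 - y') + 2 * (- 1 - y) * (- 1 - y')" using hom[OF \<rho>3(1)] by (simp only:)
      also have "\<dots> = w" by (simp add: w_def algebra_simps)
      finally show ?thesis .
    qed
    then show False using \<rho>3(2) ne(3) by simp
  qed
  then have P3: "P True False \<or> P False True" using P_of[OF \<rho>3(1)] by (cases "\<rho>3 y = y") auto
  have "P True False \<and> P False True"
    using P3 Pc[OF P1, of False True] Pc[OF P2, of True False] P1 P2
    by (cases "\<rho>1 y' = y'"; cases "\<rho>2 y = y") auto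
  moreover have "P False False" using P_of[OF auts_id] by simp
  moreover have "P True True" using Pc[of True False False True] calculation by simp
  ultimately have "P a b" by (cases a; cases b) auto
  then show ?thesis by (simp add: P_def)
qed

lemma as_root_sep_closure:
  fixes K :: "'b::alg_closed_field set"
  assumes K: "subfld K" and alg: "\<And>x. alg_over K x"
    and y: "y ^ 2 + y \<in> sep_closure K" "- 1 - y \<noteq> y"
  shows "y \<in> sep_closure K"
proof -
  note S = sep_closure_subfld[OF K alg] and R = subfld_subrng[OF sep_closure_subfld[OF K alg]]
  define A where "A = y ^ 2 + y"
  have "separable_over (sep_closure K) y"
  proof (rule separable_overI[OF S, of "[:- A, 1, 1:]"])
    have "A \<in> sep_closure K" using y(1) by (simp add: A_def)
    then show "[:- A, 1, 1:] \<in> polys_over (sep_closure K)"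
      using R by (simp add: polys_over_pCons_iff polys_over_0 subrng_1 subrng_uminus)
    show "poly [:- A, 1, 1:] y = 0" by (simp add: A_def algebra_simps power2_eq_square)
    show "rsquarefree [:- A, 1, 1:]" unfolding rsquarefree_iff
    proof (intro conjI allI notI)
      fix z assume z: "poly [:- A, 1, 1:] z = 0 \<and> poly (pderiv [:- A, 1, 1:]) z = 0"
      then have "y ^ 2 + y = z ^ 2 + z" by (simp add: A_def algebra_simps power2_eq_square eq_neg_iff_add_eq_0)
      then have zy: "z = y \<or> z = - 1 - y" by (rule as_root_cases)
      have "1 + 2 * z = 0" using z by (simp add: pderiv_pCons algebra_simps)
      moreover have "- 1 - z = z - (1 + 2 * z)" by simp
      ultimately have "- 1 - z = z" by (simp only: diff_zero)
      then show False using y(2) zy by auto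
    qed simp
  qed
  then show ?thesis by (rule separable_over_sep_closure[OF K alg])
qed

section \<open>The Galois group\<close>

lemma mem_gal_group:
  "s \<in> carrier (gal_group F N) \<longleftrightarrow> s \<in> extensional N \<and> bij_betw s N N \<and> s 1 = 1 \<and>
     (\<forall>x\<in>N. \<forall>y\<in>N. s (x + y) = s x + s y \<and> s (x * y) = s x * s y) \<and> (\<forall>x\<in>F. s x = x)"
  (is "?l \<longleftrightarrow> ?r")
proof
  show "?l \<Longrightarrow> ?r" by (auto simp: gal_group_def Bij_def ring_hom_def ring_of_type_algebra_def)
  assume ?r
  then show ?l by (auto simp: gal_group_def Bij_def ring_hom_def ring_of_type_algebra_def bij_betw_def)
qed

lemma gal_groupD:
  assumes "s \<in> carrier (gal_group F N)"
  shows "s \<in> extensional N" "bij_betw s N N" "s 1 = 1" "x \<in> F \<Longrightarrow> s x = x" "x \<in> N \<Longrightarrow> s x \<in> N"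
    "x \<in> N \<Longrightarrow> y \<in> N \<Longrightarrow> s (x + y) = s x + s y" "x \<in> N \<Longrightarrow> y \<in> N \<Longrightarrow> s (x * y) = s x * s y"
  using assms by (auto simp: mem_gal_group bij_betw_def)

text \<open>The product comes from \<open>BijGroup N\<close> and does not depend on the base field.
  Three unrelated base fields are allowed because cosets of Gal(N/L) are formed inside
  Gal(N/F).\<close>

lemma gal_group_mult:
  assumes "s \<in> carrier (gal_group F N)" "t \<in> carrier (gal_group E N)"
  shows "s \<otimes>\<^bsub>gal_group F' N\<^esub> t = (\<lambda>x\<in>N. s (t x))"
  using gal_groupD(1,2)[OF assms(1)] gal_groupD(1,2)[OF assms(2)]
  by (simp add: gal_group_def BijGroup_def Bij_def compose_def)

lemma gal_group_comp:
  assumes N: "subrng N" "F \<subseteq> N" and s: "s \<in> carrier (gal_group F N)" and t: "t \<in> carrier (gal_group F N)"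
  shows "(\<lambda>x\<in>N. s (t x)) \<in> carrier (gal_group F N)"
proof -
  note S = gal_groupD[OF s] and T = gal_groupD[OF t]
  have "bij_betw (\<lambda>x\<in>N. s (t x)) N N"
    using bij_betw_trans[OF T(2) S(2)] by (simp add: o_def cong: bij_betw_cong)
  then show ?thesis unfolding mem_gal_group
    using S T N by (auto simp: subrng_1 subrng_add subrng_mult subsetD)
qed

context
  fixes K :: "'b::alg_closed_field set"
  assumes K: "subfld K" and alg: "\<And>x. alg_over K x"
begin

lemma sep_closure_subrng: "subrng (sep_closure K)" by (rule subfld_subrng[OF sep_closure_subfld[OF K alg]])

lemma restrict_auts_gal:
  assumes \<rho>: "\<rho> \<in> auts K" shows "restrict \<rho> (sep_closure K) \<in> carrier (gal_group K (sep_closure K))"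
proof -
  note h = auts_hom[OF \<rho>]
  have "bij_betw \<rho> (sep_closure K) (sep_closure K)"
  proof (rule bij_betw_imageI)
    show "inj_on \<rho> (sep_closure K)" using auts_bij[OF \<rho>] by (meson bij_is_inj inj_on_subset subset_UNIV)
    have "x \<in> \<rho> ` (sep_closure K)" if x: "x \<in> sep_closure K" for x
    proof -
      have "inv_into UNIV \<rho> x \<in> sep_closure K" by (rule sep_closure_auts[OF K alg auts_inv[OF \<rho>] x])
      moreover have "\<rho> (inv_into UNIV \<rho> x) = x" using auts_bij[OF \<rho>] by (simp add: bij_is_surj surj_f_inv_f)
      ultimately show ?thesis by (metis imageI)
    qed
    then show "\<rho> ` (sep_closure K) = (sep_closure K)" using sep_closure_auts[OF K alg \<rho>] by auto
  qed
  then have "bij_betw (restrict \<rho> (sep_closure K)) (sep_closure K) (sep_closure K)" by (simp cong: bij_betw_cong)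
  then show ?thesis unfolding mem_gal_group using base_subset_sep_closure[OF K alg] sep_closure_subrng \<rho>
    by (auto simp: subrng_1 subrng_add subrng_mult rhom_1[OF h] rhom_add[OF h] rhom_mult[OF h] auts_fix)
qed

text \<open>The field generated over \<open>K\<close> by the roots of the minimal polynomial of
  \<open>y\<close>. Normality holds since every conjugate of an element arises by an automorphism,
  and automorphisms permute these roots.\<close>

lemma finite_galois_containing:
  assumes y: "y \<in> sep_closure K" shows "\<exists>L. finite_galois_subextension K (sep_closure K) L \<and> y \<in> L"
proof -
  obtain f where f: "is_min_poly K y f" "rsquarefree f" using y by (auto simp: sep_closure_def separable_over_def)
  note fD = is_min_polyD[OF f(1)]
  define Z where "Z = {z. poly f z = 0}"
  have "finite Z" using poly_roots_finite[OF fD(4)] by (simp add: Z_def)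
  then obtain zs where zs: "set zs = Z" using finite_list by blast
  define L where "L = fgen (K \<union> Z)"
  have L: "subfld L" "K \<subseteq> L" "Z \<subseteq> L" using fgen_subfld fgen_incl[of "K \<union> Z"] by (auto simp: L_def)
  have ZN: "Z \<subseteq> (sep_closure K)"
    using min_poly_other_root[OF K f(1)] f(2) by (auto simp: Z_def sep_closure_def separable_over_def)
  have LN: "L \<subseteq> (sep_closure K)" unfolding L_def
    using fgen_least[OF sep_closure_subfld[OF K alg]] ZN base_subset_sep_closure[OF K alg] by simp
  interpret RT: field "ring_of_type_algebra :: 'b ring" by (rule field_from_type_algebra)
  have Ksf: "subfield K ring_of_type_algebra" using K subfield_of_type_iff by blast
  have zc: "set zs \<subseteq> carrier ring_of_type_algebra" by (simp add: ring_of_type_algebra_simps)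
  have za: "(RT.algebraic over K) z" for z using alg alg_over_iff[OF K] by blast
  \<comment> \<open>The identification with the HOL-Algebra construction supplies the finite
    dimension.\<close>
  have "RT.finite_extension K zs = L"
  proof
    have "subring L ring_of_type_algebra" using L(1) subfield_of_type_iff subfieldE(1) by blast
    then show "RT.finite_extension K zs \<subseteq> L" using L zs by (intro RT.finite_extension_subring_incl) auto
    have "subfld (RT.finite_extension K zs)"
      using RT.finite_extension_is_subfield[OF Ksf zc za] subfield_of_type_iff by blast
    moreover have "K \<subseteq> RT.finite_extension K zs"
      by (rule RT.finite_extension_incl) (simp_all add: ring_of_type_algebra_simps)
    moreover have "Z \<subseteq> RT.finite_extension K zs"
      using RT.finite_extension_mem[OF subfieldE(1)[OF Ksf] zc] zs by simp
    ultimately show "L \<subseteq> RT.finite_extension K zs" unfolding L_def by (intro fgen_least) auto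
  qed
  then have dim: "RT.finite_dimension K L" using RT.finite_extension_finite_dimension(1)[OF Ksf zc za] by simp
  have "normal_extension K L" unfolding normal_extension_def
  proof
    fix x assume x: "x \<in> L"
    obtain p where p: "is_min_poly K x p" using min_poly_exists[OF K alg] by blast
    have "z \<in> L" if z: "poly p z = 0" for z
    proof -
      obtain \<rho> where \<rho>: "\<rho> \<in> auts K" "\<rho> x = z" using aut_conjugate[OF K alg p z] by blast
      have "\<rho> u \<in> fgen (K \<union> Z)" if u: "u \<in> K \<union> Z" for u
      proof (cases "u \<in> K")
        case True then show ?thesis using auts_fix[OF \<rho>(1)] L by (auto simp: L_def)
      next
        case False
        then have "poly f (\<rho> u) = \<rho> 0" using u
          poly_map_fixed[OF subfld_subrng[OF K] auts_hom[OF \<rho>(1)] auts_fix[OF \<rho>(1)] fD(1), of u] by (simp add: Z_def)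
        then have "\<rho> u \<in> Z" using rhom_0[OF subfld_subrng[OF subfld_UNIV] auts_hom[OF \<rho>(1)]] by (simp add: Z_def)
        then show ?thesis using L by (auto simp: L_def)
      qed
      from auts_fgen[OF K alg \<rho>(1) this] show ?thesis using x \<rho>(2) by (auto simp: L_def)
    qed
    then show "\<exists>p. is_min_poly K x p \<and> (\<forall>y. poly p y = 0 \<longrightarrow> y \<in> L)" using p by blast
  qed
  moreover have "separable_extension K L" using LN by (auto simp: separable_extension_def sep_closure_def)
  ultimately have "finite_galois_subextension K (sep_closure K) L"
    unfolding finite_galois_subextension_def galois_extension_def subfield_of_type_iff using K L LN dim by blast
  moreover have "y \<in> L" using L fD by (auto simp: Z_def)
  ultimately show ?thesis by blast
qed

text \<open>The value at \<open>y\<close> is constant on each coset of Gal(Ks/L) once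
  \<open>L\<close> contains \<open>y\<close>. So any condition on that value, whatever
  \<open>P\<close> is, defines a union of basic open sets.\<close>

lemma krull_open:
  assumes y: "y \<in> sep_closure K"
  shows "openin (krull_topology K (sep_closure K)) {s \<in> carrier (gal_group K (sep_closure K)). P (s y)}"
proof -
  let ?G = "gal_group K (sep_closure K)"
  obtain L where L: "finite_galois_subextension K (sep_closure K) L" "y \<in> L" using finite_galois_containing[OF y] by blast
  have KL: "K \<subseteq> L" using L by (auto simp: finite_galois_subextension_def galois_extension_def)
  have id: "(\<lambda>x\<in>(sep_closure K). x) \<in> carrier (gal_group L (sep_closure K))"
    using L sep_closure_subrng unfolding mem_gal_group by (auto simp: finite_galois_subextension_def bij_betw_def inj_on_def subrng_1 subrng_add subrng_mult)
  have coset: "openin (krull_topology K (sep_closure K)) (s <#\<^bsub>?G\<^esub> carrier (gal_group L (sep_closure K)))" if "s \<in> carrier ?G" for s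
    unfolding krull_topology_def by (rule topology_generated_by_Basis) (use that L in blast)
  have mem: "s \<in> s <#\<^bsub>?G\<^esub> carrier (gal_group L (sep_closure K))" if s: "s \<in> carrier ?G" for s
  proof -
    have "s \<otimes>\<^bsub>?G\<^esub> (\<lambda>x\<in>(sep_closure K). x) = s"
      unfolding gal_group_mult[OF s id] using gal_groupD(1)[OF s] by (auto simp: extensional_def)
    then show ?thesis using id unfolding l_coset_def by force
  qed
  have sub: "s <#\<^bsub>?G\<^esub> carrier (gal_group L (sep_closure K)) \<subseteq> {s \<in> carrier ?G. P (s y)}" if s: "s \<in> carrier ?G" "P (s y)" for s
  proof
    fix u assume "u \<in> s <#\<^bsub>?G\<^esub> carrier (gal_group L (sep_closure K))"
    then obtain t where t: "t \<in> carrier (gal_group L (sep_closure K))" "u = s \<otimes>\<^bsub>?G\<^esub> t" by (auto simp: l_coset_def)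
    have tK: "t \<in> carrier ?G" using t(1) KL by (auto simp: mem_gal_group)
    have u: "u = (\<lambda>x\<in>(sep_closure K). s (t x))" using t(2) gal_group_mult[OF s(1) t(1)] by simp
    then have "u \<in> carrier ?G" using gal_group_comp[OF sep_closure_subrng base_subset_sep_closure[OF K alg] s(1) tK] by simp
    moreover have "u y = s y" using u y gal_groupD(4)[OF t(1) L(2)] by simp
    ultimately show "u \<in> {s \<in> carrier ?G. P (s y)}" using s by simp
  qed
  have "{s \<in> carrier ?G. P (s y)} = (\<Union>s\<in>{s \<in> carrier ?G. P (s y)}. s <#\<^bsub>?G\<^esub> carrier (gal_group L (sep_closure K)))"
    using mem sub by blast
  then show ?thesis using coset by (metis (no_types, lifting) mem_Collect_eq openin_clauses(3) imageE)
qed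

lemma krull_topspace: "topspace (krull_topology K (sep_closure K)) = carrier (gal_group K (sep_closure K))"
proof
  have 0: "0 \<in> sep_closure K" by (rule subrng_0[OF sep_closure_subrng])
  show "carrier (gal_group K (sep_closure K)) \<subseteq> topspace (krull_topology K (sep_closure K))"
    using openin_subset[OF krull_open[OF 0, of "\<lambda>_. True"]] by simp
  show "topspace (krull_topology K (sep_closure K)) \<subseteq> carrier (gal_group K (sep_closure K))"
  proof
    fix u assume "u \<in> topspace (krull_topology K (sep_closure K))"
    then obtain s L t where *: "s \<in> carrier (gal_group K (sep_closure K))" "finite_galois_subextension K (sep_closure K) L"
      "t \<in> carrier (gal_group L (sep_closure K))" "u = s \<otimes>\<^bsub>gal_group K (sep_closure K)\<^esub> t"
      by (auto simp: krull_topology_def topology_generated_by_topspace l_coset_def)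
    then have "t \<in> carrier (gal_group K (sep_closure K))"
      by (auto simp: mem_gal_group finite_galois_subextension_def galois_extension_def)
    then show "u \<in> carrier (gal_group K (sep_closure K))"
      using gal_group_comp[OF sep_closure_subrng base_subset_sep_closure[OF K alg] *(1)] gal_group_mult[OF *(1,3)] *(4) by simp
  qed
qed

end

section \<open>The null set of a pair of conjugates\<close>

text \<open>A fixed choice between the two roots, depending on \<open>A\<close> alone and not on
  \<sigma>, so that each \<open>c\<close> yields one definite condition on \<sigma>.\<close>

definition as_root :: "'b::alg_closed_field \<Rightarrow> 'b" where
  "as_root A = (SOME z. z ^ 2 + z = A)"

lemma as_root: "as_root A ^ 2 + as_root A = A"
  unfolding as_root_def by (rule someI_ex) (rule as_root_exists)

locale galois_power =
  fixes K :: "'b::alg_closed_field set" and e :: nat and M :: "(nat \<Rightarrow> 'b \<Rightarrow> 'b) measure"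
  assumes K: "subfld K" and alg: "\<And>x. alg_over K x" and fin_gen: "\<exists>S. finite S \<and> K = fgen S"
    and e: "e \<ge> 1"
    and haar: "normalized_haar_measure (product_group {..<e} (\<lambda>_. gal_group K (sep_closure K)))
       (product_topology (\<lambda>_. krull_topology K (sep_closure K)) {..<e}) M"
begin

abbreviation (input) "Ks \<equiv> sep_closure K"
abbreviation (input) "G \<equiv> gal_group K (sep_closure K)"
abbreviation (input) "Ge \<equiv> product_group {..<e} (\<lambda>_. gal_group K (sep_closure K))"

section \<open>Measurability and translation invariance\<close>

lemma M_prob: "prob_space M" using haar by (simp add: normalized_haar_measure_def)

lemma Ks_subfld: "subfld Ks" by (rule sep_closure_subfld[OF K alg])

lemma space_M: "space M = PiE {..<e} (\<lambda>_. carrier G)"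
  using haar by (simp add: normalized_haar_measure_def topspace_product_topology krull_topspace[OF K alg])

lemma measurable_coordinate:
  assumes "i < e" "y \<in> Ks" shows "{\<sigma> \<in> space M. P (\<sigma> i y)} \<in> sets M"
proof -
  let ?T = "product_topology (\<lambda>_. krull_topology K Ks) {..<e}"
  have "continuous_map ?T (krull_topology K Ks) (\<lambda>\<sigma>. \<sigma> i)"
    using continuous_map_product_projection[of i "{..<e}" "\<lambda>_. krull_topology K Ks"] assms by simp
  then have "openin ?T {\<sigma> \<in> topspace ?T. \<sigma> i \<in> {s \<in> carrier G. P (s y)}}"
    by (rule openin_continuous_map_preimage) (rule krull_open[OF K alg assms(2)])
  also have "{\<sigma> \<in> topspace ?T. \<sigma> i \<in> {s \<in> carrier G. P (s y)}} = {\<sigma> \<in> space M. P (\<sigma> i y)}"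
    using assms by (auto simp: space_M topspace_product_topology krull_topspace[OF K alg])
  finally show ?thesis using haar by (auto simp: normalized_haar_measure_def intro: sigma_sets.Basic)
qed

lemma translate:
  assumes "a \<in> carrier Ge" "A \<in> sets M"
  shows "a <#\<^bsub>Ge\<^esub> A \<in> sets M" "measure M (a <#\<^bsub>Ge\<^esub> A) = measure M A"
  using haar assms by (auto simp: normalized_haar_measure_def measure_def)

lemma spaceD: "\<sigma> \<in> space M \<Longrightarrow> i < e \<Longrightarrow> \<sigma> i \<in> carrier G"
  by (auto simp: space_M)

section \<open>A fixed pair of conjugates\<close>

context
  fixes x x' t :: 'b
  assumes xs: "x \<in> Ks" "x' \<in> Ks" "t \<in> Ks" "x \<noteq> 0" "x' \<noteq> 0" "x \<noteq> x'" and t: "admissible t"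
begin

text \<open>For \<sigma> in the group and both roots in \<open>Ks\<close>, this says that the fixed
  field of \<sigma> contains the root attached to x but not the one attached to x', which
  contradicts normality over a subfield containing \<open>c\<close>.\<close>

definition good :: "'b \<Rightarrow> (nat \<Rightarrow> 'b \<Rightarrow> 'b) \<Rightarrow> bool" where
  "good c \<sigma> \<longleftrightarrow> (\<forall>i<e. \<sigma> i (as_root (c * x)) = as_root (c * x)) \<and>
     (\<exists>i<e. \<sigma> i (as_root (c * x')) \<noteq> as_root (c * x'))"

text \<open>Fixing \<open>t\<close> belongs to the condition because it makes \<sigma> fix the whole
  of \<open>base_ring t\<close>, so that roots are mapped to roots of the same equation.\<close>

definition bad :: "'b set \<Rightarrow> (nat \<Rightarrow> 'b \<Rightarrow> 'b) set" where
  "bad C = {\<sigma> \<in> space M. (\<forall>i<e. \<sigma> i x = x \<and> \<sigma> i x' = x' \<and> \<sigma> i t = t) \<and> (\<forall>c\<in>C. \<not> good c \<sigma>)}"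

text \<open>Group elements are undefined outside of \<open>Ks\<close>, so measurability is available
  only for roots inside it.\<close>

definition coeffs_ok :: "'b set" where
  "coeffs_ok = {c \<in> base_ring t. as_root (c * x) \<in> Ks \<and> as_root (c * x') \<in> Ks}"

lemma measurable_good:
  assumes "c \<in> coeffs_ok" shows "{\<sigma> \<in> space M. good c \<sigma>} \<in> sets M"
proof -
  have "{\<sigma> \<in> space M. good c \<sigma>} =
      {\<sigma> \<in> space M. \<forall>i\<in>{..<e}. \<sigma> i (as_root (c * x)) = as_root (c * x)} \<inter>
      (\<Union>i<e. {\<sigma> \<in> space M. \<sigma> i (as_root (c * x')) \<noteq> as_root (c * x')})"
    by (auto simp: good_def)
  moreover have "{\<sigma> \<in> space M. \<forall>i\<in>{..<e}. \<sigma> i (as_root (c * x)) = as_root (c * x)} \<in> sets M"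
    using assms e by (intro sets.sets_Collect_finite_All' measurable_coordinate) (auto simp: coeffs_ok_def lessThan_empty_iff)
  moreover have "(\<Union>i<e. {\<sigma> \<in> space M. \<sigma> i (as_root (c * x')) \<noteq> as_root (c * x')}) \<in> sets M"
    using assms by (intro sets.finite_UN measurable_coordinate) (auto simp: coeffs_ok_def)
  ultimately show ?thesis by simp
qed

lemma measurable_bad:
  assumes C: "finite C" "C \<subseteq> coeffs_ok" shows "bad C \<in> sets M"
  using C
proof (induction C)
  case empty
  have "bad {} = {\<sigma> \<in> space M. \<forall>i\<in>{..<e}. \<sigma> i x = x} \<inter> {\<sigma> \<in> space M. \<forall>i\<in>{..<e}. \<sigma> i x' = x'} \<inter>
      {\<sigma> \<in> space M. \<forall>i\<in>{..<e}. \<sigma> i t = t}" by (auto simp: bad_def)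
  then show ?case using xs e
    by (auto simp: lessThan_empty_iff intro!: sets.Int sets.sets_Collect_finite_All' measurable_coordinate)
next
  case (insert c C)
  have "bad (insert c C) = bad C - {\<sigma> \<in> space M. good c \<sigma>}" by (auto simp: bad_def)
  then show ?case using insert measurable_good[of c] by simp
qed

lemma gal_as_root:
  assumes "s \<in> carrier G" "A \<in> Ks" "s A = A" "z \<in> Ks" "z ^ 2 + z = A" shows "s z = z \<or> s z = - 1 - z"
proof -
  have "s (z * z + z) = s z * s z + s z"
    using gal_groupD[OF assms(1)] assms(4) subrng_mult[OF subfld_subrng[OF Ks_subfld]] by simp
  then show ?thesis using assms by (intro as_root_cases) (simp add: power2_eq_square)
qed

lemma base_ring_fixed:
  assumes s: "s \<in> carrier G" "s t = t" and c: "c \<in> base_ring t" shows "c \<in> Ks" "s c = c"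
proof -
  note R = subfld_subrng[OF Ks_subfld] and S = gal_groupD[OF s(1)]
  have "subrng {z \<in> Ks. s z = z}"
  proof -
    have K0: "0 \<in> K" by (rule subrng_0[OF subfld_subrng[OF K]])
    have "s (- z) = - z" if "z \<in> Ks" "s z = z" for z
    proof -
      have "s (- z + z) = s (- z) + s z" using S(6)[of "- z" z] that subrng_uminus[OF R] by blast
      then show ?thesis using S(4)[OF K0] that by (simp add: eq_neg_iff_add_eq_0)
    qed
    then show ?thesis unfolding subrng_def using S(3) S(4)[OF K0] S(6,7) R
      by (auto simp: subrng_0 subrng_1 subrng_add subrng_mult subrng_uminus)
  qed
  from base_ring_subset[OF this, of t] show "c \<in> Ks" "s c = c" using s xs c by auto
qed

text \<open>Let B be the part of \<open>bad C\<close> on which the new \<open>c\<close> is good.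
  Each \<sigma> in \<open>bad C\<close> becomes an element of B after suitable flips of y and y' in
  every coordinate, so 4^e left translates of B cover \<open>bad C\<close>, and B has at least the
  fraction 4^(-e) of its measure.\<close>

lemma bad_step:
  assumes C: "finite C" "C \<subseteq> coeffs_ok"
  shows "\<exists>c\<in>coeffs_ok. measure M (bad (insert c C)) \<le> (1 - (1 / 4) ^ e) * measure M (bad C)"
proof -
  interpret prob_space M by (rule M_prob)
  obtain S0 where S0: "finite S0" "K = fgen S0" using fin_gen by blast
  \<comment> \<open>The field F generated by \<open>S\<close> contains \<open>K\<close>, the ring
    \<open>base_ring t\<close> and all roots adjoined for earlier coefficients; automorphisms over F
    thus leave the earlier conditions untouched.\<close>
  define S where "S = S0 \<union> {x, x', t} \<union> (\<lambda>c. as_root (c * x)) ` C \<union> (\<lambda>c. as_root (c * x')) ` C"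
  define F where "F = fgen S"
  have "finite S" using S0 C by (simp add: S_def)
  have SF: "S \<subseteq> F" unfolding F_def by (rule fgen_incl)
  have F: "subfld F" unfolding F_def by (rule fgen_subfld)
  have KF: "K \<subseteq> F" unfolding S0(2) F_def by (rule fgen_mono) (auto simp: S_def)
  have algF: "alg_over F z" for z by (rule alg_over_mono[OF alg KF])
  have xF: "x \<in> F" "x' \<in> F" "t \<in> F" using SF by (auto simp: S_def)
  obtain c where c: "c \<in> base_ring t" "c * x \<notin> as_image F" "c * x' \<notin> as_image F"
    "c * x + c * x' + 4 * (c * x) * (c * x') \<notin> as_image F"
    using exists_generic_multiple_base_ring[OF t \<open>finite S\<close>, of x x'] xF xs by (auto simp: F_def)
  define y where "y = as_root (c * x)"
  define y' where "y' = as_root (c * x')"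
  have y: "y ^ 2 + y = c * x" "y' ^ 2 + y' = c * x'" by (simp_all add: y_def y'_def as_root)
  have cF: "c \<in> F" using base_ring_subset[OF subfld_subrng[OF F] xF(3)] c by auto
  have cxF: "c * x \<in> F" "c * x' \<in> F" using subrng_mult[OF subfld_subrng[OF F] cF] xF by blast+
  have cKs: "c \<in> Ks" using base_ring_subset[OF subfld_subrng[OF Ks_subfld] xs(3)] c by auto
  have cx: "c * x \<in> Ks" "c * x' \<in> Ks" using subrng_mult[OF subfld_subrng[OF Ks_subfld] cKs] xs by blast+
  have "z ^ 2 + z \<in> as_image F" if "z \<in> F" for z using that by (auto simp: as_image_def)
  then have nF: "y \<notin> F" "y' \<notin> F" using c(2,3) y by metis+
  have ne: "- 1 - y \<noteq> y" "- 1 - y' \<noteq> y'" using as_root_neq_conj[OF F nF(1)] as_root_neq_conj[OF F nF(2)] by simp_all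
  have yKs: "y \<in> Ks" "y' \<in> Ks"
    using as_root_sep_closure[OF K alg, of y] as_root_sep_closure[OF K alg, of y'] cx ne unfolding y by simp_all
  then have cok: "c \<in> coeffs_ok" using c by (simp add: coeffs_ok_def y_def y'_def)
  have flips: "\<exists>\<rho>\<in>auts F. \<rho> y = (if a then - 1 - y else y) \<and> \<rho> y' = (if b then - 1 - y' else y')" for a b
    by (rule independent_flips[OF F algF]) (use c y cxF in auto)
  \<comment> \<open>\<open>R p\<close> fixes F and realizes the flips prescribed by
    \<open>p\<close>: its first component concerns y, its second y'.\<close>
  define R where "R p = (SOME \<rho>. \<rho> \<in> auts F \<and> \<rho> y = (if fst p then - 1 - y else y) \<and> \<rho> y' = (if snd p then - 1 - y' else y'))" for p
  have R: "R p \<in> auts F" "R p y = (if fst p then - 1 - y else y)" "R p y' = (if snd p then - 1 - y' else y')" for p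
  proof -
    have "\<exists>\<rho>. \<rho> \<in> auts F \<and> \<rho> y = (if fst p then - 1 - y else y) \<and> \<rho> y' = (if snd p then - 1 - y' else y')"
      using flips[of "fst p" "snd p"] by blast
    from someI_ex[OF this, folded R_def]
    have "R p \<in> auts F \<and> R p y = (if fst p then - 1 - y else y) \<and> R p y' = (if snd p then - 1 - y' else y')" .
    then show "R p \<in> auts F" "R p y = (if fst p then - 1 - y else y)" "R p y' = (if snd p then - 1 - y' else y')" by auto
  qed
  define Ri where "Ri p = inv_into UNIV (R p)" for p
  have RK: "R p \<in> auts K" "Ri p \<in> auts K" for p using R(1)[of p] auts_mono[OF KF] auts_inv unfolding Ri_def by blast+
  have RiR: "Ri p (R p z) = z" for p z
    using auts_bij[OF R(1)[of p]] by (simp add: Ri_def bij_is_inj)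
  define \<E> where "\<E> = PiE {..<e} (\<lambda>_. UNIV :: (bool \<times> bool) set)"
  have card\<E>: "finite \<E>" "card \<E> = 4 ^ e"
    by (auto simp: \<E>_def card_PiE finite_PiE simp flip: UNIV_Times_UNIV)
  define a where "a \<epsilon> = (\<lambda>i\<in>{..<e}. restrict (Ri (\<epsilon> i)) Ks)" for \<epsilon>
  have aG: "a \<epsilon> \<in> carrier Ge" for \<epsilon>
    using restrict_auts_gal[OF K alg RK(2)] by (auto simp: a_def product_group_def)
  define B where "B = bad C \<inter> {\<sigma> \<in> space M. good c \<sigma>}"
  have mb: "bad C \<in> sets M" by (rule measurable_bad[OF C])
  have mB: "B \<in> sets M" unfolding B_def using mb measurable_good[OF cok] by blast
  have cover: "bad C \<subseteq> (\<Union>\<epsilon>\<in>\<E>. a \<epsilon> <#\<^bsub>Ge\<^esub> B)"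
  proof
    fix \<sigma> assume \<sigma>: "\<sigma> \<in> bad C"
    then have \<sigma>M: "\<sigma> \<in> space M" and fx: "\<And>i. i < e \<Longrightarrow> \<sigma> i x = x \<and> \<sigma> i x' = x' \<and> \<sigma> i t = t"
      and ng: "\<And>c. c \<in> C \<Longrightarrow> \<not> good c \<sigma>" by (auto simp: bad_def)
    note \<sigma>G = spaceD[OF \<sigma>M]
    have root: "\<sigma> i z = z \<or> \<sigma> i z = - 1 - z"
      if i: "i < e" and d: "d \<in> base_ring t" and u: "u = x \<or> u = x'" and z: "z \<in> Ks" "z ^ 2 + z = d * u" for i d u z
    proof -
      have u': "u \<in> Ks" "\<sigma> i u = u" using u xs fx[OF i] by auto
      have d': "d \<in> Ks" "\<sigma> i d = d" using base_ring_fixed[OF \<sigma>G[OF i] _ d] fx[OF i] by auto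
      have "\<sigma> i (d * u) = d * u" using gal_groupD(7)[OF \<sigma>G[OF i] d'(1) u'(1)] d' u' by simp
      then show ?thesis using gal_as_root[OF \<sigma>G[OF i] _ _ z] d' u' subrng_mult[OF subfld_subrng[OF Ks_subfld]] by simp
    qed
    \<comment> \<open>Flip y exactly where \<sigma> moves it, and y' exactly where \<sigma> fixes
      it. Afterwards y is fixed and y' is moved in every coordinate.\<close>
    define \<epsilon> where "\<epsilon> = (\<lambda>i\<in>{..<e}. (\<sigma> i y \<noteq> y, \<sigma> i y' = y'))"
    define \<tau> where "\<tau> = (\<lambda>i\<in>{..<e}. \<lambda>z\<in>Ks. R (\<epsilon> i) (\<sigma> i z))"
    have \<tau>: "\<tau> i z = R (\<epsilon> i) (\<sigma> i z)" if "i < e" "z \<in> Ks" for i z using that by (simp add: \<tau>_def)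
    have "\<tau> i \<in> carrier G" if i: "i < e" for i
    proof -
      have "\<tau> i = (\<lambda>z\<in>Ks. restrict (R (\<epsilon> i)) Ks (\<sigma> i z))"
        using i gal_groupD(5)[OF \<sigma>G[OF i]] by (auto simp: \<tau>_def restrict_def)
      then show ?thesis
        using gal_group_comp[OF sep_closure_subrng[OF K alg] base_subset_sep_closure[OF K alg] restrict_auts_gal[OF K alg RK(1)] \<sigma>G[OF i]]
        by simp
    qed
    then have \<tau>M: "\<tau> \<in> space M" by (auto simp: space_M \<tau>_def)
    \<comment> \<open>Agreement only requires the value \<sigma> i z to lie in F. This covers the
      earlier roots, which \<sigma> may interchange with their conjugates -1 - z in F.\<close>
    have "\<tau> i z = \<sigma> i z" if i: "i < e" and z: "z \<in> Ks" and s: "\<sigma> i z \<in> F" for i z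
      using \<tau>[OF i z] auts_fix[OF R(1) s] by simp
    note same = this
    have fx\<tau>: "\<tau> i x = x \<and> \<tau> i x' = x' \<and> \<tau> i t = t" if i: "i < e" for i
      using same[OF i] fx[OF i] xs xF by simp
    have "\<not> good d \<tau>" if d: "d \<in> C" for d
    proof -
      have dok: "d \<in> base_ring t" "as_root (d * x) \<in> Ks" "as_root (d * x') \<in> Ks" using C d by (auto simp: coeffs_ok_def)
      have "\<tau> i (as_root (d * u)) = \<sigma> i (as_root (d * u))" if i: "i < e" and u: "u = x \<or> u = x'" for i u
      proof (rule same[OF i])
        show Kd: "as_root (d * u) \<in> Ks" using u dok by auto
        have "as_root (d * u) \<in> F" using SF d u by (auto simp: S_def)
        then show "\<sigma> i (as_root (d * u)) \<in> F"
          using root[OF i dok(1) u Kd as_root] subfld_intros(2,5,6)[OF F] by metis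
      qed
      then show ?thesis using ng[OF d] by (simp add: good_def)
    qed
    moreover have "good c \<tau>" unfolding good_def y_def[symmetric] y'_def[symmetric]
    \<comment> \<open>Coordinate 0 witnesses that y' is moved; it exists because e is
      positive.\<close>
    proof (intro conjI allI impI exI[of _ 0])
      fix i assume i: "i < e"
      have fl: "R (\<epsilon> i) (- 1 - y) = - 1 - R (\<epsilon> i) y" by (rule as_root_auts(2)[OF R(1)]) (simp add: y cxF)
      show "\<tau> i y = y"
        using root[OF i c(1) _ yKs(1) y(1)] \<tau>[OF i yKs(1)] fl R(2)[of "\<epsilon> i"] i by (auto simp: \<epsilon>_def)
    next
      show i: "0 < e" using e by simp
      have fl: "R (\<epsilon> 0) (- 1 - y') = - 1 - R (\<epsilon> 0) y'" by (rule as_root_auts(2)[OF R(1)]) (simp add: y cxF)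
      show "\<tau> 0 y' \<noteq> y'"
        using root[OF i c(1) _ yKs(2) y(2)] \<tau>[OF i yKs(2)] fl R(3)[of "\<epsilon> 0"] i ne(2) by (auto simp: \<epsilon>_def)
    qed
    ultimately have \<tau>B: "\<tau> \<in> B" using \<tau>M fx\<tau> by (auto simp: B_def bad_def)
    \<comment> \<open>\<tau> arises from \<sigma> by composing with \<open>R\<close> on the left, so
      \<sigma> is recovered by a left translation with the inverses.\<close>
    have "\<sigma> = a \<epsilon> \<otimes>\<^bsub>Ge\<^esub> \<tau>"
    proof
      fix i
      show "\<sigma> i = (a \<epsilon> \<otimes>\<^bsub>Ge\<^esub> \<tau>) i"
      proof (cases "i < e")
        case True
        have "\<sigma> i = (\<lambda>z\<in>Ks. restrict (Ri (\<epsilon> i)) Ks (\<tau> i z))"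
        proof
          fix z show "\<sigma> i z = (\<lambda>z\<in>Ks. restrict (Ri (\<epsilon> i)) Ks (\<tau> i z)) z"
          proof (cases "z \<in> Ks")
            case z: True
            have "\<tau> i z \<in> Ks" by (rule gal_groupD(5)[OF spaceD[OF \<tau>M True] z])
            then show ?thesis using z \<tau>[OF True z] RiR by simp
          next
            case False
            then show ?thesis using gal_groupD(1)[OF \<sigma>G[OF True]] by (simp add: extensional_def)
          qed
        qed
        then show ?thesis
          using gal_group_mult[OF restrict_auts_gal[OF K alg RK(2)] spaceD[OF \<tau>M True]] True
          by (simp add: product_group_def a_def)
      next
        case False
        then show ?thesis using \<sigma>M by (auto simp: product_group_def space_M PiE_def extensional_def)
      qed
    qed
    moreover have "\<epsilon> \<in> \<E>" by (simp add: \<epsilon>_def \<E>_def)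
    ultimately show "\<sigma> \<in> (\<Union>\<epsilon>\<in>\<E>. a \<epsilon> <#\<^bsub>Ge\<^esub> B)" using \<tau>B by (auto simp: l_coset_def)
  qed
  have "measure M (bad C) \<le> measure M (\<Union>\<epsilon>\<in>\<E>. a \<epsilon> <#\<^bsub>Ge\<^esub> B)"
    by (rule finite_measure_mono[OF cover]) (intro sets.finite_UN card\<E> translate aG mB)
  also have "\<dots> \<le> (\<Sum>\<epsilon>\<in>\<E>. measure M (a \<epsilon> <#\<^bsub>Ge\<^esub> B))"
    by (rule finite_measure_subadditive_finite[OF card\<E>(1)]) (use translate(1)[OF aG mB] in blast)
  also have "\<dots> = 4 ^ e * measure M B" using card\<E>(2) by (simp add: translate(2)[OF aG mB])
  finally have le: "(1 / 4) ^ e * measure M (bad C) \<le> measure M B" by (simp add: field_simps power_divide)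
  have "bad (insert c C) = bad C - B" by (auto simp: bad_def B_def)
  then have "measure M (bad (insert c C)) = measure M (bad C) - measure M B"
    using finite_measure_Diff[OF mb mB] by (simp add: B_def)
  then show ?thesis using le cok by (intro bexI[of _ c]) (simp_all add: algebra_simps)
qed

text \<open>Iterating \<open>bad_step\<close> yields finite sets C whose bad sets have measure at
  most r^n with r < 1. The exceptional \<sigma> lie in all of these bad sets, whose intersection is
  null.\<close>

lemma AE_good:
  "AE \<sigma> in M. (\<forall>i<e. \<sigma> i x = x \<and> \<sigma> i x' = x' \<and> \<sigma> i t = t) \<longrightarrow> (\<exists>c\<in>coeffs_ok. good c \<sigma>)"
proof -
  interpret prob_space M by (rule M_prob)
  define r :: real where "r = 1 - (1 / 4) ^ e"
  have r: "0 \<le> r" "r < 1" by (simp_all add: r_def power_le_one)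
  have ex: "\<exists>C. finite C \<and> C \<subseteq> coeffs_ok \<and> measure M (bad C) \<le> r ^ n" for n
  proof (induction n)
    case 0 then show ?case by (intro exI[of _ "{}"]) simp
  next
    case (Suc n)
    then obtain C where C: "finite C" "C \<subseteq> coeffs_ok" "measure M (bad C) \<le> r ^ n" by blast
    obtain c where c: "c \<in> coeffs_ok" "measure M (bad (insert c C)) \<le> r * measure M (bad C)"
      using bad_step[OF C(1,2)] by (auto simp: r_def)
    have "r * measure M (bad C) \<le> r ^ Suc n" using C(3) r by (simp add: mult_left_mono)
    then show ?case using c C by (intro exI[of _ "insert c C"]) auto
  qed
  then obtain C where C: "\<And>n. finite (C n)" "\<And>n. C n \<subseteq> coeffs_ok" "\<And>n. measure M (bad (C n)) \<le> r ^ n" by metis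
  define Z where "Z = (\<Inter>n. bad (C n))"
  have Z: "Z \<in> sets M" unfolding Z_def using measurable_bad[OF C(1,2)] by blast
  have "measure M Z \<le> r ^ n" for n
  proof -
    have "measure M Z \<le> measure M (bad (C n))"
      by (rule finite_measure_mono) (auto simp: Z_def measurable_bad[OF C(1,2)])
    then show ?thesis using C(3)[of n] by simp
  qed
  moreover have "(\<lambda>n. r ^ n) \<longlonglongrightarrow> 0" using r by (intro LIMSEQ_realpow_zero)
  ultimately have "measure M Z \<le> 0" by (intro LIMSEQ_le_const[of "\<lambda>n. r ^ n"]) auto
  then have "emeasure M Z = 0" by (simp add: emeasure_eq_measure measure_le_0_iff)
  then have "Z \<in> null_sets M" using Z by (simp add: null_sets_def)
  then have "AE \<sigma> in M. \<sigma> \<notin> Z" by (rule AE_not_in)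
  moreover have elim: "\<exists>c\<in>coeffs_ok. good c \<sigma>"
    if \<sigma>: "\<sigma> \<notin> Z" "\<sigma> \<in> space M" "\<forall>i<e. \<sigma> i x = x \<and> \<sigma> i x' = x' \<and> \<sigma> i t = t" for \<sigma>
  proof -
    from \<sigma>(1) obtain n where "\<sigma> \<notin> bad (C n)" unfolding Z_def by blast
    then obtain c where "c \<in> C n" "good c \<sigma>" using \<sigma>(2,3) unfolding bad_def by blast
    then show ?thesis using C(2) by blast
  qed
  ultimately show ?thesis using AE_space by eventually_elim (use elim in blast)
qed

end

end

section \<open>Countability\<close>

text \<open>Countably many rounds of closing under the field operations suffice, since any two
  elements appear together in some round.\<close>

lemma countable_fgen:
  assumes "countable S" shows "countable (fgen S)"
proof -
  define step where "step A = A \<union> (\<lambda>(x, y). x + y) ` (A \<times> A) \<union> (\<lambda>(x, y). x * y) ` (A \<times> A) \<union> uminus ` A \<union> inverse ` A"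
    for A :: "'a set"
  define B where "B n = (step ^^ n) (insert 0 (insert 1 S))" for n
  have BS: "B (Suc n) = step (B n)" for n by (simp add: B_def)
  have cB: "countable (B n)" for n
    by (induction n) (use assms in \<open>auto simp: B_def step_def intro!: countable_Un countable_SIGMA\<close>)
  have mono: "B m \<subseteq> B n" if "m \<le> n" for m n
    by (rule lift_Suc_mono_le[OF _ that]) (auto simp: BS step_def)
  have two: "\<exists>n. x \<in> B n \<and> y \<in> B n" if "x \<in> (\<Union>n. B n)" "y \<in> (\<Union>n. B n)" for x y
  proof -
    from that obtain m n where "x \<in> B m" "y \<in> B n" by auto
    then have "x \<in> B (max m n)" "y \<in> B (max m n)" using mono[of m "max m n"] mono[of n "max m n"] by auto
    then show ?thesis by blast
  qed
  have "subfld (\<Union>n. B n)" unfolding subfld_def subrng_def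
  proof (intro conjI ballI)
    have "0 \<in> B 0" "1 \<in> B 0" by (auto simp: B_def)
    then show "0 \<in> (\<Union>n. B n)" "1 \<in> (\<Union>n. B n)" by blast+
    fix x assume x: "x \<in> (\<Union>n. B n)"
    then obtain n where "x \<in> B n" by blast
    then have "- x \<in> B (Suc n)" "inverse x \<in> B (Suc n)" by (auto simp: BS step_def)
    then show "- x \<in> (\<Union>n. B n)" "inverse x \<in> (\<Union>n. B n)" by blast+
    fix y assume "y \<in> (\<Union>n. B n)"
    from two[OF x this] obtain k where "x \<in> B k" "y \<in> B k" by blast
    then have "x + y \<in> B (Suc k)" "x * y \<in> B (Suc k)" unfolding BS step_def by force+
    then show "x + y \<in> (\<Union>n. B n)" "x * y \<in> (\<Union>n. B n)" by blast+
  qed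
  moreover have "S \<subseteq> B 0" by (auto simp: B_def)
  then have "S \<subseteq> (\<Union>n. B n)" by blast
  ultimately have "fgen S \<subseteq> (\<Union>n. B n)" by (rule fgen_least)
  moreover have "countable (\<Union>n. B n)" using cB by simp
  ultimately show ?thesis by (rule countable_subset)
qed

lemma countable_alg_closure:
  assumes "countable (UNIV :: 'a::field set)" shows "countable (UNIV :: 'a alg_closure set)"
proof -
  have "(UNIV :: 'a poly set) \<subseteq> Poly ` lists UNIV" using Poly_coeffs by (metis UNIV_I image_eqI lists_UNIV subsetI)
  then have cp: "countable (UNIV :: 'a poly set)" using assms by (meson countable_image countable_lists countable_subset)
  have "countable (\<Union>p\<in>{p :: 'a poly. p \<noteq> 0}. {z. poly (map_poly to_ac p) z = 0})"
  proof (rule countable_UN)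
    show "countable {p :: 'a poly. p \<noteq> 0}" by (rule countable_subset[OF subset_UNIV cp])
    fix p :: "'a poly" assume "p \<in> {p. p \<noteq> 0}"
    then have "map_poly to_ac p \<noteq> 0" by (simp add: map_poly_eq_0_iff)
    then show "countable {z. poly (map_poly to_ac p) z = 0}" by (intro countable_finite poly_roots_finite)
  qed
  moreover have "(UNIV :: 'a alg_closure set) \<subseteq> (\<Union>p\<in>{p :: 'a poly. p \<noteq> 0}. {z. poly (map_poly to_ac p) z = 0})"
    using alg_closure_algebraic by blast
  ultimately show ?thesis by (rule countable_subset[rotated])
qed

section \<open>The base field in its algebraic closure\<close>

lemma generate_field_UNIV:
  assumes "generate_field (ring_of_type_algebra :: 'a::field ring) S = UNIV" shows "fgen S = UNIV"
proof -
  note F = subfld_intros[OF fgen_subfld[of S]]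
  have "x \<in> fgen S" if "x \<in> generate_field (ring_of_type_algebra :: 'a ring) S" for x
    using that
  proof induction
    case (incl h) then show ?case using fgen_incl[of S] by blast
  next
    case (m_inv h)
    then show ?case using F by (simp add: ring_of_type_algebra_simps ring_of_type_algebra_m_inv)
  qed (use F in \<open>auto simp: ring_of_type_algebra_simps ring_of_type_algebra_a_inv\<close>)
  then show ?thesis using assms by auto
qed

lemma base_field_subfld: "subfld (base_field :: 'a::field alg_closure set)"
proof -
  have "0 = to_ac (0 :: 'a)" "1 = to_ac (1 :: 'a)" by simp_all
  then show ?thesis unfolding subfld_def subrng_def base_field_def
    by (auto simp flip: to_ac_add to_ac_mult to_ac_minus to_ac_inverse)
qed

lemma base_field_fgen:
  assumes "fgen S = (UNIV :: 'a::field set)" shows "base_field = fgen (to_ac ` S)"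
proof
  note F = subfld_intros[OF fgen_subfld[of "to_ac ` S"]]
  have "subfld {x :: 'a. to_ac x \<in> fgen (to_ac ` S)}"
    unfolding subfld_def subrng_def using F by auto
  then have "fgen S \<subseteq> {x. to_ac x \<in> fgen (to_ac ` S)}" using fgen_incl[of "to_ac ` S"] by (intro fgen_least) auto
  then show "base_field \<subseteq> fgen (to_ac ` S)" using assms by (auto simp: base_field_def)
  show "fgen (to_ac ` S) \<subseteq> base_field" by (rule fgen_least[OF base_field_subfld]) (auto simp: base_field_def)
qed

theorem theorem7p10:
  fixes e :: nat
    and M :: "(nat \<Rightarrow> 'a::field alg_closure \<Rightarrow> 'a alg_closure) measure"
  assumes "infinite (UNIV :: 'a set)"
    and "fin_gen_over_prime_field TYPE('a)"
    and "e \<ge> 1"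
    and "normalized_haar_measure (abs_gal_power e) (abs_gal_power_topology e) M"
  shows "AE \<sigma> in M. \<not> (\<exists>E. E \<subset> fixed_field e \<sigma> \<and> galois_extension E (fixed_field e \<sigma>))"
proof -
  let ?K = "base_field :: 'a alg_closure set"
  obtain S where S: "finite S" "fgen S = (UNIV :: 'a set)"
    using assms(2) generate_field_UNIV unfolding fin_gen_over_prime_field_def by blast
  have KS: "?K = fgen (to_ac ` S)" by (rule base_field_fgen[OF S(2)])
  have alg: "alg_over ?K x" for x
  proof -
    obtain p :: "'a poly" where "p \<noteq> 0" "poly (map_poly to_ac p) x = 0" using alg_closure_algebraic[of x] by blast
    then show ?thesis unfolding alg_over_def
      by (intro bexI[of _ "map_poly to_ac p"]) (auto simp: map_poly_eq_0_iff polys_over_def coeff_map_poly base_field_def)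
  qed
  interpret GP: galois_power ?K e M
  proof
    show "\<exists>T. finite T \<and> ?K = fgen T" using KS S(1) by blast
    show "normalized_haar_measure (product_group {..<e} (\<lambda>_. gal_group ?K (sep_closure ?K)))
       (product_topology (\<lambda>_. krull_topology ?K (sep_closure ?K)) {..<e}) M"
      using assms(4) unfolding abs_gal_power_def abs_gal_power_topology_def sep_closure_field_def .
  qed (use base_field_subfld alg assms(3) in auto)
  \<comment> \<open>Indexing by \<open>t\<close> instead of by the subfield leaves countably many
    null sets, whose union serves all subfields simultaneously.\<close>
  define T where "T = {(x, x', t). x \<in> sep_closure ?K \<and> x' \<in> sep_closure ?K \<and> t \<in> sep_closure ?K \<and>
     x \<noteq> 0 \<and> x' \<noteq> 0 \<and> x \<noteq> x' \<and> admissible t}"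
  have "countable (UNIV :: 'a alg_closure set)"
    by (rule countable_alg_closure) (use countable_fgen[OF countable_finite[OF S(1)]] S(2) in simp)
  then have "countable (UNIV \<times> UNIV \<times> UNIV :: ('a alg_closure \<times> 'a alg_closure \<times> 'a alg_closure) set)"
    by (intro countable_SIGMA)
  then have "countable T" by (rule countable_subset[rotated]) auto
  then have "AE \<sigma> in M. \<forall>(x, x', t)\<in>T. (\<forall>i<e. \<sigma> i x = x \<and> \<sigma> i x' = x' \<and> \<sigma> i t = t) \<longrightarrow>
      (\<exists>c\<in>GP.coeffs_ok x x' t. GP.good x x' c \<sigma>)"
    by (intro AE_ball_countable') (auto simp: T_def intro!: GP.AE_good)
  then show ?thesis using AE_space
  proof eventually_elim
    case (elim \<sigma>)
    let ?M = "fixed_field e \<sigma>"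
    show ?case
    proof
      assume "\<exists>E. E \<subset> ?M \<and> galois_extension E ?M"
      then obtain E where E: "E \<subset> ?M" "galois_extension E ?M" by blast
      have Ef: "subfld E" using E(2) by (simp add: galois_extension_def subfield_of_type_iff)
      obtain x x' where x: "x \<in> ?M" "x' \<in> ?M" "x \<noteq> 0" "x' \<noteq> 0" "x \<noteq> x'"
        and conj: "\<And>c y y'. c \<in> E \<Longrightarrow> y \<in> ?M \<Longrightarrow> y ^ 2 + y = c * x \<Longrightarrow> y' ^ 2 + y' = c * x' \<Longrightarrow> y' \<in> ?M"
        using galois_conjugate_pair[OF E(2,1)] by blast
      have "\<exists>t\<in>E. admissible t"
      proof (rule exists_admissible[OF Ef])
        show "finite (to_ac ` S)" using S by simp
        show "infinite (fgen (to_ac ` S))" using assms(1) unfolding KS[symmetric] base_field_def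
          by (metis finite_imageD inj_to_ac)
        fix s assume "s \<in> to_ac ` S"
        \<comment> \<open>The fixed field contains the base field and is separable over E, so the
          generators of the base field are algebraic over E even if they do not lie in it.\<close>
        then have sK: "s \<in> ?K" by (auto simp: base_field_def)
        then have "s \<in> ?M" using base_subset_sep_closure[OF base_field_subfld alg] gal_groupD(4)[OF GP.spaceD[OF elim(2)]]
          by (auto simp: fixed_field_def sep_closure_field_def)
        then show "alg_over E s" using E(2) separable_imp_alg_over
          by (auto simp: galois_extension_def separable_extension_def)
      qed
      then obtain t where t: "t \<in> E" "admissible t" by blast
      then have "t \<in> ?M" using E(1) by blast
      then have "(x, x', t) \<in> T" "\<forall>i<e. \<sigma> i x = x \<and> \<sigma> i x' = x' \<and> \<sigma> i t = t"
        using x t by (auto simp: T_def fixed_field_def sep_closure_field_def)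
      then obtain c where c: "c \<in> GP.coeffs_ok x x' t" "GP.good x x' c \<sigma>" using elim(1) by blast
      have xs: "x \<in> sep_closure ?K" "x' \<in> sep_closure ?K" "t \<in> sep_closure ?K" "x \<noteq> 0" "x' \<noteq> 0" "x \<noteq> x'"
        using \<open>(x, x', t) \<in> T\<close> by (auto simp: T_def)
      note defs = GP.coeffs_ok_def[OF xs t(2)] GP.good_def[OF xs t(2)]
      have "as_root (c * x) \<in> ?M" using c unfolding defs
        by (auto simp: fixed_field_def sep_closure_field_def)
      \<comment> \<open>E contains \<open>t\<close> and therefore the ring generated by it; only now
        does the coefficient found independently of E turn out to lie in E.\<close>
      moreover have "c \<in> E" using c(1) base_ring_subset[OF subfld_subrng[OF Ef] t(1)] by (auto simp: defs)
      ultimately have "as_root (c * x') \<in> ?M" using conj as_root by blast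
      then show False using c(2) unfolding defs by (auto simp: fixed_field_def)
    qed
  qed
qed

end
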